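(* Let $F\in\mathcal{C}^2_{\mathbb{X}_n}\cap L^2(\Omega)$. Given continuous functions $g_k$, $1\le k\le n$, satisfying $\mathbb{E}|g_k(X_k)|<\infty$ and $\mathbb{E}[g_k(X_k)]=0$, define $$\nabla_F:=\sum_{k=1}^n\partial_kF\,\mathcal{L}_kg_k,\qquad \mathcal{L}_kg_k=\mathcal{L}_kg_k(X_k):=\frac{\int_{X_k}^\infty g_k(x)p_k(x)\,dx}{p_k(X_k)}.$$ Assume that $\nabla_F\ne0$ a.s. and that the random variables $\frac{\sum_{k=1}^ng_k(X_k)}{\nabla_F}$ and $\frac{\sum_{k=1}^n\partial_k\nabla_F\,\mathcal{L}_kg_k}{\nabla_F^2}$ are in $L^1(\Omega)$. Then the law of $F$ has an absolutely continuous density given by $$p_F(x)=\mathbb{E}\left[\mathbf{1}_{\{F>x\}}\left(\frac{\sum_{k=1}^ng_k(X_k)}{\nabla_F}+\frac{\sum_{k=1}^n\partial_k\nabla_F\,\mathcal{L}_kg_k}{\nabla_F^2}\right)\right].$$ Moreover, the score function $\rho_F=p_F'/p_F$ satisfies $$\rho_F(x)=-\mathbb{E}\left[\frac{\sum_{k=1}^ng_k(X_k)}{\nabla_F}+\frac{\sum_{k=1}^n\partial_k\nabla_F\,\mathcal{L}_kg_k}{\nabla_F^2}\,\bigg|\,F=x\right].$$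
   Context: Setting. $(X_k)_{k\ge1}$ are independent real random variables (not necessarily identically distributed) with $\mathbb{E}[X_k]=0$, $\mathrm{Var}(X_k)=1$. Each $X_k$ has a density $p_k$ supported on a connected interval $I_k\subseteq\mathbb{R}$ (taken open), $p_k$ being positive and differentiable on $I_k$ and zero outside. $\mathbb{X}_n=(X_1,\dots,X_n)$, with range $I_1\times\cdots\times I_n$; $L^p(\Omega)$ is the space of random variables with $(\mathbb{E}|X|^p)^{1/p}<\infty$. $\mathcal{C}^k_{\mathbb{X}_n}$ is the set of random variables $F(\mathbb{X}_n)$ with $F$ a $k$-times continuously differentiable function on the range of $\mathbb{X}_n$; one writes $F$ for $F(\mathbb{X}_n)$, and $\partial_kF$ for the partial derivative in the $k$-th variable evaluated at $\mathbb{X}_n$. The quantity $\partial_k\nabla_F$ is the $k$-th partial derivative of $\nabla_F$ viewed as a function of $\mathbb{X}_n$. *)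

theory Defs
  imports "HOL-Probability.Probability"
begin

definition partial_deriv :: "'n \<Rightarrow> (real ^ 'n \<Rightarrow> real) \<Rightarrow> real ^ 'n \<Rightarrow> real" where
  "partial_deriv k f x = deriv (\<lambda>t. f (x + t *\<^sub>R axis k 1)) 0"

text \<open>\<open>m\<close>-times continuously differentiable functions; only meant for open \<open>S\<close>, since
  \<^const>\<open>partial_deriv\<close> is two-sided. Values of \<open>f\<close> outside \<open>S\<close> are irrelevant.\<close>

primrec Ck_on :: "nat \<Rightarrow> (real ^ 'n) set \<Rightarrow> (real ^ 'n \<Rightarrow> real) \<Rightarrow> bool" where
  "Ck_on 0 S f \<longleftrightarrow> continuous_on S f"
| "Ck_on (Suc m) S f \<longleftrightarrow>
     f differentiable_on S \<and> (\<forall>k. Ck_on m S (partial_deriv k f))"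

definition random_vec :: "('n \<Rightarrow> 'a \<Rightarrow> real) \<Rightarrow> 'a \<Rightarrow> real ^ 'n" where
  "random_vec X \<omega> = (\<chi> k. X k \<omega>)"

text \<open>The operator \<open>\<L>\<^sub>k\<close>, where \<open>q\<close> is the density \<open>p\<^sub>k\<close> of \<open>X\<^sub>k\<close>.\<close>

definition Lop :: "(real \<Rightarrow> real) \<Rightarrow> (real \<Rightarrow> real) \<Rightarrow> real \<Rightarrow> real" where
  "Lop q h y = (LBINT x:{y..}. h x * q x) / q y"

definition nabla ::
  "('n \<Rightarrow> real \<Rightarrow> real) \<Rightarrow> ('n \<Rightarrow> real \<Rightarrow> real) \<Rightarrow> (real ^ 'n \<Rightarrow> real) \<Rightarrow> real ^ 'n \<Rightarrow> real" where
  "nabla p g F x = (\<Sum>k\<in>UNIV. partial_deriv k F x * Lop (p k) (g k) (x $ k))"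

definition weight1 ::
  "('n \<Rightarrow> real \<Rightarrow> real) \<Rightarrow> ('n \<Rightarrow> real \<Rightarrow> real) \<Rightarrow> (real ^ 'n \<Rightarrow> real) \<Rightarrow> real ^ 'n \<Rightarrow> real" where
  "weight1 p g F x = (\<Sum>k\<in>UNIV. g k (x $ k)) / nabla p g F x"

definition weight2 ::
  "('n \<Rightarrow> real \<Rightarrow> real) \<Rightarrow> ('n \<Rightarrow> real \<Rightarrow> real) \<Rightarrow> (real ^ 'n \<Rightarrow> real) \<Rightarrow> real ^ 'n \<Rightarrow> real" where
  "weight2 p g F x =
     (\<Sum>k\<in>UNIV. partial_deriv k (nabla p g F) x * Lop (p k) (g k) (x $ k)) / (nabla p g F x)\<^sup>2"

definition weighted_tail :: "'a measure \<Rightarrow> ('a \<Rightarrow> real) \<Rightarrow> ('a \<Rightarrow> real) \<Rightarrow> real \<Rightarrow> real" where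
  "weighted_tail M Y H x = (\<integral>\<omega>. indicator {\<omega>. Y \<omega> > x} \<omega> * H \<omega> \<partial>M)"

definition score :: "(real \<Rightarrow> real) \<Rightarrow> real \<Rightarrow> real" where
  "score f x = deriv f x / f x"

text \<open>Absolute continuity of a function on the whole real line. (The library's
  \<^const>\<open>absolutely_continuous\<close> is about pairs of measures.)\<close>

definition abs_continuous_fun :: "(real \<Rightarrow> real) \<Rightarrow> bool" where
  "abs_continuous_fun f \<longleftrightarrow>
     (\<forall>\<epsilon>>0. \<exists>\<delta>>0. \<forall>D :: (real \<times> real) set.
        finite D \<and> (\<forall>(a, b)\<in>D. a \<le> b) \<and> disjoint_family_on (\<lambda>(a, b). {a<..<b}) D \<and>
        (\<Sum>(a, b)\<in>D. b - a) < \<delta>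
        \<longrightarrow> (\<Sum>(a, b)\<in>D. \<bar>f b - f a\<bar>) < \<epsilon>)"

text \<open>\<open>h\<close> is a version of the function \<open>x \<mapsto> E[Z | Y = x]\<close>, i.e. a Borel function with
  \<open>E[Z | \<sigma>(Y)] = h(Y)\<close> almost surely; it is unique up to null sets of the law of \<open>Y\<close>.\<close>

definition cond_exp_version ::
  "'a measure \<Rightarrow> ('a \<Rightarrow> real) \<Rightarrow> ('a \<Rightarrow> real) \<Rightarrow> (real \<Rightarrow> real) \<Rightarrow> bool" where
  "cond_exp_version M Y Z h \<longleftrightarrow>
     h \<in> borel_measurable borel \<and>
     (AE \<omega> in M. real_cond_exp M (vimage_algebra (space M) Y borel) Z \<omega> = h (Y \<omega>))"

end

theory Submission
  imports Defs
begin

text \<open>Let \<open>P\<close> be the law of \<open>(X\<^sub>1, \<dots>, X\<^sub>n)\<close> and let \<open>G\<^sub>k = p\<^sub>k \<L>\<^sub>kg\<^sub>k\<close> be the tail integral of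
  \<open>g\<^sub>kp\<^sub>k\<close>. Since \<open>G\<^sub>k' = - g\<^sub>kp\<^sub>k\<close> and \<open>G\<^sub>k\<close> tends to \<open>0\<close> at both ends of \<open>I\<^sub>k\<close>, the vector field with
  components \<open>\<L>\<^sub>kg\<^sub>k\<close> has divergence \<open>- \<Sum> g\<^sub>k\<close> with respect to \<open>P\<close> and no flux through the boundary:
  if \<open>D u = \<Sum> \<partial>\<^sub>ku \<L>\<^sub>kg\<^sub>k\<close> denotes the derivative along the field, then \<open>E[D u] = E[u \<Sum> g\<^sub>k]\<close>
  (\<open>integration_by_parts\<close>). For a test function \<open>\<phi>\<close>, the choice \<open>u = \<phi>(F) / \<nabla>\<^sub>F\<close> with
  \<open>\<nabla>\<^sub>F = D F\<close> turns this into \<open>E[\<phi>'(F)] = E[\<phi>(F) H]\<close>, where \<open>H\<close> is the sum of the two weights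
  (\<open>weighted_integration_by_parts\<close>). Because \<open>\<nabla>\<^sub>F\<close> may vanish on a null set, \<open>1 / z\<close> is
  replaced by \<open>z / (z\<^sup>2 + \<epsilon>)\<close>, and \<open>\<epsilon>\<close> tends to \<open>0\<close> by dominated convergence: this is where the two
  weights must be integrable one by one.

  The delicate point is the proof of \<open>integration_by_parts\<close>. The densities are differentiable,
  but their derivatives need not be locally integrable, and then neither need \<open>(\<L>\<^sub>kg\<^sub>k)'\<close>, which
  occurs in \<open>\<partial>\<^sub>k\<nabla>\<^sub>F\<close>. Only the sum over \<open>k\<close> is known to be integrable, so one cannot integrate by
  parts in one coordinate after another. Instead the field is straightened. On an interval where
  \<open>G\<^sub>k\<close> does not vanish, \<open>s\<^sub>k = \<integral> p\<^sub>k / G\<^sub>k\<close> is a coordinate in which the field is \<open>d/ds\<^sub>k\<close>; on the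
  zeros of \<open>G\<^sub>k\<close> the field does not move the \<open>k\<close>-th coordinate at all. Countably many products of such
  charts (\<open>flow_chart_cover\<close>) carry the law \<open>P\<close>. In each of them \<open>D\<close> is the derivative in
  one constant direction, so that only the sum is ever integrated, and the claim is the invariance of
  Lebesgue measure under translations (\<open>integral_directional_derivative_zero\<close>). Cutoffs that are
  functions of \<open>G\<^sub>k\<close> make the integrands vanish near the boundary of a chart, and the error that
  they create tends to \<open>0\<close>.

  It remains to read off the density. With \<open>\<phi>'\<close> approximating the indicator of \<open>(a, b]\<close> the formula
  becomes \<open>P(a < F \<le> b) = \<integral>\<^sub>a\<^sup>b E[1\<^bsub>F > x\<^esub> H] dx\<close>. So \<open>p\<^sub>F(x) = E[1\<^bsub>F > x\<^esub> H]\<close> is a density; it is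
  absolutely continuous because \<open>|p\<^sub>F(b) - p\<^sub>F(a)| \<le> E[1\<^bsub>a < F \<le> b\<^esub> |H|]\<close>. Conditioning on \<open>F\<close> gives
  \<open>p\<^sub>F(x) = \<integral>\<^sub>x\<^sup>\<infinity> h p\<^sub>F\<close> for every version \<open>h\<close> of \<open>E[H | F = \<cdot>]\<close>, and Lebesgue's differentiation
  theorem yields \<open>p\<^sub>F' = - h p\<^sub>F\<close> almost everywhere, which is the formula for the score.\<close>

section \<open>Lebesgue's differentiation theorem on the line\<close>

text \<open>Around every bad point \<open>x\<close> there are arbitrarily short intervals with endpoint \<open>x\<close> on which the
  Riemann term \<open>f x * length\<close> misses the integral of \<open>f\<close> by more than \<open>\<eta> * length\<close>. By Vitali's
  covering theorem disjoint intervals of this kind cover almost all bad points. If they are taken fine for the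
  gauge of a small \<open>e\<close>, Henstock's lemma bounds the total error by \<open>2 * e\<close>, hence their total
  length by \<open>2 * e / \<eta>\<close>.\<close>

lemma negligible_large_difference_quotient_error:
  fixes f :: "real \<Rightarrow> real"
  assumes f: "f integrable_on {a..b}" and \<eta>: "\<eta> > 0"
  defines "F \<equiv> \<lambda>u. integral {a..u} f"
  shows "negligible {x \<in> {a<..<b}. \<forall>d>0. \<exists>v\<in>{a<..<b}. v \<noteq> x \<and> \<bar>v - x\<bar> < d \<and>
           \<bar>F v - F x - f x * (v - x)\<bar> > \<eta> * \<bar>v - x\<bar>}" (is "negligible ?E")
  unfolding negligible_outer_le
proof (intro allI impI)
  fix \<epsilon> :: real assume \<epsilon>: "\<epsilon> > 0"
  \<comment> \<open>the factor 2 is lost in Henstock's lemma\<close>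
  define e where "e = \<epsilon> * \<eta> / 2"
  have e: "e > 0" using \<epsilon> \<eta> by (simp add: e_def)
  obtain \<gamma> where \<gamma>: "gauge \<gamma>" and fine: "\<And>p. p tagged_division_of cbox a b \<Longrightarrow> \<gamma> fine p \<Longrightarrow>
      norm ((\<Sum>(x,k)\<in>p. measure lborel k *\<^sub>R f x) - integral (cbox a b) f) < e"
    using has_integral_integral[THEN iffD1, OF f] e unfolding has_integral_real[symmetric] has_integral
    by (metis box_real(2) has_integral has_integral_integral f)
  define seg where "seg = (\<lambda>(x::real, v). {min x v..max x v})"
  define K where "K = {(x, v). x \<in> ?E \<and> v \<in> {a<..<b} \<and> v \<noteq> x \<and>
           \<bar>F v - F x - f x * (v - x)\<bar> > \<eta> * \<bar>v - x\<bar> \<and> seg (x, v) \<subseteq> \<gamma> x}"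
  define c where "c = (\<lambda>(x::real, v). (x + v) / 2)"
  define r where "r = (\<lambda>(x::real, v). \<bar>v - x\<bar> / 2)"
  have seg: "cball (c i) (r i) = seg i" for i
    by (cases i) (auto simp: c_def r_def seg_def cball_def dist_real_def abs_if min_def max_def field_simps split: if_splits)
  have cov: "\<exists>i. i \<in> K \<and> x \<in> cball (c i) (r i) \<and> r i < d" if x: "x \<in> ?E" and d: "d > 0" for x d
  proof -
    from \<gamma> have "open (\<gamma> x)" "x \<in> \<gamma> x" by (auto simp: gauge_def)
    then obtain \<rho> where \<rho>: "\<rho> > 0" "cball x \<rho> \<subseteq> \<gamma> x" by (meson open_contains_cball)
    have "min \<rho> d > 0" using \<rho> d by auto
    then obtain v where v: "v\<in>{a<..<b}" "v \<noteq> x" "\<bar>v - x\<bar> < min \<rho> d"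
        "\<bar>F v - F x - f x * (v - x)\<bar> > \<eta> * \<bar>v - x\<bar>" using x by blast
    have "seg (x, v) \<subseteq> cball x \<rho>" using v(3) by (auto simp: seg_def dist_real_def)
    then have "(x, v) \<in> K" using x v \<rho> by (auto simp: K_def)
    moreover have "x \<in> cball (c (x,v)) (r (x,v))" unfolding seg by (auto simp: seg_def)
    moreover have "r (x,v) < d" using v by (auto simp: r_def)
    ultimately show ?thesis by blast
  qed
  have rpos: "\<And>i. i \<in> K \<Longrightarrow> 0 < r i" by (auto simp: K_def r_def)
  obtain C where C: "countable C" "C \<subseteq> K"
     "pairwise (\<lambda>i j. disjnt (cball (c i) (r i)) (cball (c j) (r j))) C"
     "negligible (?E - (\<Union>i \<in> C. cball (c i) (r i)))"
    using Vitali_covering_theorem_cballs[of K r ?E c, OF rpos cov] by blast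
  have bound: "measure lebesgue (\<Union>i\<in>C0. seg i) \<le> \<epsilon>" if C0: "C0 \<subseteq> C" "finite C0" for C0
  proof -
    define p where "p = (\<lambda>i. (fst i, seg i)) ` C0"
    have disj: "seg i \<inter> seg j = {}" if "i \<in> C0" "j \<in> C0" "i \<noteq> j" for i j
      using C(3) C0 that unfolding pairwise_def disjnt_def seg by blast
    have ne: "seg i \<noteq> {}" for i by (cases i) (auto simp: seg_def)
    have inj: "inj_on (\<lambda>i. (fst i, seg i)) C0"
      using disj ne by (intro inj_onI) (metis Pair_inject inf.idem)
    have sub: "seg i \<subseteq> {a<..<b}" if "i \<in> C0" for i
    proof -
      obtain x v where i: "i = (x, v)" by (cases i)
      have "(x, v) \<in> K" using that C0 C(2) i by auto
      then have "a < x" "x < b" "a < v" "v < b" by (auto simp: K_def)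
      then show ?thesis by (auto simp: seg_def i)
    qed
    have tag: "p tagged_partial_division_of (cbox a b)"
      unfolding tagged_partial_division_of_def p_def
    proof (intro conjI allI impI; (elim conjE imageE)?)
      show "finite ((\<lambda>i. (fst i, seg i)) ` C0)" using C0 by auto
    next
      fix x k i assume "(x, k) = (fst i, seg i)" "i \<in> C0"
      then show "x \<in> k" "k \<subseteq> cbox a b" "\<exists>a b. k = cbox a b"
        using sub[of i] by (auto simp: seg_def split: prod.splits) (metis box_real(2))?
    next
      fix x1 k1 x2 k2 i j assume "(x1, k1) = (fst i, seg i)" "i \<in> C0" "(x2, k2) = (fst j, seg j)" "j \<in> C0"
        "(x1, k1) \<noteq> (x2, k2)"
      then show "interior k1 \<inter> interior k2 = {}" using disj[of i j] interior_subset by (metis disjoint_iff prod.inject subset_iff)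
    qed
    have "seg i \<subseteq> \<gamma> (fst i)" if "i \<in> K" for i
      using that by (cases i) (auto simp: K_def)
    then have finep: "\<gamma> fine p" using C0 C(2) by (auto simp: fine_def p_def)
    have H: "(\<Sum>(x,k)\<in>p. norm (measure lborel k *\<^sub>R f x - integral k f)) \<le> 2 * real DIM(real) * e"
      by (rule Henstock_lemma_part2[OF _ e \<gamma> _ tag finep]) (use f fine in auto)
    have incr: "integral {u..w} f = F w - F u" if "a < u" "u \<le> w" "w < b" for u w
    proof -
      have "f integrable_on {a..w}" using f that by (rule_tac integrable_subinterval_real[OF f]) auto
      from Henstock_Kurzweil_Integration.integral_combine[OF _ _ this, of u] that show ?thesis
        unfolding F_def by auto
    qed
    have pt: "\<eta> * measure lborel (seg i) \<le> norm (measure lborel (seg i) *\<^sub>R f (fst i) - integral (seg i) f)" if "i \<in> C0" for i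
    proof -
      obtain x v where i: "i = (x, v)" by (cases i)
      have K: "(x,v) \<in> K" using that C0 C(2) i by auto
      then have *: "\<bar>F v - F x - f x * (v - x)\<bar> > \<eta> * \<bar>v - x\<bar>" "a < v" "v < b" "a < x" "x < b"
        by (auto simp: K_def)
      show ?thesis
      proof (cases "x \<le> v")
        case True
        then have "seg i = {x..v}" by (auto simp: i seg_def)
        with True * incr[of x v] show ?thesis by (auto simp: i abs_if algebra_simps split: if_splits)
      next
        case False
        then have "seg i = {v..x}" by (auto simp: i seg_def)
        with False * incr[of v x] show ?thesis by (auto simp: i abs_if algebra_simps split: if_splits)
      qed
    qed
    have "measure lebesgue (\<Union>i\<in>C0. seg i) \<le> (\<Sum>i\<in>C0. measure lebesgue (seg i))"
      by (rule measure_UNION_le) (use C0 in \<open>auto simp: seg_def split: prod.splits\<close>)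
    also have "\<dots> = (\<Sum>i\<in>C0. measure lborel (seg i))"
      by (auto intro!: sum.cong simp: seg_def split: prod.splits)
    finally have "\<eta> * measure lebesgue (\<Union>i\<in>C0. seg i) \<le> (\<Sum>i\<in>C0. \<eta> * measure lborel (seg i))"
      using \<eta> by (simp add: sum_distrib_left[symmetric])
    also have "\<dots> \<le> (\<Sum>i\<in>C0. norm (measure lborel (seg i) *\<^sub>R f (fst i) - integral (seg i) f))"
      by (intro sum_mono pt)
    also have "\<dots> = (\<Sum>(x,k)\<in>p. norm (measure lborel k *\<^sub>R f x - integral k f))"
      unfolding p_def by (subst sum.reindex[OF inj]) simp
    also have "\<dots> \<le> \<eta> * \<epsilon>" using H by (simp add: e_def algebra_simps)
    finally show ?thesis using \<eta> by simp
  qed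
  have meas: "\<And>i. seg i \<in> lmeasurable" by (auto simp: seg_def split: prod.splits)
  define T where "T = (\<Union>i\<in>C. seg i) \<union> (?E - (\<Union>i \<in> C. cball (c i) (r i)))"
  have U: "(\<Union>i\<in>C. seg i) \<in> lmeasurable" "measure lebesgue (\<Union>i\<in>C. seg i) \<le> \<epsilon>"
    using fmeasurable_UN_bound[OF C(1) meas bound] measure_UN_bound[OF C(1) meas bound] by auto
  have "T \<in> lmeasurable" "measure lebesgue T \<le> \<epsilon>"
    unfolding T_def using U C(4)
    by (auto simp: negligible_imp_measurable fmeasurable.Un measure_Un_null_set negligible_iff_null_sets[symmetric])
  moreover have "?E \<subseteq> T" by (auto simp: T_def seg)
  ultimately show "\<exists>T. ?E \<subseteq> T \<and> T \<in> lmeasurable \<and> measure lebesgue T \<le> \<epsilon>" by blast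
qed

lemma indefinite_integral_has_derivative_ae:
  fixes f :: "real \<Rightarrow> real"
  assumes f: "f integrable_on {a..b}"
  shows "negligible {x \<in> {a<..<b}. \<not> ((\<lambda>u. integral {a..u} f) has_real_derivative f x) (at x)}"
proof -
  define F where "F = (\<lambda>u. integral {a..u} f)"
  define E where "E = (\<lambda>\<eta>. {x \<in> {a<..<b}. \<forall>d>0. \<exists>v\<in>{a<..<b}. v \<noteq> x \<and> \<bar>v - x\<bar> < d \<and>
           \<bar>F v - F x - f x * (v - x)\<bar> > \<eta> * \<bar>v - x\<bar>})"
  have "negligible (\<Union>n. E (inverse (real (Suc n))))"
    unfolding E_def F_def
    by (rule negligible_Union_nat, rule negligible_large_difference_quotient_error[OF f]) simp
  moreover have "(F has_real_derivative f x) (at x)"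
    if x: "x \<in> {a<..<b}" and nE: "\<And>n. x \<notin> E (inverse (real (Suc n)))" for x
    unfolding has_field_derivative_def has_derivative_at
  proof (intro conjI)
    show "bounded_linear ((*) (f x))" by (rule bounded_linear_mult_right)
    show "(\<lambda>h. norm (F (x + h) - F x - f x * h) / norm h) \<midarrow>0\<rightarrow> 0"
      unfolding LIM_eq
    proof (intro allI impI)
      fix \<epsilon> :: real assume "\<epsilon> > 0"
      then obtain n where n: "inverse (real (Suc n)) < \<epsilon>" using reals_Archimedean by blast
      from nE[of n] x obtain d where d: "d > 0" "\<And>v. v\<in>{a<..<b} \<Longrightarrow> v \<noteq> x \<Longrightarrow> \<bar>v - x\<bar> < d \<Longrightarrow>
           \<bar>F v - F x - f x * (v - x)\<bar> \<le> inverse (real (Suc n)) * \<bar>v - x\<bar>"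
        unfolding E_def mem_Collect_eq by (metis not_less)
      define s where "s = min d (min (x - a) (b - x))"
      have "s > 0" using d x by (auto simp: s_def)
      moreover have "norm (norm (F (x + h) - F x - f x * h) / norm h - 0) < \<epsilon>" if "h \<noteq> 0" "norm (h - 0) < s" for h
      proof -
        have "x + h \<in> {a<..<b}" "\<bar>x + h - x\<bar> < d" using that x by (auto simp: s_def)
        from d(2)[OF this(1) _ this(2)] that have "\<bar>F (x + h) - F x - f x * h\<bar> \<le> inverse (real (Suc n)) * \<bar>h\<bar>" by auto
        then have "\<bar>F (x + h) - F x - f x * h\<bar> / \<bar>h\<bar> \<le> inverse (real (Suc n))"
          using that by (simp add: divide_le_eq)
        then show ?thesis using n by simp
      qed
      ultimately show "\<exists>s>0. \<forall>h. h \<noteq> 0 \<and> norm (h - 0) < s \<longrightarrow> norm (norm (F (x + h) - F x - f x * h) / norm h - 0) < \<epsilon>"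
        by blast
    qed
  qed
  ultimately show ?thesis
    by (elim negligible_subset) (auto simp: F_def)
qed

section \<open>Smoothed positive part and step function\<close>

text \<open>A continuously differentiable approximation of the positive part of \<open>z\<close> that vanishes for
  \<open>z \<le> \<delta>\<close>; beyond \<open>\<delta>\<close> it is \<open>(z - \<delta>)\<^sup>2 / z\<close>. It serves twice: differences of shifted copies are test
  functions, and applied to the absolute value of a flux it cuts off a neighbourhood of the zeros without
  increasing the derivative, since \<open>soft_step\<close>, its derivative, takes values between \<open>0\<close> and \<open>1\<close>.\<close>

definition soft_pos :: "real \<Rightarrow> real \<Rightarrow> real" where
  "soft_pos \<delta> z = (if z \<le> \<delta> then 0 else z - 2 * \<delta> + \<delta>\<^sup>2 / z)"

definition soft_step :: "real \<Rightarrow> real \<Rightarrow> real" where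
  "soft_step \<delta> z = (if z \<le> \<delta> then 0 else 1 - \<delta>\<^sup>2 / z\<^sup>2)"

lemma soft_step_bounds:
  assumes "\<delta> > 0" shows "0 \<le> soft_step \<delta> z" "soft_step \<delta> z \<le> 1"
proof -
  show "soft_step \<delta> z \<le> 1" by (auto simp: soft_step_def)
  have "\<delta>\<^sup>2 \<le> z\<^sup>2" if "\<delta> < z" using that assms by (intro power_mono) auto
  then show "0 \<le> soft_step \<delta> z" using assms by (auto simp: soft_step_def divide_le_eq)
qed

lemma soft_pos_eq: "\<delta> < z \<Longrightarrow> \<delta> > 0 \<Longrightarrow> soft_pos \<delta> z = (z - \<delta>)\<^sup>2 / z"
  by (simp add: soft_pos_def field_simps power2_eq_square)

lemma soft_pos_has_derivative:
  assumes \<delta>: "\<delta> > 0"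
  shows "(soft_pos \<delta> has_real_derivative soft_step \<delta> z) (at z)"
proof -
  consider "z < \<delta>" | "z > \<delta>" | "z = \<delta>" by linarith
  then show ?thesis
  proof cases
    case 1
    have "eventually (\<lambda>y. y < \<delta>) (nhds z)" using 1 by (rule order_tendstoD(2)[OF filterlim_ident])
    then have "eventually (\<lambda>y. soft_pos \<delta> y = 0) (nhds z)"
      by eventually_elim (simp add: soft_pos_def)
    with 1 show ?thesis by (subst DERIV_cong_ev[OF refl _ refl]) (auto simp: soft_step_def)
  next
    case 2
    have "eventually (\<lambda>y. y > \<delta>) (nhds z)" using 2 by (rule order_tendstoD(1)[OF filterlim_ident])
    then have ev: "eventually (\<lambda>y. soft_pos \<delta> y = y - 2 * \<delta> + \<delta>\<^sup>2 / y) (nhds z)"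
      by eventually_elim (simp add: soft_pos_def)
    have "((\<lambda>y. y - 2 * \<delta> + \<delta>\<^sup>2 / y) has_real_derivative soft_step \<delta> z) (at z)"
      using 2 \<delta> by (auto intro!: derivative_eq_intros simp: soft_step_def power2_eq_square)
    then show ?thesis by (subst DERIV_cong_ev[OF refl ev refl])
  next
    case 3
    have lim: "(\<lambda>h. (soft_pos \<delta> (z + h) - soft_pos \<delta> z) / h) \<midarrow>0\<rightarrow> 0"
    proof (rule Lim_null_comparison)
      show "eventually (\<lambda>h. norm ((soft_pos \<delta> (z + h) - soft_pos \<delta> z) / h) \<le> \<bar>h\<bar> / \<delta>) (at 0)"
      proof (rule always_eventually, rule allI)
        fix h :: real
        show "norm ((soft_pos \<delta> (z + h) - soft_pos \<delta> z) / h) \<le> \<bar>h\<bar> / \<delta>"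
        proof (cases "h > 0")
          case True
          then have "soft_pos \<delta> (z + h) = h\<^sup>2 / (\<delta> + h)" using 3 \<delta> by (simp add: soft_pos_eq)
          then have "norm ((soft_pos \<delta> (z + h) - soft_pos \<delta> z) / h) = h / (\<delta> + h)"
            using True 3 \<delta> by (simp add: soft_pos_def power2_eq_square)
          also have "\<dots> \<le> h / \<delta>" using True \<delta> by (intro divide_left_mono) auto
          finally show ?thesis using True by simp
        next
          case False
          then have "soft_pos \<delta> (z + h) = 0" "soft_pos \<delta> z = 0" using 3 by (auto simp: soft_pos_def)
          then show ?thesis using \<delta> by simp
        qed
      qed
      show "((\<lambda>h. \<bar>h\<bar> / \<delta>) \<longlongrightarrow> 0) (at 0)" using \<delta> by (auto intro!: tendsto_eq_intros)
    qed
    moreover have "soft_step \<delta> z = 0" using 3 by (simp add: soft_step_def)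
    ultimately show ?thesis by (simp only: DERIV_def)
  qed
qed

lemma continuous_on_soft_step: assumes "\<delta> > 0" shows "continuous_on A (soft_step \<delta>)"
proof -
  have "continuous_on ({..\<delta>} \<union> {\<delta>..}) (\<lambda>z. if z \<le> \<delta> then 0 else 1 - \<delta>\<^sup>2 / z\<^sup>2)"
    using assms by (intro continuous_on_If continuous_intros) auto
  moreover have "{..\<delta>} \<union> {\<delta>..} = UNIV" by auto
  moreover have "soft_step \<delta> = (\<lambda>z. if z \<le> \<delta> then 0 else 1 - \<delta>\<^sup>2 / z\<^sup>2)" by (auto simp: soft_step_def)
  ultimately have "continuous_on UNIV (soft_step \<delta>)" by simp
  then show ?thesis by (rule continuous_on_subset) auto
qed

lemma soft_pos_nonneg: "\<delta> > 0 \<Longrightarrow> 0 \<le> soft_pos \<delta> z"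
  using soft_pos_eq[of \<delta> z] by (cases "z \<le> \<delta>") (auto simp: soft_pos_def)

lemma soft_pos_le: assumes "\<delta> > 0" "0 \<le> z" shows "soft_pos \<delta> z \<le> z"
proof (cases "z \<le> \<delta>")
  case False
  then have "\<delta>\<^sup>2 / z \<le> \<delta>" using assms by (simp add: divide_le_eq power2_eq_square)
  then show ?thesis using False assms by (simp add: soft_pos_def)
qed (use assms in \<open>auto simp: soft_pos_def\<close>)

lemma soft_pos_lipschitz:
  assumes \<delta>: "\<delta> > 0" shows "\<bar>soft_pos \<delta> y - soft_pos \<delta> x\<bar> \<le> \<bar>y - x\<bar>"
proof -
  have "norm (soft_pos \<delta> y - soft_pos \<delta> x) \<le> 1 * norm (y - x)"
    by (rule field_differentiable_bound[where S=UNIV and f'="soft_step \<delta>"])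
      (auto intro: has_field_derivative_at_within soft_pos_has_derivative[OF \<delta>] simp: soft_step_bounds[OF \<delta>])
  then show ?thesis by simp
qed

lemma soft_pos_tendsto: "(\<lambda>n. soft_pos (1 / real (Suc n)) z) \<longlonglongrightarrow> max 0 z"
proof (cases "z > 0")
  case True
  have "eventually (\<lambda>n. 1 / real (Suc n) < z) sequentially"
    using LIMSEQ_inverse_real_of_nat True by (intro order_tendstoD(2)[where y=0]) (auto simp: inverse_eq_divide)
  then have "eventually (\<lambda>n. z - 2 * (1 / real (Suc n)) + (1 / real (Suc n))\<^sup>2 / z = soft_pos (1 / real (Suc n)) z) sequentially"
    by eventually_elim (simp add: soft_pos_def)
  moreover have "(\<lambda>n. z - 2 * (1 / real (Suc n)) + (1 / real (Suc n))\<^sup>2 / z) \<longlonglongrightarrow> z - 2 * 0 + 0\<^sup>2 / z"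
    using True LIMSEQ_inverse_real_of_nat by (intro tendsto_intros) (auto simp: inverse_eq_divide)
  ultimately show ?thesis using True by (auto elim: Lim_transform_eventually[rotated])
next
  case False
  then have "soft_pos (1 / real (Suc n)) z = 0" for n
    by (auto simp: soft_pos_def not_less intro: order_trans)
  then show ?thesis using False by simp
qed

lemma soft_step_tendsto: "(\<lambda>n. soft_step (1 / real (Suc n)) z) \<longlonglongrightarrow> (if z > 0 then 1 else 0)"
proof (cases "z > 0")
  case True
  have "eventually (\<lambda>n. 1 / real (Suc n) < z) sequentially"
    using LIMSEQ_inverse_real_of_nat True by (intro order_tendstoD(2)[where y=0]) (auto simp: inverse_eq_divide)
  then have "eventually (\<lambda>n. 1 - (1 / real (Suc n))\<^sup>2 / z\<^sup>2 = soft_step (1 / real (Suc n)) z) sequentially"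
    by eventually_elim (simp add: soft_step_def)
  moreover have "(\<lambda>n. 1 - (1 / real (Suc n))\<^sup>2 / z\<^sup>2) \<longlonglongrightarrow> 1 - 0\<^sup>2 / z\<^sup>2"
    using True LIMSEQ_inverse_real_of_nat by (intro tendsto_intros) (auto simp: inverse_eq_divide)
  ultimately show ?thesis using True by (auto elim: Lim_transform_eventually[rotated])
next
  case False
  then have "soft_step (1 / real (Suc n)) z = 0" for n
    by (auto simp: soft_step_def not_less intro: order_trans)
  then show ?thesis using False by simp
qed

section \<open>Conditional expectations as functions of a real variable\<close>

text \<open>The function is the density of the image of \<open>f \<cdot> M\<close> under \<open>Y\<close> with respect to the law
  of \<open>Y\<close>.\<close>

lemma (in prob_space) nonneg_cond_exp_factor:
  fixes Y f :: "'a \<Rightarrow> real"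
  assumes [measurable]: "Y \<in> borel_measurable M" and f: "integrable M f" and f0: "\<And>\<omega>. 0 \<le> f \<omega>"
  obtains h :: "real \<Rightarrow> real" where "h \<in> borel_measurable borel" "integrable M (\<lambda>\<omega>. h (Y \<omega>))"
    "\<And>A. A \<in> sets borel \<Longrightarrow> (\<integral>\<omega>. indicator A (Y \<omega>) * f \<omega> \<partial>M) = (\<integral>\<omega>. indicator A (Y \<omega>) * h (Y \<omega>) \<partial>M)"
proof -
  have [measurable]: "f \<in> borel_measurable M" using f by auto
  define D where "D = distr M borel Y"
  define K where "K = distr (density M (\<lambda>\<omega>. ennreal (f \<omega>))) borel Y"
  interpret D: prob_space D unfolding D_def by (rule prob_space_distr) measurable
  have sDK[measurable_cong, simp]: "sets D = sets borel" "sets K = sets borel" by (auto simp: D_def K_def)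
  have K: "emeasure K A = (\<integral>\<^sup>+\<omega>. ennreal (indicator A (Y \<omega>) * f \<omega>) \<partial>M)" if [measurable]: "A \<in> sets borel" for A
    unfolding K_def by (subst emeasure_distr) (auto simp: emeasure_density f0 mult.commute
        intro!: nn_integral_cong split: split_indicator)
  have "absolutely_continuous D K"
    unfolding absolutely_continuous_def
  proof
    fix A assume "A \<in> null_sets D"
    then have A[measurable]: "A \<in> sets borel" and "emeasure M (Y -` A \<inter> space M) = 0"
      by (auto simp: D_def null_sets_def emeasure_distr)
    then have "AE \<omega> in M. \<omega> \<notin> Y -` A \<inter> space M" by (intro AE_not_in null_setsI) auto
    then have "emeasure K A = (\<integral>\<^sup>+\<omega>. 0 \<partial>M)"
      unfolding K[OF A] by (intro nn_integral_cong_AE) (auto elim!: AE_mp simp: indicator_def)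
    then show "A \<in> null_sets K" using A by (auto simp: null_sets_def)
  qed
  then have RN: "density D (RN_deriv D K) = K" by (intro D.density_RN_deriv) (simp_all add: sDK)
  define R where "R = RN_deriv D K"
  have [measurable]: "R \<in> borel_measurable borel" unfolding R_def by (metis borel_measurable_RN_deriv measurable_cong_sets sDK(1))
  have KR: "emeasure K A = (\<integral>\<^sup>+\<omega>. R (Y \<omega>) * indicator A (Y \<omega>) \<partial>M)" if [measurable]: "A \<in> sets borel" for A
  proof -
    have "emeasure K A = emeasure (density D R) A" using RN by (simp add: R_def)
    also have "\<dots> = (\<integral>\<^sup>+y. R y * indicator A y \<partial>D)" by (rule emeasure_density) simp_all
    also have "\<dots> = (\<integral>\<^sup>+\<omega>. R (Y \<omega>) * indicator A (Y \<omega>) \<partial>M)" unfolding D_def by (rule nn_integral_distr) simp_all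
    finally show ?thesis .
  qed
  have "(\<integral>\<^sup>+\<omega>. R (Y \<omega>) \<partial>M) = (\<integral>\<^sup>+\<omega>. ennreal (f \<omega>) \<partial>M)"
    using K[of UNIV] KR[of UNIV] by simp
  also have "\<dots> < \<infinity>" using f f0 by (simp add: integrable_iff_bounded)
  finally have fin: "(\<integral>\<^sup>+\<omega>. R (Y \<omega>) \<partial>M) < \<infinity>" .
  then have AE: "AE \<omega> in M. R (Y \<omega>) \<noteq> \<infinity>" by (intro nn_integral_PInf_AE) auto
  define h where "h y = enn2real (R y)" for y
  have [measurable]: "h \<in> borel_measurable borel" unfolding h_def by measurable
  have AEh: "AE \<omega> in M. ennreal (h (Y \<omega>)) = R (Y \<omega>)"
    using AE by eventually_elim (auto simp: h_def less_top)
  have h0: "0 \<le> h y" for y by (simp add: h_def)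
  have ih: "integrable M (\<lambda>\<omega>. h (Y \<omega>))"
    using fin AEh by (intro integrableI_bounded) (auto simp: h0 cong: nn_integral_cong_AE)
  show ?thesis
  proof (rule that[OF _ ih])
    fix A :: "real set" assume [measurable]: "A \<in> sets borel"
    have "(\<integral>\<^sup>+\<omega>. ennreal (indicator A (Y \<omega>) * f \<omega>) \<partial>M) = (\<integral>\<^sup>+\<omega>. ennreal (indicator A (Y \<omega>) * h (Y \<omega>)) \<partial>M)"
      unfolding K[symmetric, OF \<open>A \<in> sets borel\<close>] KR[OF \<open>A \<in> sets borel\<close>]
      by (intro nn_integral_cong_AE, use AEh in eventually_elim) (auto split: split_indicator)
    then show "(\<integral>\<omega>. indicator A (Y \<omega>) * f \<omega> \<partial>M) = (\<integral>\<omega>. indicator A (Y \<omega>) * h (Y \<omega>) \<partial>M)"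
      using f0 h0 by (simp add: integral_eq_nn_integral)
  qed simp
qed

lemma (in prob_space) cond_exp_version_exists:
  fixes Y f :: "'a \<Rightarrow> real"
  assumes Y[measurable]: "Y \<in> borel_measurable M" and f: "integrable M f"
  shows "\<exists>h. cond_exp_version M Y f h"
proof -
  let ?F = "vimage_algebra (space M) Y borel"
  interpret F: finite_measure_subalgebra M ?F
    by standard (auto simp: subalgebra_def sets_vimage_algebra2)
  have P1: "integrable M (\<lambda>\<omega>. max 0 (f \<omega>))" "\<And>\<omega>. 0 \<le> max 0 (f \<omega>)"
    and P2: "integrable M (\<lambda>\<omega>. max 0 (- f \<omega>))" "\<And>\<omega>. 0 \<le> max 0 (- f \<omega>)" using f by auto
  obtain h1 where h1: "h1 \<in> borel_measurable borel" "integrable M (\<lambda>\<omega>. h1 (Y \<omega>))"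
    "\<And>A. A \<in> sets borel \<Longrightarrow> (\<integral>\<omega>. indicator A (Y \<omega>) * max 0 (f \<omega>) \<partial>M) = (\<integral>\<omega>. indicator A (Y \<omega>) * h1 (Y \<omega>) \<partial>M)"
    using nonneg_cond_exp_factor[OF Y P1(1,2)] by blast
  obtain h2 where h2: "h2 \<in> borel_measurable borel" "integrable M (\<lambda>\<omega>. h2 (Y \<omega>))"
    "\<And>A. A \<in> sets borel \<Longrightarrow> (\<integral>\<omega>. indicator A (Y \<omega>) * max 0 (- f \<omega>) \<partial>M) = (\<integral>\<omega>. indicator A (Y \<omega>) * h2 (Y \<omega>) \<partial>M)"
    using nonneg_cond_exp_factor[OF Y P2(1,2)] by blast
  have I: "integrable M (\<lambda>\<omega>. indicator A (Y \<omega>) * u \<omega>)" if [measurable]: "A \<in> sets borel" and u: "integrable M u" for A and u :: "'a \<Rightarrow> real"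
    using u by (intro Bochner_Integration.integrable_bound[OF u]) (auto split: split_indicator)
  define h where "h y = h1 y - h2 y" for y
  have [measurable]: "h \<in> borel_measurable borel" using h1 h2 unfolding h_def by auto
  have "AE \<omega> in M. real_cond_exp M ?F f \<omega> = h (Y \<omega>)"
  proof (rule F.real_cond_exp_charact[OF _ f])
    show "integrable M (\<lambda>\<omega>. h (Y \<omega>))" using h1 h2 by (auto simp: h_def)
    show "(\<lambda>\<omega>. h (Y \<omega>)) \<in> borel_measurable ?F"
      by (rule measurable_compose[OF measurable_vimage_algebra1]) auto
    fix B assume "B \<in> sets ?F"
    then obtain A where A[measurable]: "A \<in> sets borel" and B: "B = Y -` A \<inter> space M"
      by (auto simp: sets_vimage_algebra2)
    have *: "(\<integral>\<omega>\<in>B. u \<omega> \<partial>M) = (\<integral>\<omega>. indicator A (Y \<omega>) * u \<omega> \<partial>M)" for u :: "'a \<Rightarrow> real"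
      unfolding set_lebesgue_integral_def B by (intro Bochner_Integration.integral_cong) (auto simp: indicator_def)
    have "(\<integral>\<omega>. indicator A (Y \<omega>) * f \<omega> \<partial>M) =
        (\<integral>\<omega>. indicator A (Y \<omega>) * max 0 (f \<omega>) - indicator A (Y \<omega>) * max 0 (- f \<omega>) \<partial>M)"
      by (intro Bochner_Integration.integral_cong) (auto simp: max_def)
    also have "\<dots> = (\<integral>\<omega>. indicator A (Y \<omega>) * h1 (Y \<omega>) - indicator A (Y \<omega>) * h2 (Y \<omega>) \<partial>M)"
      unfolding Bochner_Integration.integral_diff[OF I[OF A P1(1)] I[OF A P2(1)]]
        Bochner_Integration.integral_diff[OF I[OF A h1(2)] I[OF A h2(2)]] h1(3)[OF A] h2(3)[OF A] by (rule refl)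
    finally show "(\<integral>\<omega>\<in>B. f \<omega> \<partial>M) = (\<integral>\<omega>\<in>B. h (Y \<omega>) \<partial>M)"
      unfolding * by (simp add: h_def right_diff_distrib)
  qed
  then show ?thesis unfolding cond_exp_version_def by (intro exI[of _ h]) simp
qed

lemma (in prob_space) cond_exp_version_integral:
  fixes Y f :: "'a \<Rightarrow> real"
  assumes Y[measurable]: "Y \<in> borel_measurable M" and f: "integrable M f" and h: "cond_exp_version M Y f h"
  shows "integrable M (\<lambda>\<omega>. h (Y \<omega>))"
    and "A \<in> sets borel \<Longrightarrow> (\<integral>\<omega>. indicator A (Y \<omega>) * f \<omega> \<partial>M) = (\<integral>\<omega>. indicator A (Y \<omega>) * h (Y \<omega>) \<partial>M)"
proof -
  let ?F = "vimage_algebra (space M) Y borel"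
  interpret F: finite_measure_subalgebra M ?F
    by standard (auto simp: subalgebra_def sets_vimage_algebra2)
  have [measurable]: "h \<in> borel_measurable borel" and ae: "AE \<omega> in M. real_cond_exp M ?F f \<omega> = h (Y \<omega>)"
    using h by (auto simp: cond_exp_version_def)
  have [measurable]: "real_cond_exp M ?F f \<in> borel_measurable M"
    using F.real_cond_exp_int(1)[OF f] by auto
  show "integrable M (\<lambda>\<omega>. h (Y \<omega>))"
    using integrable_cong_AE[OF _ _ ae] F.real_cond_exp_int(1)[OF f] by auto
  assume A[measurable]: "A \<in> sets borel"
  have *: "(\<integral>\<omega>\<in>Y -` A \<inter> space M. u \<omega> \<partial>M) = (\<integral>\<omega>. indicator A (Y \<omega>) * u \<omega> \<partial>M)" for u :: "'a \<Rightarrow> real"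
    unfolding set_lebesgue_integral_def by (intro Bochner_Integration.integral_cong) (auto simp: indicator_def)
  have "(\<integral>\<omega>. indicator A (Y \<omega>) * f \<omega> \<partial>M) = (\<integral>\<omega>. indicator A (Y \<omega>) * real_cond_exp M ?F f \<omega> \<partial>M)"
    using F.real_cond_exp_intA[OF f in_vimage_algebra[OF A], of] unfolding * .
  also have "\<dots> = (\<integral>\<omega>. indicator A (Y \<omega>) * h (Y \<omega>) \<partial>M)"
    using ae by (intro integral_cong_AE) auto
  finally show "(\<integral>\<omega>. indicator A (Y \<omega>) * f \<omega> \<partial>M) = (\<integral>\<omega>. indicator A (Y \<omega>) * h (Y \<omega>) \<partial>M)" .
qed

section \<open>Density and score from an integration by parts formula\<close>

text \<open>The formula \<open>E[\<phi>'(Y)] = E[\<phi>(Y) H]\<close> for smooth bounded test functions is all that the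
  conclusions about the law of \<open>Y\<close> depend on.\<close>

locale density_by_parts = prob_space M for M :: "'a measure" +
  fixes Y H :: "'a \<Rightarrow> real"
  assumes Y[measurable]: "Y \<in> borel_measurable M"
    and H: "integrable M H"
    and by_parts: "\<And>\<phi> \<phi>' C. (\<And>x. (\<phi> has_real_derivative \<phi>' x) (at x)) \<Longrightarrow> continuous_on UNIV \<phi>' \<Longrightarrow>
       (\<And>x. \<bar>\<phi> x\<bar> \<le> C) \<Longrightarrow> (\<And>x. \<bar>\<phi>' x\<bar> \<le> C) \<Longrightarrow> (\<integral>\<omega>. \<phi>' (Y \<omega>) \<partial>M) = (\<integral>\<omega>. \<phi> (Y \<omega>) * H \<omega> \<partial>M)"
begin

lemma H_meas[measurable]: "H \<in> borel_measurable M" using H by auto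

definition dens :: "real \<Rightarrow> real" where "dens = weighted_tail M Y H"

lemma dens_eq: "dens x = (\<integral>\<omega>. (if x < Y \<omega> then 1 else 0) * H \<omega> \<partial>M)"
  unfolding dens_def weighted_tail_def by (intro Bochner_Integration.integral_cong) (auto simp: indicator_def)

text \<open>The test function is a smoothed version of \<open>y \<mapsto> (y - a)\<^sup>+ - (y - b)\<^sup>+\<close>, whose derivative is the
  indicator of \<open>(a, b]\<close>.\<close>

lemma prob_Ioc:
  assumes ab: "a \<le> b"
  shows "prob {\<omega> \<in> space M. a < Y \<omega> \<and> Y \<omega> \<le> b} = (\<integral>\<omega>. (max 0 (Y \<omega> - a) - max 0 (Y \<omega> - b)) * H \<omega> \<partial>M)"
proof -
  define \<delta> where "\<delta> n = 1 / real (Suc n)" for n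
  have \<delta>: "\<delta> n > 0" for n by (simp add: \<delta>_def)
  define \<phi> where "\<phi> n y = soft_pos (\<delta> n) (y - a) - soft_pos (\<delta> n) (y - b)" for n y
  define \<phi>' where "\<phi>' n y = soft_step (\<delta> n) (y - a) - soft_step (\<delta> n) (y - b)" for n y
  have D: "(\<phi> n has_real_derivative \<phi>' n y) (at y)" for n y
  proof -
    have "((\<lambda>y. soft_pos (\<delta> n) (y - c)) has_real_derivative soft_step (\<delta> n) (y - c)) (at y)" for c
    proof -
      have "((\<lambda>y. y - c) has_real_derivative 1) (at y)" by (auto intro!: derivative_eq_intros)
      from DERIV_chain2[OF soft_pos_has_derivative[OF \<delta>] this] show ?thesis by simp
    qed
    then show ?thesis unfolding \<phi>_def \<phi>'_def by (intro DERIV_diff)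
  qed
  have C: "continuous_on UNIV (\<phi>' n)" for n
    unfolding \<phi>'_def by (intro continuous_intros continuous_on_compose2[OF continuous_on_soft_step[OF \<delta>, of UNIV]]) auto
  have b1: "\<bar>\<phi> n y\<bar> \<le> b - a" for n y
    using soft_pos_lipschitz[OF \<delta>, of n "y - a" "y - b"] ab by (simp add: \<phi>_def)
  have b2: "\<bar>\<phi>' n y\<bar> \<le> 1" for n y
    using soft_step_bounds[OF \<delta>, of n "y - a"] soft_step_bounds[OF \<delta>, of n "y - b"] by (auto simp: \<phi>'_def)
  have C0: "continuous_on UNIV (\<phi> n)" for n
    by (rule DERIV_continuous_on) (auto intro: has_field_derivative_at_within D)
  have [measurable]: "\<phi> n \<in> borel_measurable borel" "\<phi>' n \<in> borel_measurable borel" for n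
    using C C0 by (auto intro: borel_measurable_continuous_onI)
  have eq: "(\<integral>\<omega>. \<phi>' n (Y \<omega>) \<partial>M) = (\<integral>\<omega>. \<phi> n (Y \<omega>) * H \<omega> \<partial>M)" for n
    by (rule by_parts[OF D C, where C="max 1 (b - a)"]) (use b1 b2 in \<open>auto intro: order_trans max.coboundedI1 max.coboundedI2\<close>)
  have "(\<lambda>n. \<integral>\<omega>. \<phi>' n (Y \<omega>) \<partial>M) \<longlonglongrightarrow> (\<integral>\<omega>. (if Y \<omega> - a > 0 then 1 else 0) - (if Y \<omega> - b > 0 then 1 else 0) \<partial>M)"
  proof (rule integral_dominated_convergence[where w="\<lambda>_. 1"])
    show "AE \<omega> in M. (\<lambda>n. \<phi>' n (Y \<omega>)) \<longlonglongrightarrow> (if Y \<omega> - a > 0 then 1 else 0) - (if Y \<omega> - b > 0 then 1 else 0)"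
      unfolding \<phi>'_def \<delta>_def by (intro AE_I2 tendsto_diff soft_step_tendsto)
    show "AE \<omega> in M. norm (\<phi>' n (Y \<omega>)) \<le> 1" for n using b2 by auto
  qed auto
  also have "(\<integral>\<omega>. (if Y \<omega> - a > 0 then 1 else 0) - (if Y \<omega> - b > 0 then 1 else 0) \<partial>M) =
      (\<integral>\<omega>. indicator {\<omega> \<in> space M. a < Y \<omega> \<and> Y \<omega> \<le> b} \<omega> \<partial>M)"
    using ab by (intro Bochner_Integration.integral_cong) (auto simp: indicator_def)
  also have "\<dots> = prob {\<omega> \<in> space M. a < Y \<omega> \<and> Y \<omega> \<le> b}" by simp
  finally have 1: "(\<lambda>n. \<integral>\<omega>. \<phi>' n (Y \<omega>) \<partial>M) \<longlonglongrightarrow> prob {\<omega> \<in> space M. a < Y \<omega> \<and> Y \<omega> \<le> b}" .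
  have "(\<lambda>n. \<integral>\<omega>. \<phi> n (Y \<omega>) * H \<omega> \<partial>M) \<longlonglongrightarrow> (\<integral>\<omega>. (max 0 (Y \<omega> - a) - max 0 (Y \<omega> - b)) * H \<omega> \<partial>M)"
  proof (rule integral_dominated_convergence[where w="\<lambda>\<omega>. (b - a) * \<bar>H \<omega>\<bar>"])
    show "integrable M (\<lambda>\<omega>. (b - a) * \<bar>H \<omega>\<bar>)" using H by auto
    show "AE \<omega> in M. (\<lambda>n. \<phi> n (Y \<omega>) * H \<omega>) \<longlonglongrightarrow> (max 0 (Y \<omega> - a) - max 0 (Y \<omega> - b)) * H \<omega>"
      unfolding \<phi>_def \<delta>_def by (intro AE_I2 tendsto_intros soft_pos_tendsto)
    show "AE \<omega> in M. norm (\<phi> n (Y \<omega>) * H \<omega>) \<le> (b - a) * \<bar>H \<omega>\<bar>" for n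
      using b1 by (auto simp: abs_mult intro!: mult_right_mono)
  qed auto
  with 1 show ?thesis unfolding eq by (rule LIMSEQ_unique)
qed

text \<open>Nonnegativity holds at every point, not only almost everywhere: \<open>dens x\<close> is the limit of the
  difference quotients \<open>n P(x < Y \<le> x + 1/n)\<close>.\<close>

lemma dens_nonneg: "dens x \<ge> 0"
proof -
  define \<phi> where "\<phi> n y = real (Suc n) * (max 0 (y - x) - max 0 (y - (x + 1 / real (Suc n))))" for n y
  have [measurable]: "\<phi> n \<in> borel_measurable borel" for n unfolding \<phi>_def by measurable
  have b: "\<bar>\<phi> n y\<bar> \<le> 1" for n y
  proof -
    define k where "k = real (Suc n)"
    have k: "k > 0" by (simp add: k_def)
    have "0 \<le> max 0 (y - x) - max 0 (y - (x + 1 / k))" "max 0 (y - x) - max 0 (y - (x + 1 / k)) \<le> 1 / k"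
      using divide_pos_pos[OF zero_less_one k] by linarith+
    then have "0 \<le> k * (max 0 (y - x) - max 0 (y - (x + 1 / k)))"
      "k * (max 0 (y - x) - max 0 (y - (x + 1 / k))) \<le> k * (1 / k)"
      using k by (auto intro: mult_left_mono simp del: times_divide_eq_right)
    moreover have "\<phi> n y = k * (max 0 (y - x) - max 0 (y - (x + 1 / k)))" by (simp only: \<phi>_def k_def)
    ultimately show ?thesis using k by simp
  qed
  have lim: "(\<lambda>n. \<phi> n y) \<longlonglongrightarrow> (if x < y then 1 else 0)" for y
  proof (cases "x < y")
    case True
    have "eventually (\<lambda>n. 1 / real (Suc n) < y - x) sequentially"
      using LIMSEQ_inverse_real_of_nat True by (intro order_tendstoD(2)[where y=0]) (auto simp: inverse_eq_divide)
    then have "eventually (\<lambda>n. \<phi> n y = 1) sequentially"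
      by eventually_elim (use True in \<open>auto simp: \<phi>_def max_def field_simps\<close>)
    then show ?thesis using True by (simp add: tendsto_eventually)
  next
    case False
    then have "y - x \<le> 0" "y - (x + 1 / real (Suc n)) \<le> 0" for n
      using zero_le_divide_1_iff[of "real (Suc n)"] by linarith+
    then have "\<phi> n y = 0" for n by (simp only: \<phi>_def max_absorb1) simp
    then show ?thesis using False by simp
  qed
  have "(\<lambda>n. \<integral>\<omega>. \<phi> n (Y \<omega>) * H \<omega> \<partial>M) \<longlonglongrightarrow> dens x"
    unfolding dens_eq
  proof (rule integral_dominated_convergence[where w="\<lambda>\<omega>. \<bar>H \<omega>\<bar>"])
    show "integrable M (\<lambda>\<omega>. \<bar>H \<omega>\<bar>)" using H by auto
    show "AE \<omega> in M. (\<lambda>n. \<phi> n (Y \<omega>) * H \<omega>) \<longlonglongrightarrow> (if x < Y \<omega> then 1 else 0) * H \<omega>"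
      by (intro AE_I2 tendsto_intros lim)
    show "AE \<omega> in M. norm (\<phi> n (Y \<omega>) * H \<omega>) \<le> \<bar>H \<omega>\<bar>" for n
      using b by (auto simp: abs_mult intro!: mult_left_le_one_le)
  qed auto
  moreover have "(\<integral>\<omega>. \<phi> n (Y \<omega>) * H \<omega> \<partial>M) \<ge> 0" for n
  proof -
    have "(\<integral>\<omega>. \<phi> n (Y \<omega>) * H \<omega> \<partial>M) = real (Suc n) * prob {\<omega> \<in> space M. x < Y \<omega> \<and> Y \<omega> \<le> x + 1 / real (Suc n)}"
      by (subst prob_Ioc) (auto simp: \<phi>_def mult.assoc)
    then show ?thesis by simp
  qed
  ultimately show ?thesis by (intro LIMSEQ_le_const) auto
qed

lemma dens_le: "dens x \<le> (\<integral>\<omega>. \<bar>H \<omega>\<bar> \<partial>M)"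
  unfolding dens_eq using H by (intro integral_mono integrable_mult_indicator[where A=A for A, simplified])
    (auto intro!: Bochner_Integration.integrable_bound[OF H])

lemma dens_meas[measurable]: "dens \<in> borel_measurable borel"
proof -
  have "(\<lambda>x. \<integral>\<omega>. (if x < Y \<omega> then 1 else 0) * H \<omega> \<partial>M) \<in> borel_measurable borel"
    by (rule borel_measurable_lebesgue_integral) measurable
  then show ?thesis by (simp add: dens_eq[abs_def])
qed

text \<open>The layer cake formula \<open>(y - a)\<^sup>+ - (y - b)\<^sup>+ = \<integral>\<^sub>a\<^sup>b 1\<^bsub>y > x\<^esub> dx\<close> and Fubini's theorem.\<close>

lemma prob_Ioc_dens:
  assumes ab: "a \<le> b"
  shows "prob {\<omega> \<in> space M. a < Y \<omega> \<and> Y \<omega> \<le> b} = (LBINT x:{a<..b}. dens x)"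
proof -
  interpret pair_sigma_finite M lborel ..
  let ?f = "\<lambda>(\<omega>, x). indicator {a<..b} x * ((if x < Y \<omega> then 1 else 0) * H \<omega>)"
  have meas: "?f \<in> borel_measurable (M \<Otimes>\<^sub>M lborel)" by measurable
  have int: "integrable (M \<Otimes>\<^sub>M lborel) ?f"
  proof (rule Bochner_Integration.integrable_bound[OF _ meas])
    show "integrable (M \<Otimes>\<^sub>M lborel) (\<lambda>(\<omega>, x). indicator {a<..b} x * H \<omega>)"
      by (rule Fubini_integrable) (use ab H in \<open>auto simp: abs_mult intro!: integrable_real_mult_indicator\<close>)
  qed (auto simp: abs_mult split: split_indicator)
  have "(LBINT x:{a<..b}. dens x) = (LBINT x. \<integral>\<omega>. ?f (\<omega>, x) \<partial>M)"
    by (simp add: set_lebesgue_integral_def dens_eq)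
  also have "\<dots> = (\<integral>\<omega>. (LBINT x. ?f (\<omega>, x)) \<partial>M)" using Fubini_integral[OF int] by simp
  also have "\<dots> = (\<integral>\<omega>. (max 0 (Y \<omega> - a) - max 0 (Y \<omega> - b)) * H \<omega> \<partial>M)"
  proof (intro Bochner_Integration.integral_cong refl)
    fix \<omega>
    have 1: "?f (\<omega>, x) = H \<omega> * (indicator ({a<..b} \<inter> {..<Y \<omega>}) x)" for x by (auto split: split_indicator)
    have 2: "measure lborel ({a<..b} \<inter> {..<Y \<omega>}) = max 0 (Y \<omega> - a) - max 0 (Y \<omega> - b)"
    proof (cases "Y \<omega> \<le> b")
      case True then have "{a<..b} \<inter> {..<Y \<omega>} = {a<..<Y \<omega>}" by auto
      with True show ?thesis by (auto simp: measure_def max_def)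
    next
      case False then have "{a<..b} \<inter> {..<Y \<omega>} = {a<..b}" by auto
      with False ab show ?thesis by (auto simp: max_def)
    qed
    have "(LBINT x. ?f (\<omega>, x)) = H \<omega> * (LBINT x. indicator ({a<..b} \<inter> {..<Y \<omega>}) x)"
      unfolding 1 by (rule integral_mult_right_zero)
    then show "(LBINT x. ?f (\<omega>, x)) = (max 0 (Y \<omega> - a) - max 0 (Y \<omega> - b)) * H \<omega>"
      using 2 by simp
  qed
  finally show ?thesis using prob_Ioc[OF ab] by simp
qed

lemma set_integrable_dens: "set_integrable lborel {a<..b} dens"
  unfolding set_integrable_def
  by (rule integrableI_bounded_set_indicator[where B="\<integral>\<omega>. \<bar>H \<omega>\<bar> \<partial>M"])
    (use dens_le dens_nonneg in \<open>cases "a \<le> b"; auto\<close>)+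

lemma distr_eq_density: "distr M borel Y = density lborel (\<lambda>x. ennreal (dens x))"
proof (rule measure_eqI_generator_eq[where E="range (\<lambda>(a, b). {a <.. b::real})" and \<Omega>=UNIV and A="\<lambda>n. {- real n<..real n}"])
  show "Int_stable (range (\<lambda>(a, b). {a <.. b::real}))" by (auto simp: Int_stable_def)
  show "sets (distr M borel Y) = sigma_sets UNIV (range (\<lambda>(a, b). {a <.. b::real}))"
     "sets (density lborel (\<lambda>x. ennreal (dens x))) = sigma_sets UNIV (range (\<lambda>(a, b). {a <.. b::real}))"
    by (simp_all add: borel_sigma_sets_Ioc)
  show "range (\<lambda>n. {- real n<..real n}) \<subseteq> range (\<lambda>(a, b). {a <.. b::real})" by auto
  show "(\<Union>n. {- real n<..real n}) = UNIV"
    by (auto simp: minus_less_iff) (metis (no_types, lifting) less_imp_le max.strict_boundedE reals_Archimedean2)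
  fix n show "emeasure (distr M borel Y) {- real n<..real n} \<noteq> \<infinity>"
    by (simp add: emeasure_distr)
next
  fix X assume "X \<in> range (\<lambda>(a, b). {a <.. b::real})"
  then obtain a b where X: "X = {a<..b}" by auto
  show "emeasure (distr M borel Y) X = emeasure (density lborel (\<lambda>x. ennreal (dens x))) X"
  proof (cases "a \<le> b")
    case True
    have "emeasure (distr M borel Y) X = ennreal (prob {\<omega> \<in> space M. a < Y \<omega> \<and> Y \<omega> \<le> b})"
      unfolding X by (subst emeasure_distr) (auto simp: emeasure_eq_measure intro!: arg_cong[where f=prob])
    also have "\<dots> = ennreal (LBINT x. indicator {a<..b} x * dens x)"
      using prob_Ioc_dens[OF True] by (simp add: set_lebesgue_integral_def)
    also have "\<dots> = (\<integral>\<^sup>+x. ennreal (indicator {a<..b} x * dens x) \<partial>lborel)"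
      using set_integrable_dens[of a b] by (intro nn_integral_eq_integral[symmetric])
        (auto simp: set_integrable_def dens_nonneg)
    also have "\<dots> = emeasure (density lborel (\<lambda>x. ennreal (dens x))) X"
      unfolding X by (subst emeasure_density) (auto intro!: nn_integral_cong split: split_indicator)
    finally show ?thesis .
  qed (simp add: X)
qed auto

lemma dens_diff:
  assumes "a \<le> b"
  shows "dens a - dens b = (\<integral>\<omega>. indicator {a<..b} (Y \<omega>) * H \<omega> \<partial>M)"
proof -
  have I: "integrable M (\<lambda>\<omega>. (if x < Y \<omega> then 1 else 0) * H \<omega>)" for x
    by (rule Bochner_Integration.integrable_bound[OF H]) auto
  have "dens a - dens b = (\<integral>\<omega>. (if a < Y \<omega> then 1 else 0) * H \<omega> - (if b < Y \<omega> then 1 else 0) * H \<omega> \<partial>M)"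
    unfolding dens_eq using I by simp
  also have "\<dots> = (\<integral>\<omega>. indicator {a<..b} (Y \<omega>) * H \<omega> \<partial>M)"
    using assms by (intro Bochner_Integration.integral_cong) (auto simp: indicator_def)
  finally show ?thesis .
qed

text \<open>The increments are at most \<open>E[1\<^bsub>a < Y \<le> b\<^esub> |H|]\<close>. Splitting \<open>|H|\<close> at a level \<open>n\<close> leaves an
  arbitrarily small tail expectation and \<open>n P(a < Y \<le> b)\<close>, which is at most \<open>n E|H| (b - a)\<close> as the
  density is bounded by \<open>E|H|\<close>.\<close>

lemma dens_abs_continuous: "abs_continuous_fun dens"
  unfolding abs_continuous_fun_def
proof (intro allI impI)
  fix \<epsilon> :: real assume \<epsilon>: "\<epsilon> > 0"
  define C where "C = (\<integral>\<omega>. \<bar>H \<omega>\<bar> \<partial>M)"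
  have C0: "C \<ge> 0" by (simp add: C_def)
  define T where "T n \<omega> = (if \<bar>H \<omega>\<bar> > real n then \<bar>H \<omega>\<bar> else 0)" for n :: nat and \<omega>
  have [measurable]: "T n \<in> borel_measurable M" for n unfolding T_def[abs_def] by measurable
  have IT: "integrable M (T n)" for n
    by (rule Bochner_Integration.integrable_bound[OF H]) (auto simp: T_def)
  have "(\<lambda>n. \<integral>\<omega>. T n \<omega> \<partial>M) \<longlonglongrightarrow> (\<integral>\<omega>. 0 \<partial>M)"
  proof (rule integral_dominated_convergence[where w="\<lambda>\<omega>. \<bar>H \<omega>\<bar>"])
    show "AE \<omega> in M. (\<lambda>n. T n \<omega>) \<longlonglongrightarrow> 0"
    proof (intro AE_I2 tendsto_eventually)
      fix \<omega>
      have "eventually (\<lambda>n. real n > \<bar>H \<omega>\<bar>) sequentially"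
        using filterlim_real_sequentially by (auto simp: filterlim_at_top_dense)
      then show "eventually (\<lambda>n. T n \<omega> = 0) sequentially" by eventually_elim (auto simp: T_def)
    qed
  qed (use H in \<open>auto simp: T_def\<close>)
  then have "eventually (\<lambda>n. (\<integral>\<omega>. T n \<omega> \<partial>M) < \<epsilon> / 2) sequentially"
    using \<epsilon> by (intro order_tendstoD(2)[where y=0]) auto
  then obtain n where n: "(\<integral>\<omega>. T n \<omega> \<partial>M) < \<epsilon> / 2" by (auto simp: eventually_sequentially)
  \<comment> \<open>adding 1 keeps the denominator positive when the bound \<open>C\<close> or the level \<open>n\<close> is 0\<close>
  define \<delta> where "\<delta> = \<epsilon> / (2 * (real n * C + 1))"
  have nC: "real n * C + 1 > 0" using C0 by (simp add: add_nonneg_pos)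
  have \<delta>: "\<delta> > 0" using \<epsilon> nC by (simp add: \<delta>_def)
  show "\<exists>\<delta>>0. \<forall>D. finite D \<and> (\<forall>(a, b)\<in>D. a \<le> b) \<and> disjoint_family_on (\<lambda>(a, b). {a<..<b}) D \<and>
           (\<Sum>(a, b)\<in>D. b - a) < \<delta> \<longrightarrow> (\<Sum>(a, b)\<in>D. \<bar>dens b - dens a\<bar>) < \<epsilon>"
  proof (intro exI[of _ \<delta>] conjI allI impI \<delta>; elim conjE)
    fix D :: "(real \<times> real) set"
    assume fin: "finite D" and le: "\<forall>(a, b)\<in>D. a \<le> b" and disj: "disjoint_family_on (\<lambda>(a, b). {a<..<b}) D"
      and len: "(\<Sum>(a, b)\<in>D. b - a) < \<delta>"
    let ?J = "\<lambda>(a, b). {a<..b::real}"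
    \<comment> \<open>two half-open intervals that meet have interiors that meet\<close>
    have disj': "disjoint_family_on ?J D"
      unfolding disjoint_family_on_def
    proof (intro ballI impI)
      fix i j assume ij: "i \<in> D" "j \<in> D" "i \<noteq> j"
      obtain a b c d where i: "i = (a, b)" and j: "j = (c, d)" by (cases i, cases j) auto
      show "?J i \<inter> ?J j = {}"
      proof (rule ccontr)
        assume "?J i \<inter> ?J j \<noteq> {}"
        then obtain y where "y \<in> ?J i" "y \<in> ?J j" by blast
        then have y: "a < y" "y \<le> b" "c < y" "y \<le> d" by (auto simp: i j)
        then obtain z where "max a c < z" "z < y" using dense[of "max a c" y] by auto
        then have "z \<in> {a<..<b} \<inter> {c<..<d}" using y by auto
        moreover have "{a<..<b} \<inter> {c<..<d} = {}" using disj ij unfolding disjoint_family_on_def i j by fastforce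
        ultimately show False by blast
      qed
    qed
    have I: "integrable M (\<lambda>\<omega>. indicator (?J i) (Y \<omega>) * u \<omega>)" if "integrable M u" for u :: "'a \<Rightarrow> real" and i
      using that by (intro Bochner_Integration.integrable_bound[OF that]) (auto split: split_indicator prod.split)
    have one: "\<bar>dens b - dens a\<bar> \<le> real n * (C * (b - a)) + (\<integral>\<omega>. indicator (?J (a, b)) (Y \<omega>) * T n \<omega> \<partial>M)"
      if "a \<le> b" for a b
    proof -
      have "\<bar>dens b - dens a\<bar> = norm (\<integral>\<omega>. indicator {a<..b} (Y \<omega>) * H \<omega> \<partial>M)"
        using dens_diff[OF that] by simp
      also have "\<dots> \<le> (\<integral>\<omega>. norm (indicator {a<..b} (Y \<omega>) * H \<omega>) \<partial>M)" by (rule integral_norm_bound)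
      also have "\<dots> \<le> (\<integral>\<omega>. indicator {a<..b} (Y \<omega>) * real n + indicator {a<..b} (Y \<omega>) * T n \<omega> \<partial>M)"
        using I[OF H, of "(a,b)"] I[OF IT, of "(a,b)"] I[of "\<lambda>_. real n" "(a,b)"]
        by (intro integral_mono) (auto simp: T_def split: split_indicator)
      also have "\<dots> = (\<integral>\<omega>. indicator {a<..b} (Y \<omega>) * real n \<partial>M) + (\<integral>\<omega>. indicator {a<..b} (Y \<omega>) * T n \<omega> \<partial>M)"
        using I[OF IT, of "(a,b)"] I[of "\<lambda>_. real n" "(a,b)"] by simp
      also have "(\<integral>\<omega>. indicator {a<..b} (Y \<omega>) * real n \<partial>M) = real n * (\<integral>\<omega>. indicator {\<omega> \<in> space M. a < Y \<omega> \<and> Y \<omega> \<le> b} \<omega> \<partial>M)"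
        by (subst integral_mult_right_zero[symmetric], intro Bochner_Integration.integral_cong) (auto simp: indicator_def)
      also have "\<dots> = real n * (LBINT x:{a<..b}. dens x)" using prob_Ioc_dens[OF that] by simp
      also have "(LBINT x:{a<..b}. dens x) \<le> (LBINT x:{a<..b}. C)"
        using set_integrable_dens that by (intro set_integral_mono) (auto simp: dens_le C_def set_integrable_def)
      also have "(LBINT x:{a<..b}. C) = C * (b - a)" using that by (simp add: set_lebesgue_integral_def)
      finally show ?thesis by (simp add: mult_left_mono)
    qed
    have "(\<Sum>(a, b)\<in>D. \<bar>dens b - dens a\<bar>) \<le> (\<Sum>(a, b)\<in>D. real n * (C * (b - a)) + (\<integral>\<omega>. indicator (?J (a, b)) (Y \<omega>) * T n \<omega> \<partial>M))"
    proof (rule sum_mono)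
      fix i assume "i \<in> D"
      moreover obtain a b where "i = (a, b)" by (cases i)
      ultimately show "(case i of (a, b) \<Rightarrow> \<bar>dens b - dens a\<bar>) \<le>
          (case i of (a, b) \<Rightarrow> real n * (C * (b - a)) + (\<integral>\<omega>. indicator (?J (a, b)) (Y \<omega>) * T n \<omega> \<partial>M))"
        using le one[of a b] by auto
    qed
    also have "\<dots> = real n * C * (\<Sum>(a, b)\<in>D. b - a) + (\<integral>\<omega>. (\<Sum>i\<in>D. indicator (?J i) (Y \<omega>) * T n \<omega>) \<partial>M)"
      using I[OF IT] by (subst Bochner_Integration.integral_sum) (auto simp: sum.distrib sum_distrib_left split_beta mult.assoc)
    also have "(\<integral>\<omega>. (\<Sum>i\<in>D. indicator (?J i) (Y \<omega>) * T n \<omega>) \<partial>M) \<le> (\<integral>\<omega>. T n \<omega> \<partial>M)"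
    proof (intro integral_mono Bochner_Integration.integrable_sum I IT)
      fix \<omega>
      have "(\<Sum>i\<in>D. indicator (?J i) (Y \<omega>) * T n \<omega>) = indicator (\<Union>i\<in>D. ?J i) (Y \<omega>) * T n \<omega>"
      proof -
        have "(indicator (\<Union>i\<in>D. ?J i) (Y \<omega>) :: real) = (\<Sum>i\<in>D. indicator (?J i) (Y \<omega>))"
          by (rule indicator_UN_disjoint[OF fin disj'])
        then show ?thesis by (simp only: sum_distrib_right)
      qed
      also have "\<dots> \<le> T n \<omega>" by (auto simp: T_def split: split_indicator)
      finally show "(\<Sum>i\<in>D. indicator (?J i) (Y \<omega>) * T n \<omega>) \<le> T n \<omega>" .
    qed
    also have "real n * C * (\<Sum>(a, b)\<in>D. b - a) \<le> real n * C * \<delta>"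
      using len C0 by (intro mult_left_mono) auto
    also have "real n * C * \<delta> \<le> \<epsilon> / 2"
      using \<epsilon> nC C0 by (simp add: \<delta>_def field_simps)
    finally show "(\<Sum>(a, b)\<in>D. \<bar>dens b - dens a\<bar>) < \<epsilon>" using n by simp
  qed
qed

lemma AE_distr_iff: "(AE x in distr M borel Y. P x) \<longleftrightarrow> (AE x in lborel. dens x > 0 \<longrightarrow> P x)"
  unfolding distr_eq_density by (subst AE_density) auto

text \<open>Conditioning turns \<open>dens\<close> into the indefinite integral \<open>\<integral>\<^sub>x\<^sup>\<infinity> h dens\<close>, which is
  differentiable almost everywhere by Lebesgue's theorem.\<close>

lemma dens_derivative:
  assumes h: "cond_exp_version M Y H h"
  shows "AE x in lborel. (dens has_real_derivative - (h x * dens x)) (at x)"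
proof -
  have [measurable]: "h \<in> borel_measurable borel" using h by (auto simp: cond_exp_version_def)
  define f where "f x = h x * dens x" for x
  have [measurable]: "f \<in> borel_measurable borel" unfolding f_def by measurable
  have "integrable (distr M borel Y) h"
    using cond_exp_version_integral(1)[OF Y H h] by (subst integrable_distr_eq) auto
  then have If: "integrable lborel f"
    unfolding distr_eq_density by (subst (asm) integrable_real_density) (auto simp: dens_nonneg f_def[abs_def] mult.commute)
  have diff: "dens a - dens b = (LBINT x:{a<..b}. f x)" if "a \<le> b" for a b
  proof -
    have "dens a - dens b = (\<integral>\<omega>. indicator {a<..b} (Y \<omega>) * h (Y \<omega>) \<partial>M)"
      unfolding dens_diff[OF that] by (rule cond_exp_version_integral(2)[OF Y H h]) simp
    also have "\<dots> = (\<integral>x. indicator {a<..b} x * h x \<partial>distr M borel Y)"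
      by (subst integral_distr) auto
    also have "\<dots> = (LBINT x. dens x * (indicator {a<..b} x * h x))"
      unfolding distr_eq_density by (subst integral_real_density) (auto simp: dens_nonneg)
    also have "\<dots> = (LBINT x:{a<..b}. f x)"
      unfolding set_lebesgue_integral_def f_def by (intro Bochner_Integration.integral_cong) (auto simp: mult_ac)
    finally show ?thesis .
  qed
  have hk: "f integrable_on {a..b}" "a \<le> b \<Longrightarrow> integral {a..b} f = (LBINT x:{a<..b}. f x)" for a b
  proof -
    have s: "set_integrable lborel {a..b} f"
      unfolding set_integrable_def by (rule integrable_mult_indicator[OF _ If]) simp
    show "f integrable_on {a..b}" by (rule set_borel_integral_eq_integral(1)[OF s])
    assume "a \<le> b"
    have "(LBINT x:{a<..b}. f x) = (LBINT x:{a..b}. f x)"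
      unfolding set_lebesgue_integral_def
      using AE_lborel_singleton[of a] by (intro integral_cong_AE) (auto split: split_indicator elim!: eventually_mono)
    then show "integral {a..b} f = (LBINT x:{a<..b}. f x)" using set_borel_integral_eq_integral(2)[OF s] by simp
  qed
  have *: "AE x in lborel. x \<in> {- real n<..<real n} \<longrightarrow> (dens has_real_derivative - f x) (at x)" for n :: nat
  proof -
    let ?a = "- real n" and ?b = "real n"
    let ?N = "{x \<in> {?a<..<?b}. \<not> ((\<lambda>u. integral {?a..u} f) has_real_derivative f x) (at x)}"
    have "negligible ?N" by (rule indefinite_integral_has_derivative_ae[OF hk(1)])
    then have "AE x in lebesgue. x \<notin> ?N" unfolding negligible_iff_null_sets by (rule AE_not_in)
    then have "AE x in lborel. x \<notin> ?N" by (simp add: AE_completion_iff)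
    then show ?thesis
    proof eventually_elim
      case (elim x)
      show ?case
      proof
        assume x: "x \<in> {?a<..<?b}"
        with elim have D: "((\<lambda>u. integral {?a..u} f) has_real_derivative f x) (at x)" by auto
        have "eventually (\<lambda>u. u \<in> {?a<..<?b}) (nhds x)"
          using x by (intro eventually_nhds_in_open) auto
        then have "eventually (\<lambda>u. dens u = dens ?a - integral {?a..u} f) (nhds x)"
        proof eventually_elim
          case (elim u)
          then show ?case using diff[of ?a u] hk(2)[of ?a u] by simp
        qed
        moreover have "((\<lambda>u. dens ?a - integral {?a..u} f) has_real_derivative - f x) (at x)"
          using DERIV_diff[OF DERIV_const D] by simp
        ultimately show "(dens has_real_derivative - f x) (at x)"
          by (subst DERIV_cong_ev[OF refl _ refl])
      qed
    qed
  qed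
  have "AE x in lborel. \<forall>n::nat. x \<in> {- real n<..<real n} \<longrightarrow> (dens has_real_derivative - f x) (at x)"
    unfolding AE_all_countable using * by blast
  then show ?thesis
  proof eventually_elim
    case (elim x)
    obtain n :: nat where "\<bar>x\<bar> < real n" using reals_Archimedean2 by blast
    then have "x \<in> {- real n<..<real n}" by auto
    with elim show ?case unfolding f_def by blast
  qed
qed

theorem density_and_score:
  "distributed M lborel Y (\<lambda>x. ennreal (dens x))" "\<forall>x. dens x \<ge> 0" "abs_continuous_fun dens"
  "AE x in distr M borel Y. dens x > 0 \<and> dens differentiable (at x)"
  "\<exists>h. cond_exp_version M Y H h"
  "\<forall>h. cond_exp_version M Y H h \<longrightarrow> (AE x in distr M borel Y. score dens x = - h x)"
proof -
  have "distr M lborel Y = distr M borel Y" by (rule distr_cong) auto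
  then show "distributed M lborel Y (\<lambda>x. ennreal (dens x))"
    unfolding distributed_def using distr_eq_density by simp
  show "\<forall>x. dens x \<ge> 0" using dens_nonneg by blast
  show "abs_continuous_fun dens" by (rule dens_abs_continuous)
  show ex: "\<exists>h. cond_exp_version M Y H h" by (rule cond_exp_version_exists[OF Y H])
  then obtain h where "cond_exp_version M Y H h" by blast
  from dens_derivative[OF this] show "AE x in distr M borel Y. dens x > 0 \<and> dens differentiable (at x)"
    unfolding AE_distr_iff by eventually_elim (auto simp: real_differentiable_def)
  show "\<forall>h. cond_exp_version M Y H h \<longrightarrow> (AE x in distr M borel Y. score dens x = - h x)"
  proof (intro allI impI)
    fix h assume "cond_exp_version M Y H h"
    from dens_derivative[OF this] show "AE x in distr M borel Y. score dens x = - h x"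
      unfolding AE_distr_iff by eventually_elim (auto simp: score_def dest!: DERIV_imp_deriv)
  qed
qed

end

section \<open>One coordinate: the flux and the flow charts\<close>

text \<open>A cutoff near the zeros of the flux: \<open>0\<close> for \<open>0 < |z| \<le> \<delta>\<close>, tending to \<open>1\<close> as \<open>\<delta>\<close> tends to \<open>0\<close>.
  The value at \<open>z = 0\<close> is \<open>1\<close> because a coordinate with vanishing flux does not move and must
  not be cut off.\<close>

definition cutoff :: "real \<Rightarrow> real \<Rightarrow> real" where
  "cutoff \<delta> z = (if z = 0 then 1 else soft_pos \<delta> \<bar>z\<bar> / \<bar>z\<bar>)"

lemma abs_has_real_derivative:
  fixes f :: "real \<Rightarrow> real"
  assumes "(f has_real_derivative f') (at x)" "f x \<noteq> 0"
  shows "((\<lambda>x. \<bar>f x\<bar>) has_real_derivative sgn (f x) * f') (at x)"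
proof -
  have "isCont f x" using assms(1) by (rule DERIV_isCont)
  then have lim: "(f \<longlongrightarrow> f x) (nhds x)" by (simp add: isCont_def tendsto_at_iff_tendsto_nhds)
  have "eventually (\<lambda>y. \<bar>f y\<bar> = sgn (f x) * f y) (nhds x)"
  proof (cases "f x > 0")
    case True
    with lim have "eventually (\<lambda>y. f y > 0) (nhds x)" by (intro order_tendstoD(1))
    then show ?thesis by eventually_elim (use True in auto)
  next
    case False
    with lim assms(2) have "eventually (\<lambda>y. f y < 0) (nhds x)" by (intro order_tendstoD(2)) auto
    then show ?thesis by eventually_elim (use False assms(2) in auto)
  qed
  moreover have "((\<lambda>y. sgn (f x) * f y) has_real_derivative sgn (f x) * f') (at x)"
    by (rule DERIV_cmult[OF assms(1)])
  ultimately show ?thesis by (subst DERIV_cong_ev[OF refl _ refl])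
qed

locale coordinate =
  fixes p g :: "real \<Rightarrow> real" and I :: "real set"
  assumes open_I: "open I" and connected_I: "connected I"
    and p_pos: "\<And>x. x \<in> I \<Longrightarrow> p x > 0" and p_zero: "\<And>x. x \<notin> I \<Longrightarrow> p x = 0"
    and p_diff: "p differentiable_on I"
    and p_int: "integrable lborel p"
    and g_cont: "continuous_on I g"
    and gp_int: "integrable lborel (\<lambda>x. g x * p x)" and gp_zero: "(LBINT x. g x * p x) = 0"
begin

lemma p_meas[measurable]: "p \<in> borel_measurable borel" using p_int by auto
lemma gp_meas[measurable]: "(\<lambda>x. g x * p x) \<in> borel_measurable borel" using gp_int by auto

lemma p_nonneg: "p x \<ge> 0" using p_pos[of x] p_zero[of x] by (cases "x \<in> I") auto

lemma I_meas[measurable]: "I \<in> sets borel" using open_I by simp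

text \<open>The flux density \<open>p \<L>g\<close> of the field in this coordinate. It is continuous on the whole line and
  vanishes off \<open>I\<close>, so the set where it is nonzero is an open subset of \<open>I\<close>.\<close>

definition G :: "real \<Rightarrow> real" where "G y = (LBINT x:{y..}. g x * p x)"

lemma Lop_eq: "Lop p g y = G y / p y" by (simp add: Lop_def G_def)

lemma gp_set_int: "A \<in> sets borel \<Longrightarrow> set_integrable lborel A (\<lambda>x. g x * p x)"
  unfolding set_integrable_def by (rule integrable_mult_indicator[OF _ gp_int]) simp

lemma G_diff: assumes "a \<le> y" shows "G y = G a - integral {a..y} (\<lambda>x. g x * p x)"
proof -
  have "G a = (LBINT x:{a..<y} \<union> {y..}. g x * p x)"
    using assms unfolding G_def by (intro arg_cong2[where f="set_lebesgue_integral lborel"]) auto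
  also have "\<dots> = (LBINT x:{a..<y}. g x * p x) + G y"
    unfolding G_def by (rule set_integral_Un) (auto intro: gp_set_int)
  also have "(LBINT x:{a..<y}. g x * p x) = (LBINT x:{a..y}. g x * p x)"
    unfolding set_lebesgue_integral_def
    using AE_lborel_singleton[of y] by (intro integral_cong_AE) (auto split: split_indicator elim!: eventually_mono)
  also have "\<dots> = integral {a..y} (\<lambda>x. g x * p x)"
    by (rule set_borel_integral_eq_integral(2)[OF gp_set_int]) simp
  finally show ?thesis by simp
qed

lemma gp_hk: "(\<lambda>x. g x * p x) integrable_on {a..b}"
  by (rule set_borel_integral_eq_integral(1)[OF gp_set_int]) simp

lemma G_continuous: "continuous_on A G"
proof -
  have "isCont G y" for y
  proof -
    have "continuous_on {y-1..y+1} (\<lambda>x. G (y-1) - integral {y-1..x} (\<lambda>x. g x * p x))"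
      by (intro continuous_intros indefinite_integral_continuous_1 gp_hk)
    then have "continuous_on {y-1..y+1} G"
      by (rule continuous_on_eq) (rule G_diff[symmetric], simp)
    then show ?thesis by (rule continuous_on_interior) auto
  qed
  then show ?thesis by (simp add: continuous_at_imp_continuous_on)
qed

lemma p_continuous: "continuous_on I p"
  using p_diff by (rule differentiable_imp_continuous_on)

lemma G_has_derivative: assumes y: "y \<in> I" shows "(G has_real_derivative - (g y * p y)) (at y)"
proof -
  obtain e where e: "e > 0" "cball y e \<subseteq> I" using open_I y by (meson open_contains_cball)
  then have sub: "{y-e..y+e} \<subseteq> I" by (auto simp: cball_def dist_real_def subset_iff)
  have "continuous_on {y-e..y+e} (\<lambda>x. g x * p x)"
    by (intro continuous_intros continuous_on_subset[OF g_cont sub] continuous_on_subset[OF p_continuous sub])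
  then have "((\<lambda>u. integral {y-e..u} (\<lambda>x. g x * p x)) has_real_derivative g y * p y) (at y within {y-e..y+e})"
    by (rule integral_has_real_derivative) (use e in auto)
  then have "((\<lambda>u. integral {y-e..u} (\<lambda>x. g x * p x)) has_real_derivative g y * p y) (at y)"
    using at_within_interior[of y "{y-e..y+e}"] e by simp
  from DERIV_diff[OF DERIV_const this]
  have "((\<lambda>u. G (y-e) - integral {y-e..u} (\<lambda>x. g x * p x)) has_real_derivative - (g y * p y)) (at y)" by simp
  moreover have "eventually (\<lambda>u. u \<in> {y-e<..<y+e}) (nhds y)" using e by (intro eventually_nhds_in_open) auto
  then have "eventually (\<lambda>u. G u = G (y-e) - integral {y-e..u} (\<lambda>x. g x * p x)) (nhds y)"
    by eventually_elim (rule G_diff, simp)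
  ultimately show ?thesis by (subst DERIV_cong_ev[OF refl _ refl])
qed

text \<open>A point off the interval \<open>I\<close> has all of \<open>I\<close> on one side, so its tail integral is either empty or
  the full integral, which is \<open>0\<close>.\<close>

lemma G_outside: assumes y: "y \<notin> I" shows "G y = 0"
proof -
  have "is_interval I" using connected_I by (simp add: is_interval_connected_1)
  then have "(\<forall>x\<in>I. x < y) \<or> (\<forall>x\<in>I. y < x)"
    using y unfolding is_interval_1 by (meson not_le)
  then show ?thesis
  proof
    assume "\<forall>x\<in>I. x < y"
    then have "indicator {y..} x *\<^sub>R (g x * p x) = 0" for x using p_zero[of x] by (cases "x \<in> I") (auto simp: indicator_def)
    then show ?thesis unfolding G_def set_lebesgue_integral_def by (simp only: Bochner_Integration.integral_zero)
  next
    assume "\<forall>x\<in>I. y < x"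
    then have "indicator {y..} x *\<^sub>R (g x * p x) = g x * p x" for x using p_zero[of x] by (cases "x \<in> I") (auto simp: indicator_def)
    then show ?thesis using gp_zero unfolding G_def set_lebesgue_integral_def by (simp only:)
  qed
qed

lemma G_complement: "G y = - (LBINT x. indicator {..y} x *\<^sub>R (g x * p x))"
proof -
  have "(LBINT x. g x * p x) = (LBINT x:{..<y} \<union> {y..}. g x * p x)"
  proof -
    have "{..<y} \<union> {y..} = UNIV" by auto
    then show ?thesis by (simp add: set_lebesgue_integral_def)
  qed
  also have "\<dots> = (LBINT x:{..<y}. g x * p x) + G y"
    unfolding G_def by (rule set_integral_Un) (auto intro: gp_set_int)
  also have "(LBINT x:{..<y}. g x * p x) = (LBINT x. indicator {..y} x *\<^sub>R (g x * p x))"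
    unfolding set_lebesgue_integral_def
    using AE_lborel_singleton[of y] by (intro integral_cong_AE) (auto split: split_indicator elim!: eventually_mono)
  finally show ?thesis using gp_zero by simp
qed

lemma G_at_top: "(G \<longlongrightarrow> 0) at_top"
proof -
  have "((\<lambda>y. - (LBINT x. indicator {..y} x *\<^sub>R (g x * p x))) \<longlongrightarrow> - (LBINT x. g x * p x)) at_top"
    by (intro tendsto_minus tendsto_integral_at_top gp_int) simp
  then show ?thesis unfolding G_complement[symmetric] gp_zero by simp
qed

lemma G_at_bot: "(G \<longlongrightarrow> 0) at_bot"
proof -
  have "((\<lambda>y. LBINT x:{y..}. g x * p x) \<longlongrightarrow> (LBINT x:UNIV. g x * p x)) at_bot"
    unfolding set_lebesgue_integral_def
  proof (rule tendsto_at_botI_sequentially)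
    fix X :: "nat \<Rightarrow> real" assume X: "filterlim X at_bot sequentially"
    show "(\<lambda>n. LBINT x. indicator {X n..} x *\<^sub>R (g x * p x)) \<longlonglongrightarrow> (LBINT x. indicator UNIV x *\<^sub>R (g x * p x))"
    proof (rule integral_dominated_convergence[where w="\<lambda>x. \<bar>g x * p x\<bar>"])
      show "AE x in lborel. (\<lambda>n. indicator {X n..} x *\<^sub>R (g x * p x)) \<longlonglongrightarrow> indicator UNIV x *\<^sub>R (g x * p x)"
      proof (intro AE_I2 tendsto_eventually)
        fix x
        have "eventually (\<lambda>n. X n \<le> x) sequentially" using X by (auto simp: filterlim_at_bot)
        then show "eventually (\<lambda>n. indicator {X n..} x *\<^sub>R (g x * p x) = indicator UNIV x *\<^sub>R (g x * p x)) sequentially"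
          by eventually_elim (auto simp: indicator_def)
      qed
    qed (use gp_int in \<open>auto split: split_indicator\<close>)
  qed
  moreover have "(LBINT x:UNIV. g x * p x) = 0" using gp_zero by (simp add: set_lebesgue_integral_def)
  ultimately show ?thesis by (simp add: G_def[abs_def])
qed

lemma nonzero_subset: "{x. G x \<noteq> 0} \<subseteq> I" using G_outside by blast

lemma open_nonzero: "open {x. G x \<noteq> 0}"
  using G_continuous[of UNIV] by (intro open_Collect_neq) auto

lemma compact_superlevel: assumes "\<delta> > 0" shows "compact {x. \<bar>G x\<bar> \<ge> \<delta>}"
proof -
  have "closed {x. \<bar>G x\<bar> \<ge> \<delta>}"
    by (intro closed_Collect_le continuous_intros G_continuous)
  moreover have "bounded {x. \<bar>G x\<bar> \<ge> \<delta>}"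
  proof -
    have "eventually (\<lambda>x. \<bar>G x\<bar> < \<delta>) at_top" "eventually (\<lambda>x. \<bar>G x\<bar> < \<delta>) at_bot"
      using order_tendstoD(2)[OF tendsto_rabs[OF G_at_top], of \<delta>] order_tendstoD(2)[OF tendsto_rabs[OF G_at_bot], of \<delta>] assms
      by auto
    then obtain a b where "\<And>x. x \<ge> b \<Longrightarrow> \<bar>G x\<bar> < \<delta>" "\<And>x. x \<le> a \<Longrightarrow> \<bar>G x\<bar> < \<delta>"
      unfolding eventually_at_top_linorder eventually_at_bot_linorder by blast
    then have "{x. \<bar>G x\<bar> \<ge> \<delta>} \<subseteq> {a..b}"
    proof (intro subsetI)
      fix x assume "x \<in> {x. \<bar>G x\<bar> \<ge> \<delta>}"
      then have "\<not> \<bar>G x\<bar> < \<delta>" by simp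
      then have "\<not> x \<ge> b" "\<not> x \<le> a" using \<open>\<And>x. x \<ge> b \<Longrightarrow> \<bar>G x\<bar> < \<delta>\<close> \<open>\<And>x. x \<le> a \<Longrightarrow> \<bar>G x\<bar> < \<delta>\<close> by blast+
      then show "x \<in> {a..b}" by simp
    qed
    then show ?thesis by (rule bounded_subset[rotated]) simp
  qed
  ultimately show ?thesis by (simp add: compact_eq_bounded_closed)
qed

lemma Lop_differentiable: assumes "y \<in> I" shows "Lop p g differentiable (at y)"
proof -
  have "p differentiable (at y)" using p_diff open_I assms by (simp add: differentiable_on_eq_differentiable_at)
  moreover have "G differentiable (at y)" using G_has_derivative[OF assms] by (auto simp: real_differentiable_def)
  ultimately show ?thesis unfolding Lop_eq[abs_def] using p_pos[OF assms] by (intro differentiable_divide) auto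
qed

text \<open>At such a point the derivative \<open>- g p\<close> of \<open>G\<close> is nonzero, so the zero is isolated and is
  determined by two rationals that separate it from the other zeros.\<close>

lemma countable_isolated_zeros: "countable {x \<in> I. G x = 0 \<and> g x \<noteq> 0}" (is "countable ?X")
proof -
  let ?Z = "{x. G x = 0}"
  have ex: "\<exists>a b. a \<in> \<rat> \<and> b \<in> \<rat> \<and> a < x \<and> x < b \<and> {a<..<b} \<inter> ?Z = {x}" if x: "x \<in> ?X" for x
  proof -
    have "- (g x * p x) \<noteq> 0" using x p_pos[of x] by auto
    moreover have "((\<lambda>y. (G y - G x) / (y - x)) \<longlongrightarrow> - (g x * p x)) (at x)"
      using G_has_derivative[of x] x by (simp add: has_field_derivative_iff)
    ultimately have "eventually (\<lambda>y. (G y - G x) / (y - x) \<noteq> 0) (at x)"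
      by (intro tendsto_imp_eventually_ne)
    then obtain d where d: "d > 0" "\<And>y. y \<noteq> x \<Longrightarrow> dist y x < d \<Longrightarrow> G y \<noteq> 0"
      using x by (auto simp: eventually_at)
    obtain a where a: "a \<in> \<rat>" "x - d < a" "a < x" using Rats_dense_in_real[of "x - d" x] d by auto
    obtain b where b: "b \<in> \<rat>" "x < b" "b < x + d" using Rats_dense_in_real[of x "x + d"] d by auto
    have "{a<..<b} \<inter> ?Z = {x}"
    proof (intro equalityI subsetI)
      fix y assume "y \<in> {a<..<b} \<inter> ?Z"
      moreover from this a b have "dist y x < d" by (auto simp: dist_real_def)
      ultimately show "y \<in> {x}" using d(2) by blast
    qed (use a b x in auto)
    with a b show ?thesis by blast
  qed
  define c where "c x = (SOME c. c \<in> \<rat> \<times> \<rat> \<and> {fst c<..<snd c} \<inter> ?Z = {x})" for x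
  have cx: "c x \<in> \<rat> \<times> \<rat> \<and> {fst (c x)<..<snd (c x)} \<inter> ?Z = {x}" if x: "x \<in> ?X" for x
  proof -
    obtain a b where "a \<in> \<rat> \<and> b \<in> \<rat> \<and> a < x \<and> x < b \<and> {a<..<b} \<inter> ?Z = {x}" using ex[OF x] by blast
    then have "(a, b) \<in> \<rat> \<times> \<rat> \<and> {fst (a, b)<..<snd (a, b)} \<inter> ?Z = {x}" by simp
    then show ?thesis unfolding c_def by (rule someI)
  qed
  then have c: "\<And>x. x \<in> ?X \<Longrightarrow> c x \<in> \<rat> \<times> \<rat>"
    and sing: "\<And>x. x \<in> ?X \<Longrightarrow> {fst (c x)<..<snd (c x)} \<inter> ?Z = {x}" by blast+
  have "inj_on c ?X"
  proof (rule inj_onI)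
    fix x y assume x: "x \<in> ?X" and y: "y \<in> ?X" and eq: "c x = c y"
    have "{x} = {y}" using sing[OF x] sing[OF y] unfolding eq by (rule trans[OF sym])
    then show "x = y" by simp
  qed
  moreover have "c ` ?X \<subseteq> \<rat> \<times> \<rat>" using c by blast
  moreover have "countable (\<rat> \<times> \<rat> :: (real \<times> real) set)" by (intro countable_SIGMA countable_rat)
  ultimately show ?thesis using countable_subset countable_image_inj_on by blast
qed

lemma g_zero_ae: "AE x in lborel. x \<in> I \<longrightarrow> G x = 0 \<longrightarrow> g x = 0"
proof -
  have "AE x in lborel. x \<notin> {x \<in> I. G x = 0 \<and> g x \<noteq> 0}"
    by (intro AE_not_in countable_imp_null_set_lborel countable_isolated_zeros)
  then show ?thesis by eventually_elim auto
qed

text \<open>A chart \<open>\<tau>\<close> of the part \<open>A\<close> of the line in which the field \<open>\<L>g\<close> is the constant \<open>e\<close>: the measure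
  with density \<open>q\<close> is carried to the restriction of \<open>p\<close> to \<open>A\<close>, moving \<open>s\<close> with speed \<open>e\<close> moves \<open>\<tau> s\<close> along
  the field, and the cut-off density is differentiable at every point of the line and
  vanishes along the line near each zero of \<open>q\<close>. The formula for its derivative is \<open>(p \<L>g)' = - g p\<close> in the chart, apart from the
  derivative of the cutoff.\<close>

definition flow_chart :: "real set \<Rightarrow> real \<Rightarrow> (real \<Rightarrow> real) \<Rightarrow> (real \<Rightarrow> real) \<Rightarrow> bool" where
  "flow_chart A e \<tau> q \<longleftrightarrow>
     \<tau> \<in> borel_measurable borel \<and> q \<in> borel_measurable borel \<and> (\<forall>s. 0 \<le> q s) \<and>
     (\<forall>B\<in>sets borel. (\<integral>\<^sup>+s. ennreal (q s * indicator B (\<tau> s)) \<partial>lborel) = (\<integral>\<^sup>+x. ennreal (p x * indicator (A \<inter> B) x) \<partial>lborel)) \<and>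
     (\<forall>s. q s \<noteq> 0 \<longrightarrow> \<tau> s \<in> A \<and> ((\<lambda>t. \<tau> (s + t * e)) has_real_derivative Lop p g (\<tau> s)) (at 0)) \<and>
     (\<forall>\<delta>>0. \<forall>s. ((\<lambda>t. cutoff \<delta> (G (\<tau> (s + t * e))) * q (s + t * e)) has_real_derivative
         - (soft_step \<delta> \<bar>G (\<tau> s)\<bar> * g (\<tau> s) * q s)) (at 0)) \<and>
     (\<forall>\<delta>>0. \<forall>s. q s = 0 \<longrightarrow> eventually (\<lambda>t. cutoff \<delta> (G (\<tau> (s + t * e))) * q (s + t * e) = 0) (nhds 0))"

lemma G_meas[measurable]: "G \<in> borel_measurable borel"
  by (rule borel_measurable_continuous_onI[OF G_continuous])

text \<open>Where the flux vanishes the field vanishes, so the identity with speed \<open>0\<close> is a chart.\<close>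

lemma flow_chart_zeros: "flow_chart {x\<in>I. G x = 0} 0 (\<lambda>s. s) (\<lambda>s. if s \<in> I \<and> G s = 0 then p s else 0)"
proof -
  have "(if s \<in> I \<and> G s = 0 then p s else 0) * indicator B s = p s * indicator ({x\<in>I. G x = 0} \<inter> B) s" for s B
    by (auto simp: indicator_def)
  moreover have "soft_step \<delta> 0 = 0" if "\<delta> > 0" for \<delta> using that by (simp add: soft_step_def)
  ultimately show ?thesis
    unfolding flow_chart_def using p_nonneg by (auto simp: Lop_eq)
qed

text \<open>On a component of the set where the flux is nonzero, the coordinate \<open>s = \<integral> p / G\<close> satisfies
  \<open>s' = 1 / \<L>g\<close>. Its inverse \<open>\<tau>\<close> solves \<open>\<tau>' = \<L>g(\<tau>)\<close>, so \<open>p dx\<close> becomes \<open>|\<L>g(\<tau>)| p(\<tau>) ds = |G(\<tau>)| ds\<close>.\<close>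

lemma flow_chart_component:
  assumes J: "J \<in> components {x. G x \<noteq> 0}"
  shows "\<exists>\<tau> q. flow_chart J 1 \<tau> q"
proof -
  have oJ: "open J" using open_components[OF open_nonzero J] .
  have cJ: "connected J" using J by (rule in_components_connected)
  then have iJ: "\<And>a b x. a \<in> J \<Longrightarrow> b \<in> J \<Longrightarrow> a \<le> x \<Longrightarrow> x \<le> b \<Longrightarrow> x \<in> J"
    unfolding is_interval_connected_1[symmetric] is_interval_1 by blast
  have JU: "\<And>x. x \<in> J \<Longrightarrow> G x \<noteq> 0" using in_components_subset[OF J] by auto
  have JI: "\<And>x. x \<in> J \<Longrightarrow> x \<in> I" using JU G_outside by blast
  obtain c where c: "c \<in> J" using in_components_nonempty[OF J] by blast
  define s where "s x = (LBINT t=ereal c..ereal x. p t / G t)" for x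
  have ds: "(s has_real_derivative p x / G x) (at x)" if x: "x \<in> J" for x
  proof -
    obtain \<epsilon> where \<epsilon>: "\<epsilon> > 0" "cball x \<epsilon> \<subseteq> J" using oJ x by (meson open_contains_cball)
    then have e: "x - \<epsilon> \<in> J" "x + \<epsilon> \<in> J" by (auto simp: subset_iff dist_real_def)
    define a where "a = min c (x - \<epsilon>)"
    define b where "b = max c (x + \<epsilon>)"
    have ab: "a \<in> J" "b \<in> J" "a \<le> c" "c \<le> b" "a < x" "x < b"
      using e c \<epsilon> by (auto simp: a_def b_def min_def max_def)
    have sub: "{a..b} \<subseteq> J" using iJ[OF ab(1,2)] by auto
    have "continuous_on {a..b} (\<lambda>t. p t / G t)"
      using sub JU JI by (intro continuous_intros G_continuous continuous_on_subset[OF p_continuous]) auto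
    then have "(s has_vector_derivative p x / G x) (at x within {a..b})"
      unfolding s_def using ab by (intro interval_integral_FTC2) auto
    then show ?thesis
      using at_within_interior[of x "{a..b}"] ab by (simp add: has_real_derivative_iff_has_vector_derivative)
  qed
  have nz: "p x / G x \<noteq> 0" if "x \<in> J" for x using p_pos[OF JI[OF that]] JU[OF that] by simp
  have inj: "inj_on s J"
  proof (rule linorder_inj_onI')
    fix x y assume xy: "x \<in> J" "y \<in> J" "x < y"
    show "s x \<noteq> s y"
    proof
      assume eq: "s x = s y"
      have sub: "{x..y} \<subseteq> J" using iJ[OF xy(1,2)] by auto
      have "\<exists>z>x. z < y \<and> (\<lambda>v. (p z / G z) * v) = (\<lambda>v. 0)"
      proof (rule Rolle_deriv[OF xy(3) eq])
        show "continuous_on {x..y} s"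
          by (rule DERIV_continuous_on, rule has_field_derivative_at_within, rule ds) (use sub in auto)
        show "(s has_derivative (\<lambda>v. (p z / G z) * v)) (at z)" if "x < z" "z < y" for z
        proof -
          have "z \<in> J" using sub that by auto
          from ds[OF this] show ?thesis unfolding has_field_derivative_def .
        qed
      qed
      then obtain z where "x < z" "z < y" "(\<lambda>v. (p z / G z) * v) = (\<lambda>v. 0)" by blast
      then have "z \<in> J" using sub by auto
      from fun_cong[OF \<open>(\<lambda>v. (p z / G z) * v) = (\<lambda>v. 0)\<close>, of 1] nz[OF this] show False by simp
    qed
  qed
  have cs: "continuous_on J s"
    by (rule DERIV_continuous_on) (use ds in \<open>auto intro: has_field_derivative_at_within\<close>)
  define S where "S = s ` J"
  have oS: "open S" unfolding S_def by (rule invariance_of_domain[OF cs oJ inj])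
  then have [measurable]: "S \<in> sets borel" by simp
  have [measurable]: "J \<in> sets borel" using oJ by simp
  define \<tau> where "\<tau> y = (if y \<in> S then the_inv_into J s y else 0)" for y
  have \<tau>s: "\<tau> (s x) = x" if "x \<in> J" for x using that inj by (simp add: \<tau>_def S_def the_inv_into_f_f)
  have \<tau>J: "\<tau> y \<in> J" and s\<tau>: "s (\<tau> y) = y" if "y \<in> S" for y
    using that by (auto simp: S_def \<tau>s)
  have d\<tau>: "(\<tau> has_real_derivative Lop p g (\<tau> y)) (at y)" if y: "y \<in> S" for y
  proof -
    define x where "x = \<tau> y"
    have x: "x \<in> J" "y = s x" using \<tau>J[OF y] s\<tau>[OF y] by (auto simp: x_def)
    have "(\<tau> has_derivative (\<lambda>v. (G x / p x) * v)) (at (s x))"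
    proof (rule has_derivative_inverse_strong[OF oJ x(1) cs \<tau>s])
      show "(s has_derivative (\<lambda>v. (p x / G x) * v)) (at x)" using ds[OF x(1)] unfolding has_field_derivative_def .
      show "(\<lambda>v. (p x / G x) * v) \<circ> (\<lambda>v. (G x / p x) * v) = id" using nz[OF x(1)] by (auto simp: fun_eq_iff)
    qed
    then have "(\<tau> has_real_derivative G x / p x) (at (s x))" unfolding has_field_derivative_def .
    then show ?thesis using x by (simp add: Lop_eq \<tau>s)
  qed
  have c\<tau>: "continuous_on S \<tau>"
    by (rule DERIV_continuous_on) (use d\<tau> in \<open>auto intro: has_field_derivative_at_within\<close>)
  have "(\<lambda>y. indicator S y *\<^sub>R \<tau> y) \<in> borel_measurable borel"
    by (rule borel_measurable_continuous_on_indicator[OF _ c\<tau>]) simp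
  moreover have "(\<lambda>y. indicator S y *\<^sub>R \<tau> y) = \<tau>" by (auto simp: \<tau>_def indicator_def)
  ultimately have [measurable]: "\<tau> \<in> borel_measurable borel" by simp
  define q where "q y = (if y \<in> S then \<bar>G (\<tau> y)\<bar> else 0)" for y
  have [measurable]: "q \<in> borel_measurable borel" unfolding q_def[abs_def] by measurable
  have inj\<tau>: "inj_on \<tau> S" by (rule inj_on_inverseI) (rule s\<tau>)
  have im\<tau>: "\<tau> ` S = J" using \<tau>J \<tau>s by (force simp: S_def)
  have transport: "(\<integral>\<^sup>+y. ennreal (q y * indicator B (\<tau> y)) \<partial>lborel) = (\<integral>\<^sup>+x. ennreal (p x * indicator (J \<inter> B) x) \<partial>lborel)"
    if [measurable]: "B \<in> sets borel" for B
  proof -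
    let ?f = "\<lambda>x. p x * indicator B x"
    have "integrable lborel (\<lambda>x. indicator J x *\<^sub>R ?f x)"
      by (rule Bochner_Integration.integrable_bound[OF p_int]) (auto simp: p_nonneg split: split_indicator)
    then have "set_integrable lebesgue J ?f" unfolding set_integrable_def by (subst integrable_completion) auto
    then have f: "?f absolutely_integrable_on \<tau> ` S" unfolding im\<tau> .
    have "S \<in> sets lebesgue" by simp
    from has_absolute_integral_change_of_variables_1'[OF this has_field_derivative_at_within[OF d\<tau>] inj\<tau>, THEN iffD2, OF _ conjI[OF f refl]]
    have 1: "(\<lambda>y. \<bar>Lop p g (\<tau> y)\<bar> * ?f (\<tau> y)) absolutely_integrable_on S"
      and 2: "integral S (\<lambda>y. \<bar>Lop p g (\<tau> y)\<bar> * ?f (\<tau> y)) = integral J ?f" unfolding im\<tau> by auto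
    have "((\<lambda>y. \<bar>Lop p g (\<tau> y)\<bar> * ?f (\<tau> y)) has_integral integral J ?f) S"
      using 2 set_lebesgue_integral_eq_integral(1)[OF 1] by (simp add: has_integral_iff)
    then have "((\<lambda>y. q y * indicator B (\<tau> y)) has_integral integral J ?f) S"
    proof (rule has_integral_eq[rotated])
      fix y assume y: "y \<in> S"
      show "\<bar>Lop p g (\<tau> y)\<bar> * ?f (\<tau> y) = q y * indicator B (\<tau> y)"
        using y p_pos[OF JI[OF \<tau>J[OF y]]] by (simp add: q_def Lop_eq)
    qed
    then have "((\<lambda>y. if y \<in> S then q y * indicator B (\<tau> y) else 0) has_integral integral J ?f) UNIV"
      by (simp add: has_integral_restrict_UNIV)
    moreover have "(\<lambda>y. if y \<in> S then q y * indicator B (\<tau> y) else 0) = (\<lambda>y. q y * indicator B (\<tau> y))"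
      by (auto simp: q_def)
    ultimately have "(\<integral>\<^sup>+y. ennreal (q y * indicator B (\<tau> y)) \<partial>lborel) = ennreal (integral J ?f)"
      by (intro nn_integral_has_integral_lborel) (auto simp: q_def)
    moreover have "(?f has_integral integral J ?f) J"
      using set_lebesgue_integral_eq_integral(1)[OF f] unfolding im\<tau> by (simp add: has_integral_iff)
    then have "((\<lambda>x. if x \<in> J then ?f x else 0) has_integral integral J ?f) UNIV"
      by (simp add: has_integral_restrict_UNIV)
    moreover have "(\<lambda>x. if x \<in> J then ?f x else 0) = (\<lambda>x. p x * indicator (J \<inter> B) x)"
      by (auto simp: indicator_def)
    ultimately show ?thesis
      by (subst nn_integral_has_integral_lborel[where I="integral J ?f"]) (auto simp: p_nonneg)
  qed
  have \<beta>: "cutoff \<delta> (G (\<tau> y)) * q y = (if y \<in> S then soft_pos \<delta> \<bar>G (\<tau> y)\<bar> else 0)" for \<delta> y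
    using JU[OF \<tau>J, of y] by (auto simp: cutoff_def q_def)
  have shift0: "eventually (\<lambda>t. P (y + t)) (nhds 0)" if "eventually P (nhds y)" for P and y :: real
  proof -
    have "((\<lambda>t. y + t) \<longlongrightarrow> y + 0) (nhds 0)" by (intro tendsto_intros filterlim_ident)
    then show ?thesis using that by (simp add: filterlim_iff)
  qed
  have vanish: "eventually (\<lambda>t. cutoff \<delta> (G (\<tau> (y + t))) * q (y + t) = 0) (nhds 0)" if \<delta>: "\<delta> > 0" and y: "y \<notin> S" for \<delta> y
  proof -
    \<comment> \<open>the points of the component that are not cut off form a compact set, so their image in the chart is closed\<close>
    let ?K = "{x. \<bar>G x\<bar> \<ge> \<delta>} \<inter> J"
    have "closedin (top_of_set {x. G x \<noteq> 0}) J" by (rule closedin_component[OF J])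
    then obtain T where T: "closed T" "J = {x. G x \<noteq> 0} \<inter> T" by (auto simp: closedin_closed)
    have "?K = {x. \<bar>G x\<bar> \<ge> \<delta>} \<inter> T" using T(2) \<delta> by auto
    then have "compact ?K" using compact_Int_closed[OF compact_superlevel[OF \<delta>] T(1)] by simp
    then have "compact (s ` ?K)" by (rule compact_continuous_image[rotated]) (rule continuous_on_subset[OF cs], blast)
    then have "open (- (s ` ?K))" by (simp add: compact_imp_closed open_Compl)
    moreover have "y \<in> - (s ` ?K)" using y by (auto simp: S_def)
    ultimately have "eventually (\<lambda>z. z \<in> - (s ` ?K)) (nhds y)" by (rule eventually_nhds_in_open)
    then have "eventually (\<lambda>z. cutoff \<delta> (G (\<tau> z)) * q z = 0) (nhds y)"
    proof eventually_elim
      case (elim z)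
      show ?case
      proof (cases "z \<in> S")
        case True
        have "\<tau> z \<notin> ?K" using elim s\<tau>[OF True] by (metis ComplD imageI)
        then have "\<bar>G (\<tau> z)\<bar> \<le> \<delta>" using \<tau>J[OF True] by auto
        then show ?thesis by (simp add: \<beta> soft_pos_def)
      qed (simp add: \<beta>)
    qed
    then show ?thesis by (rule shift0)
  qed
  have deriv: "((\<lambda>t. cutoff \<delta> (G (\<tau> (y + t))) * q (y + t)) has_real_derivative
         - (soft_step \<delta> \<bar>G (\<tau> y)\<bar> * g (\<tau> y) * q y)) (at 0)" if \<delta>: "\<delta> > 0" for \<delta> y
  proof (cases "y \<in> S")
    case False
    then have "q y = 0" by (simp add: q_def)
    then show ?thesis by (subst DERIV_cong_ev[OF refl vanish[OF \<delta> False] refl]) simp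
  next
    case True
    let ?x = "\<tau> y"
    have x: "?x \<in> I" "G ?x \<noteq> 0" "p ?x > 0" using True \<tau>J JI JU p_pos by auto
    have "((\<lambda>z. G (\<tau> z)) has_real_derivative - (g ?x * p ?x) * Lop p g ?x) (at y)"
      by (rule DERIV_chain2[OF G_has_derivative[OF x(1)] d\<tau>[OF True]])
    then have "((\<lambda>z. G (\<tau> z)) has_real_derivative - (g ?x * G ?x)) (at y)" using x by (simp add: Lop_eq)
    then have "((\<lambda>z. \<bar>G (\<tau> z)\<bar>) has_real_derivative sgn (G ?x) * - (g ?x * G ?x)) (at y)"
      by (rule abs_has_real_derivative) (rule x)
    from DERIV_chain2[OF soft_pos_has_derivative[OF \<delta>] this]
    have "((\<lambda>z. soft_pos \<delta> \<bar>G (\<tau> z)\<bar>) has_real_derivative - (soft_step \<delta> \<bar>G ?x\<bar> * g ?x * q y)) (at y)"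
      using True by (simp add: q_def abs_sgn mult_ac)
    moreover have "eventually (\<lambda>z. z \<in> S) (nhds y)" using oS True by (rule eventually_nhds_in_open)
    then have "eventually (\<lambda>z. cutoff \<delta> (G (\<tau> z)) * q z = soft_pos \<delta> \<bar>G (\<tau> z)\<bar>) (nhds y)"
      by eventually_elim (simp add: \<beta>)
    ultimately have "((\<lambda>z. cutoff \<delta> (G (\<tau> z)) * q z) has_real_derivative - (soft_step \<delta> \<bar>G ?x\<bar> * g ?x * q y)) (at y)"
      by (subst DERIV_cong_ev[OF refl _ refl])
    then show ?thesis using DERIV_shift[of "\<lambda>z. cutoff \<delta> (G (\<tau> z)) * q z" _ 0 y] by (simp add: add.commute)
  qed
  have dshift: "((\<lambda>t. \<tau> (y + t)) has_real_derivative Lop p g (\<tau> y)) (at 0)" if "y \<in> S" for y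
    using d\<tau>[OF that] DERIV_shift[of \<tau> _ 0 y] by (simp add: add.commute)
  have qS: "q y = 0 \<longleftrightarrow> y \<notin> S" for y using JU[OF \<tau>J, of y] by (auto simp: q_def)
  have "flow_chart J 1 \<tau> q"
    unfolding flow_chart_def mult_1_right qS
  proof (intro conjI allI ballI impI)
    show "0 \<le> q y" for y by (simp add: q_def)
  qed (use transport vanish deriv dshift \<tau>J in \<open>simp_all add: qS\<close>)
  then show ?thesis by blast
qed

lemma flow_chart_cover:
  obtains \<A> where "countable \<A>" "\<And>A. A \<in> \<A> \<Longrightarrow> A \<in> sets borel" "disjoint \<A>" "\<Union>\<A> = I"
    "\<And>A. A \<in> \<A> \<Longrightarrow> \<exists>e \<tau> q. flow_chart A e \<tau> q"
proof
  let ?U = "{x. G x \<noteq> 0}" and ?Z = "{x\<in>I. G x = 0}"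
  let ?A = "insert ?Z (components ?U)"
  have oc: "\<And>C. C \<in> components ?U \<Longrightarrow> open C" using open_components[OF open_nonzero] .
  have pw: "pairwise disjnt (components ?U)" by (auto simp: pairwise_def disjnt_def components_nonoverlap)
  show "countable ?A" using countable_disjoint_open_subsets[OF oc pw] by simp
  show "\<And>A. A \<in> ?A \<Longrightarrow> A \<in> sets borel" using oc by auto
  have "C \<inter> ?Z = {}" if "C \<in> components ?U" for C using in_components_subset[OF that] by auto
  then show "disjoint ?A" using pw by (simp add: disjoint_def pairwise_def disjnt_def) blast
  show "\<Union>?A = I" using nonzero_subset Union_components[of ?U] by auto
  show "\<exists>e \<tau> q. flow_chart A e \<tau> q" if "A \<in> ?A" for A
    using that flow_chart_zeros flow_chart_component by blast
qed

end

section \<open>Translations and changes of variables in a product\<close>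

abbreviation lborel_fun :: "('n \<Rightarrow> real) measure" where
  "lborel_fun \<equiv> PiM UNIV (\<lambda>_. lborel)"

lemma sigma_finite_lborel_fun: "sigma_finite_measure (lborel_fun :: ('n::finite \<Rightarrow> real) measure)"
proof -
  interpret product_sigma_finite "\<lambda>_::'n. lborel :: real measure" ..
  show ?thesis by (rule sigma_finite) simp
qed

lemma measurable_shift[measurable]:
  fixes e :: "'n::finite \<Rightarrow> real"
  shows "(\<lambda>(s, t). (\<lambda>k. s k + t * e k)) \<in> lborel_fun \<Otimes>\<^sub>M lborel \<rightarrow>\<^sub>M lborel_fun"
  unfolding split_beta by (rule measurable_PiM_single') (auto simp: space_PiM)

lemma distr_shift:
  fixes c :: "'n::finite \<Rightarrow> real"
  shows "distr lborel_fun lborel_fun (\<lambda>s k. s k + c k) = lborel_fun"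
proof -
  interpret product_sigma_finite "\<lambda>_::'n. lborel :: real measure" ..
  have [measurable]: "(\<lambda>s k. s k + c k) \<in> lborel_fun \<rightarrow>\<^sub>M (lborel_fun :: ('n \<Rightarrow> real) measure)"
    by (rule measurable_PiM_single') (auto simp: space_PiM)
  show ?thesis
  proof (rule PiM_eqI)
    fix A :: "'n \<Rightarrow> real set" assume A: "\<And>i. i \<in> UNIV \<Longrightarrow> A i \<in> sets lborel"
    have [measurable]: "A i \<in> sets borel" for i using A[of i] by simp
    have [measurable]: "(\<lambda>x. x + c i) -` A i \<in> sets borel" for i
      using measurable_sets[of "\<lambda>x. x + c i" borel borel "A i"] by simp
    have "emeasure (distr lborel_fun lborel_fun (\<lambda>s k. s k + c k)) (Pi\<^sub>E UNIV A) =
        emeasure lborel_fun (Pi\<^sub>E UNIV (\<lambda>i. (\<lambda>x. x + c i) -` A i))"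
      by (subst emeasure_distr) (auto intro!: arg_cong2[where f=emeasure] simp: space_PiM PiE_iff)
    also have "\<dots> = (\<Prod>i\<in>UNIV. emeasure lborel ((\<lambda>x. x + c i) -` A i))"
      by (rule emeasure_PiM) auto
    also have "\<dots> = (\<Prod>i\<in>UNIV. emeasure lborel (A i))"
    proof (intro prod.cong refl)
      fix i
      have "emeasure lborel (A i) = emeasure (distr lborel borel ((+) (c i))) (A i)" by (simp add: lborel_distr_plus)
      also have "\<dots> = emeasure lborel ((\<lambda>x. x + c i) -` A i)"
        by (subst emeasure_distr) (auto intro!: arg_cong2[where f=emeasure] simp: add.commute)
      finally show "emeasure lborel ((\<lambda>x. x + c i) -` A i) = emeasure lborel (A i)" by simp
    qed
    finally show "emeasure (distr lborel_fun lborel_fun (\<lambda>s k. s k + c k)) (Pi\<^sub>E UNIV A) = (\<Prod>i\<in>UNIV. emeasure lborel (A i))" .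
  qed auto
qed

text \<open>By Fubini's theorem \<open>f'\<close> is integrable along almost every line in direction \<open>e\<close>, so there
  \<open>f(s + e) - f(s)\<close> is the integral of \<open>f'(s + t e)\<close> over \<open>t \<in> [0, 1]\<close>. Integrating over \<open>s\<close>, translation
  invariance makes the left side \<open>0\<close> and the right side \<open>\<integral> f'\<close>.\<close>

lemma integral_directional_derivative_zero:
  fixes f f' :: "('n::finite \<Rightarrow> real) \<Rightarrow> real" and e :: "'n \<Rightarrow> real"
  assumes f: "integrable lborel_fun f" and f': "integrable lborel_fun f'"
    and deriv: "\<And>s. ((\<lambda>t. f (\<lambda>k. s k + t * e k)) has_real_derivative f' s) (at 0)"
  shows "(\<integral>s. f' s \<partial>lborel_fun) = 0"
proof -
  interpret N: sigma_finite_measure "lborel_fun :: ('n \<Rightarrow> real) measure" by (rule sigma_finite_lborel_fun)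
  interpret NL: pair_sigma_finite "lborel_fun :: ('n \<Rightarrow> real) measure" "lborel :: real measure" ..
  define sh where "sh t s = (\<lambda>k. s k + t * e k)" for t and s :: "'n \<Rightarrow> real"
  have shm[measurable]: "sh t \<in> lborel_fun \<rightarrow>\<^sub>M lborel_fun" for t
    unfolding sh_def[abs_def] by (rule measurable_PiM_single') (auto simp: space_PiM)
  have shd: "distr lborel_fun lborel_fun (sh t) = lborel_fun" for t
    unfolding sh_def[abs_def] by (rule distr_shift)
  have shi: "(\<integral>s. h (sh t s) \<partial>lborel_fun) = (\<integral>s. h s \<partial>lborel_fun)" and shint: "integrable lborel_fun (\<lambda>s. h (sh t s))"
    if h: "integrable lborel_fun h" for h :: "('n \<Rightarrow> real) \<Rightarrow> real" and t
  proof -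
    have [measurable]: "h \<in> borel_measurable lborel_fun" using h by auto
    show "(\<integral>s. h (sh t s) \<partial>lborel_fun) = (\<integral>s. h s \<partial>lborel_fun)"
      by (subst (2) shd[of t, symmetric], subst integral_distr) auto
    show "integrable lborel_fun (\<lambda>s. h (sh t s))"
      using h by (subst (asm) shd[of t, symmetric], subst (asm) integrable_distr_eq) auto
  qed
  have [measurable]: "f' \<in> borel_measurable lborel_fun" using f' by auto
  define h where "h = (\<lambda>(s, t). indicator {0..1} t * f' (sh t s))"
  have hm[measurable]: "h \<in> borel_measurable (lborel_fun \<Otimes>\<^sub>M lborel)"
  proof -
    have "(\<lambda>x. f' ((\<lambda>(s, t). (\<lambda>k. s k + t * e k)) x)) \<in> borel_measurable (lborel_fun \<Otimes>\<^sub>M lborel)"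
      by (rule measurable_compose[OF measurable_shift]) measurable
    then show ?thesis unfolding h_def sh_def split_beta by measurable
  qed
  have hint: "integrable (lborel_fun \<Otimes>\<^sub>M lborel) h"
  proof (rule integrableI_bounded[OF hm])
    have "(\<integral>\<^sup>+x. ennreal (norm (h x)) \<partial>(lborel_fun \<Otimes>\<^sub>M lborel)) = (\<integral>\<^sup>+t. \<integral>\<^sup>+s. ennreal (norm (h (s, t))) \<partial>lborel_fun \<partial>lborel)"
      by (rule NL.nn_integral_snd[symmetric]) simp
    also have "\<dots> = (\<integral>\<^sup>+t. indicator {0..1} t * (\<integral>\<^sup>+s. ennreal \<bar>f' s\<bar> \<partial>lborel_fun) \<partial>(lborel::real measure))"
    proof (rule nn_integral_cong)
      fix t :: real
      have "(\<integral>\<^sup>+s. ennreal (norm (h (s, t))) \<partial>lborel_fun) = (\<integral>\<^sup>+s. indicator {0..1} t * ennreal \<bar>f' (sh t s)\<bar> \<partial>lborel_fun)"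
        by (rule nn_integral_cong) (auto simp: h_def split: split_indicator)
      also have "\<dots> = indicator {0..1} t * (\<integral>\<^sup>+s. ennreal \<bar>f' (sh t s)\<bar> \<partial>lborel_fun)"
        by (rule nn_integral_cmult) measurable
      also have "(\<integral>\<^sup>+s. ennreal \<bar>f' (sh t s)\<bar> \<partial>lborel_fun) = (\<integral>\<^sup>+s. ennreal \<bar>f' s\<bar> \<partial>lborel_fun)"
        by (subst (2) shd[of t, symmetric], subst nn_integral_distr) auto
      finally show "(\<integral>\<^sup>+s. ennreal (norm (h (s, t))) \<partial>lborel_fun) = indicator {0..1} t * (\<integral>\<^sup>+s. ennreal \<bar>f' s\<bar> \<partial>lborel_fun)" .
    qed
    also have "\<dots> = (\<integral>\<^sup>+s. ennreal \<bar>f' s\<bar> \<partial>lborel_fun)"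
      by (subst nn_integral_multc) auto
    also have "\<dots> < \<infinity>" using f' by (simp add: integrable_iff_bounded)
    finally show "(\<integral>\<^sup>+x. ennreal (norm (h x)) \<partial>(lborel_fun \<Otimes>\<^sub>M lborel)) < \<infinity>" .
  qed
  have line: "((\<lambda>t. f (sh t s)) has_real_derivative f' (sh t s)) (at t)" for s t
  proof -
    have "(\<lambda>u. f (sh (u + t) s)) = (\<lambda>u. f (\<lambda>k. sh t s k + u * e k))" by (simp add: sh_def algebra_simps)
    then show ?thesis using deriv[of "sh t s"] DERIV_shift[of "\<lambda>t. f (sh t s)" _ 0 t] by simp
  qed
  have "AE s in lborel_fun. integrable lborel (\<lambda>t. h (s, t))" by (rule NL.AE_integrable_fst'[OF hint])
  then have inner: "AE s in lborel_fun. (LBINT t. h (s, t)) = f (sh 1 s) - f s"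
  proof eventually_elim
    case (elim s)
    then have si: "set_integrable lborel {0..1} (\<lambda>t. f' (sh t s))"
      by (simp add: set_integrable_def h_def)
    have "((\<lambda>t. f' (sh t s)) has_integral (f (sh 1 s) - f (sh 0 s))) {0..1}"
      by (rule fundamental_theorem_of_calculus)
        (auto simp: has_real_derivative_iff_has_vector_derivative[symmetric] intro: has_field_derivative_at_within line)
    then have "(LBINT t:{0..1}. f' (sh t s)) = f (sh 1 s) - f (sh 0 s)"
      using set_borel_integral_eq_integral(2)[OF si] by (simp add: integral_unique)
    then show ?case by (simp add: set_lebesgue_integral_def h_def sh_def)
  qed
  have "(\<integral>s. f' s \<partial>lborel_fun) = (LBINT t::real. indicator {0..1} t * (\<integral>s. f' s \<partial>lborel_fun))" by (simp add: content_real)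
  also have "\<dots> = (LBINT t. \<integral>s. h (s, t) \<partial>lborel_fun)"
    by (intro Bochner_Integration.integral_cong refl) (simp add: h_def shi[OF f'])
  also have "\<dots> = (\<integral>s. (LBINT t. h (s, t)) \<partial>lborel_fun)"
    using NL.Fubini_integral[of "\<lambda>s t. h (s, t)"] hint by simp
  also have "\<dots> = (\<integral>s. f (sh 1 s) - f s \<partial>lborel_fun)"
    using f shint[OF f, of 1] by (intro integral_cong_AE inner) auto
  also have "\<dots> = 0" using f shint[OF f] by (simp add: shi[OF f])
  finally show ?thesis .
qed

text \<open>Both sides are product measures: on a box they factor into one-dimensional integrals, which
  agree by the transport property of each chart.\<close>

lemma chart_product_distr:
  fixes p q \<tau> :: "'n::finite \<Rightarrow> real \<Rightarrow> real" and A :: "'n \<Rightarrow> real set"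
  assumes p[measurable]: "\<And>k. p k \<in> borel_measurable borel" and p0: "\<And>k x. p k x \<ge> 0" and pfin: "\<And>k. integrable lborel (p k)"
    and q[measurable]: "\<And>k. q k \<in> borel_measurable borel" and q0: "\<And>k x. q k x \<ge> 0"
    and \<tau>[measurable]: "\<And>k. \<tau> k \<in> borel_measurable borel" and A[measurable]: "\<And>k. A k \<in> sets borel"
    and transport: "\<And>k B. B \<in> sets borel \<Longrightarrow> (\<integral>\<^sup>+s. ennreal (q k s * indicator B (\<tau> k s)) \<partial>lborel) = (\<integral>\<^sup>+x. ennreal (p k x * indicator (A k \<inter> B) x) \<partial>lborel)"
  defines "P \<equiv> PiM UNIV (\<lambda>k. density lborel (\<lambda>x. ennreal (p k x)))"
  shows "distr (density lborel_fun (\<lambda>s. ennreal (\<Prod>k\<in>UNIV. q k (s k)))) P (\<lambda>s k. \<tau> k (s k)) = density P (indicator (Pi\<^sub>E UNIV A))" (is "?L = ?R")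
proof -
  have fin: "emeasure (density lborel (\<lambda>x. ennreal (p k x * indicator (B k) x))) UNIV < \<infinity>" if [measurable]: "B k \<in> sets borel" for k B
  proof -
    have "emeasure (density lborel (\<lambda>x. ennreal (p k x * indicator (B k) x))) UNIV = (\<integral>\<^sup>+x. ennreal (p k x * indicator (B k) x) \<partial>lborel)"
      by (simp add: emeasure_density)
    also have "\<dots> \<le> (\<integral>\<^sup>+x. ennreal (norm (p k x)) \<partial>lborel)"
      using p0 by (intro nn_integral_mono) (auto split: split_indicator)
    also have "\<dots> < \<infinity>" using pfin[of k] by (simp add: integrable_iff_bounded)
    finally show ?thesis .
  qed
  have sf: "sigma_finite_measure (density lborel (\<lambda>x. ennreal (p k x * indicator (B k) x)))" if "B k \<in> sets borel" for k B
    using fin[of B k] that by (intro finite_measure.sigma_finite_measure finite_measureI) auto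
  let ?Q = "\<lambda>k. density lborel (\<lambda>x. ennreal (p k x * indicator (A k) x))"
  interpret Q: product_sigma_finite ?Q by (intro product_sigma_finite.intro sf) simp
  interpret P: product_sigma_finite "\<lambda>k. density lborel (\<lambda>x. ennreal (p k x))"
    using sf[of "\<lambda>_. UNIV"] by (intro product_sigma_finite.intro) simp
  interpret N: product_sigma_finite "\<lambda>_::'n. lborel :: real measure" ..
  have setsP: "sets P = sets (PiM UNIV ?Q)" unfolding P_def by (intro sets_PiM_cong) auto
  have setsN: "sets P = sets lborel_fun" unfolding P_def by (intro sets_PiM_cong) auto
  have [measurable]: "(\<lambda>s k. \<tau> k (s k)) \<in> lborel_fun \<rightarrow>\<^sub>M P"
    unfolding measurable_cong_sets[OF refl setsN] by (rule measurable_PiM_single') (auto simp: space_PiM)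
  have [measurable]: "(\<lambda>s. ennreal (\<Prod>k\<in>UNIV. q k (s k))) \<in> borel_measurable lborel_fun" by measurable
  have "?L = PiM UNIV ?Q"
  proof (rule Q.PiM_eqI)
    fix B :: "'n \<Rightarrow> real set" assume "\<And>i. i \<in> UNIV \<Longrightarrow> B i \<in> sets (?Q i)"
    then have B[measurable]: "B i \<in> sets borel" for i by simp
    have [measurable]: "Pi\<^sub>E UNIV B \<in> sets P" unfolding setsN by (rule sets_PiM_I_finite) auto
    have [measurable]: "(\<lambda>s k. \<tau> k (s k)) -` Pi\<^sub>E UNIV B \<in> sets lborel_fun"
      using measurable_sets[of "\<lambda>s k. \<tau> k (s k)" lborel_fun P "Pi\<^sub>E UNIV B"] by (simp add: space_PiM)
    have "emeasure ?L (Pi\<^sub>E UNIV B) = (\<integral>\<^sup>+s. ennreal (\<Prod>k\<in>UNIV. q k (s k)) * indicator (Pi\<^sub>E UNIV B) (\<lambda>k. \<tau> k (s k)) \<partial>lborel_fun)"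
      by (subst emeasure_distr, simp, simp, subst emeasure_density) (auto intro!: nn_integral_cong simp: indicator_def space_PiM)
    also have "\<dots> = (\<integral>\<^sup>+s. (\<Prod>k\<in>UNIV. ennreal (q k (s k) * indicator (B k) (\<tau> k (s k)))) \<partial>lborel_fun)"
    proof (intro nn_integral_cong)
      fix s
      show "ennreal (\<Prod>k\<in>UNIV. q k (s k)) * indicator (Pi\<^sub>E UNIV B) (\<lambda>k. \<tau> k (s k)) = (\<Prod>k\<in>UNIV. ennreal (q k (s k) * indicator (B k) (\<tau> k (s k))))"
      proof (cases "\<forall>k. \<tau> k (s k) \<in> B k")
        case True
        then show ?thesis by (simp add: q0 prod_ennreal PiE_iff)
      next
        case False
        then obtain j where j: "\<tau> j (s j) \<notin> B j" by blast
        then have "(\<Prod>k\<in>UNIV. ennreal (q k (s k) * indicator (B k) (\<tau> k (s k)))) = 0"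
          by (intro prod_zero) (auto intro!: exI[of _ j])
        with j show ?thesis by (auto simp: indicator_def PiE_iff)
      qed
    qed
    also have "\<dots> = (\<Prod>k\<in>UNIV. \<integral>\<^sup>+s. ennreal (q k s * indicator (B k) (\<tau> k s)) \<partial>lborel)"
      by (rule N.product_nn_integral_prod) auto
    also have "\<dots> = (\<Prod>k\<in>UNIV. emeasure (?Q k) (B k))"
      by (intro prod.cong refl, subst transport) (auto simp: emeasure_density intro!: nn_integral_cong split: split_indicator)
    finally show "emeasure ?L (Pi\<^sub>E UNIV B) = (\<Prod>k\<in>UNIV. emeasure (?Q k) (B k))" .
  qed (simp_all add: setsP)
  also have "\<dots> = ?R"
  proof (rule Q.PiM_eqI[symmetric])
    fix B :: "'n \<Rightarrow> real set" assume "\<And>i. i \<in> UNIV \<Longrightarrow> B i \<in> sets (?Q i)"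
    then have B[measurable]: "B i \<in> sets borel" for i by simp
    have [measurable]: "Pi\<^sub>E UNIV B \<in> sets P" "Pi\<^sub>E UNIV A \<in> sets P" unfolding setsN by (rule sets_PiM_I_finite; simp)+
    have [measurable]: "Pi\<^sub>E UNIV (\<lambda>k. A k \<inter> B k) \<in> sets P" unfolding setsN by (rule sets_PiM_I_finite) auto
    have "emeasure ?R (Pi\<^sub>E UNIV B) = (\<integral>\<^sup>+x. indicator (Pi\<^sub>E UNIV A) x * indicator (Pi\<^sub>E UNIV B) x \<partial>P)"
      by (rule emeasure_density) simp_all
    also have "\<dots> = (\<integral>\<^sup>+x. indicator (Pi\<^sub>E UNIV (\<lambda>k. A k \<inter> B k)) x \<partial>P)"
      by (intro nn_integral_cong) (auto simp: indicator_def PiE_iff)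
    also have "\<dots> = emeasure P (Pi\<^sub>E UNIV (\<lambda>k. A k \<inter> B k))" by (rule nn_integral_indicator) simp
    also have "\<dots> = (\<Prod>k\<in>UNIV. emeasure (density lborel (\<lambda>x. ennreal (p k x))) (A k \<inter> B k))"
      unfolding P_def by (rule P.emeasure_PiM) auto
    also have "\<dots> = (\<Prod>k\<in>UNIV. emeasure (?Q k) (B k))"
      by (intro prod.cong refl) (auto simp: emeasure_density intro!: nn_integral_cong split: split_indicator)
    finally show "emeasure ?R (Pi\<^sub>E UNIV B) = (\<Prod>k\<in>UNIV. emeasure (?Q k) (B k))" .
  qed (simp_all add: setsP)
  finally show ?thesis .
qed

section \<open>Partial derivatives and curves\<close>

lemma sum_axis_expansion: "(x :: real ^ 'n) = (\<Sum>k\<in>UNIV. x $ k *\<^sub>R axis k 1)"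
  using basis_expansion[of x] by (simp add: scalar_mult_eq_scaleR)

lemma measurable_vec_lambda_PiM:
  assumes "\<And>k. (\<lambda>x. f x k) \<in> borel_measurable M"
  shows "(\<lambda>x. (\<chi> k. f x k) :: real ^ 'n) \<in> borel_measurable M"
proof -
  have "(\<lambda>x. \<Sum>k\<in>UNIV. f x k *\<^sub>R (axis k 1 :: real ^ 'n)) \<in> borel_measurable M"
    using assms by measurable
  then show ?thesis by (subst sum_axis_expansion) simp
qed

lemma has_derivative_partial_deriv:
  fixes u :: "real ^ 'n \<Rightarrow> real"
  assumes "(u has_derivative u') (at x)"
  shows "u' d = (\<Sum>k\<in>UNIV. partial_deriv k u x * d $ k)"
    and "((\<lambda>t. u (x + t *\<^sub>R axis k 1)) has_real_derivative partial_deriv k u x) (at 0)"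
proof -
  interpret u': bounded_linear u' using assms by (rule has_derivative_bounded_linear)
  have D: "((\<lambda>t. u (x + t *\<^sub>R axis k 1)) has_real_derivative u' (axis k 1)) (at 0)" for k
  proof -
    have "((\<lambda>t. x + t *\<^sub>R axis k 1 :: real ^ 'n) has_derivative (\<lambda>t. t *\<^sub>R axis k 1)) (at 0)"
      by (auto intro!: derivative_eq_intros)
    from has_derivative_compose[OF this, of u u'] assms
    have "((\<lambda>t. u (x + t *\<^sub>R axis k 1)) has_derivative (\<lambda>t. u' (t *\<^sub>R axis k 1))) (at 0)" by simp
    then show ?thesis by (simp add: has_field_derivative_def u'.scaleR mult_commute_abs)
  qed
  then have eq: "partial_deriv k u x = u' (axis k 1)" for k
    unfolding partial_deriv_def by (rule DERIV_imp_deriv)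
  show "((\<lambda>t. u (x + t *\<^sub>R axis k 1)) has_real_derivative partial_deriv k u x) (at 0)" using D eq by simp
  show "u' d = (\<Sum>k\<in>UNIV. partial_deriv k u x * d $ k)"
    by (subst sum_axis_expansion) (simp add: u'.sum u'.scaleR eq mult.commute)
qed

lemma chain_rule_along_curve:
  fixes u :: "real ^ 'n \<Rightarrow> real" and c :: "real \<Rightarrow> 'n \<Rightarrow> real"
  assumes u: "u differentiable (at (\<chi> k. c 0 k))"
    and c: "\<And>k. ((\<lambda>t. c t k) has_real_derivative d k) (at 0)"
  shows "((\<lambda>t. u (\<chi> k. c t k)) has_real_derivative (\<Sum>k\<in>UNIV. partial_deriv k u (\<chi> k. c 0 k) * d k)) (at 0)"
proof -
  obtain u' where u': "(u has_derivative u') (at (\<chi> k. c 0 k))" using u by (auto simp: differentiable_def)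
  interpret u': bounded_linear u' using u' by (rule has_derivative_bounded_linear)
  have "((\<lambda>t. \<Sum>k\<in>UNIV. c t k *\<^sub>R (axis k 1 :: real ^ 'n)) has_derivative (\<lambda>h. \<Sum>k\<in>UNIV. (d k * h) *\<^sub>R axis k 1)) (at 0)"
    using c by (intro has_derivative_sum has_derivative_scaleR_left) (simp add: has_field_derivative_def)
  moreover have "(\<Sum>k\<in>UNIV. c t k *\<^sub>R (axis k 1 :: real ^ 'n)) = (\<chi> k. c t k)" for t
    by (subst sum_axis_expansion[of "\<chi> k. c t k"]) simp
  moreover have "(\<Sum>k\<in>UNIV. (d k * h) *\<^sub>R (axis k 1 :: real ^ 'n)) = h *\<^sub>R (\<chi> k. d k)" for h
    by (subst sum_axis_expansion[of "h *\<^sub>R (\<chi> k. d k)"]) (simp add: mult.commute)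
  ultimately have "((\<lambda>t. (\<chi> k. c t k) :: real ^ 'n) has_derivative (\<lambda>h. h *\<^sub>R (\<chi> k. d k))) (at 0)" by simp
  from has_derivative_compose[OF this u']
  have "((\<lambda>t. u (\<chi> k. c t k)) has_derivative (\<lambda>h. u' (h *\<^sub>R (\<chi> k. d k)))) (at 0)" .
  then show ?thesis
    by (simp add: has_field_derivative_def u'.scaleR has_derivative_partial_deriv(1)[OF u', of "\<chi> k. d k"] mult_commute_abs)
qed

text \<open>A partial derivative is a pointwise limit of difference quotients; extending \<open>u\<close> by \<open>0\<close> makes these
  measurable without changing the limit inside the open set.\<close>

lemma borel_measurable_partial_deriv:
  fixes u :: "real ^ 'n \<Rightarrow> real"
  assumes D: "open D" and u: "\<And>x. x \<in> D \<Longrightarrow> u differentiable (at x)"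
  shows "(\<lambda>x. if x \<in> D then u x else 0) \<in> borel_measurable borel"
    and "(\<lambda>x. if x \<in> D then partial_deriv k u x else 0) \<in> borel_measurable borel"
proof -
  define U where "U x = (if x \<in> D then u x else 0)" for x
  have [measurable]: "D \<in> sets borel" using D by simp
  have "continuous_on D u"
    using u differentiable_imp_continuous_within by (intro continuous_at_imp_continuous_on) blast
  then have "(\<lambda>x. indicator D x *\<^sub>R u x) \<in> borel_measurable borel"
    by (intro borel_measurable_continuous_on_indicator) auto
  moreover have "(\<lambda>x. indicator D x *\<^sub>R u x) = U" by (auto simp: U_def indicator_def)
  ultimately have [measurable]: "U \<in> borel_measurable borel" by simp
  then show "(\<lambda>x. if x \<in> D then u x else 0) \<in> borel_measurable borel" by (simp add: U_def[abs_def])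
  define h where "h m = inverse (real (Suc m))" for m
  show "(\<lambda>x. if x \<in> D then partial_deriv k u x else 0) \<in> borel_measurable borel"
  proof (rule borel_measurable_LIMSEQ_real)
    show "(\<lambda>x. if x \<in> D then (U (x + h m *\<^sub>R axis k 1) - U x) / h m else 0) \<in> borel_measurable borel" for m
      by measurable
    fix x
    show "(\<lambda>m. if x \<in> D then (U (x + h m *\<^sub>R axis k 1) - U x) / h m else 0) \<longlonglongrightarrow> (if x \<in> D then partial_deriv k u x else 0)"
    proof (cases "x \<in> D")
      case True
      obtain u' where u': "(u has_derivative u') (at x)" using u[OF True] by (auto simp: differentiable_def)
      have h0: "h \<longlonglongrightarrow> 0" unfolding h_def[abs_def] by (rule LIMSEQ_inverse_real_of_nat)
      have "(\<lambda>t. (u (x + t *\<^sub>R axis k 1) - u x) / t) \<midarrow>0\<rightarrow> partial_deriv k u x"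
        using has_derivative_partial_deriv(2)[OF u', of k] by (simp add: DERIV_def)
      moreover have "filterlim h (at 0) sequentially"
        using h0 by (intro filterlim_atI) (auto simp: h_def)
      ultimately have lim: "(\<lambda>m. (u (x + h m *\<^sub>R axis k 1) - u x) / h m) \<longlonglongrightarrow> partial_deriv k u x"
        by (rule filterlim_compose)
      have "(\<lambda>m. x + h m *\<^sub>R axis k 1) \<longlonglongrightarrow> x + 0 *\<^sub>R axis k 1" by (intro tendsto_intros h0)
      then have "eventually (\<lambda>m. x + h m *\<^sub>R axis k 1 \<in> D) sequentially"
        using D True by (intro topological_tendstoD) auto
      then have "eventually (\<lambda>m. (u (x + h m *\<^sub>R axis k 1) - u x) / h m = (U (x + h m *\<^sub>R axis k 1) - U x) / h m) sequentially"
        by eventually_elim (use True in \<open>simp add: U_def\<close>)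
      from Lim_transform_eventually[OF lim this] True show ?thesis by simp
    qed simp
  qed
qed

lemma cutoff_bounds: assumes "\<delta> > 0" shows "0 \<le> cutoff \<delta> z" "cutoff \<delta> z \<le> 1"
  using soft_pos_nonneg[OF assms, of "\<bar>z\<bar>"] soft_pos_le[OF assms, of "\<bar>z\<bar>"]
  by (auto simp: cutoff_def divide_le_eq)

lemma cutoff_tendsto: "(\<lambda>n. cutoff (1 / real (Suc n)) z) \<longlonglongrightarrow> 1"
proof (cases "z = 0")
  case False
  then have "(\<lambda>n. soft_pos (1 / real (Suc n)) \<bar>z\<bar> / \<bar>z\<bar>) \<longlonglongrightarrow> max 0 \<bar>z\<bar> / \<bar>z\<bar>"
    by (intro tendsto_divide soft_pos_tendsto tendsto_const) auto
  then show ?thesis using False by (simp add: cutoff_def)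
qed (simp add: cutoff_def)

lemma borel_measurable_soft_step[measurable]: "soft_step \<delta> \<in> borel_measurable borel"
  unfolding soft_step_def[abs_def] by measurable

lemma borel_measurable_cutoff[measurable]: "cutoff \<delta> \<in> borel_measurable borel"
  unfolding cutoff_def[abs_def] soft_pos_def by measurable

section \<open>Integration by parts against the product law\<close>

locale product_law =
  fixes p g :: "'n::finite \<Rightarrow> real \<Rightarrow> real" and I :: "'n \<Rightarrow> real set"
  assumes coord: "\<And>k. coordinate (p k) (g k) (I k)" and p_one: "\<And>k. (LBINT x. p k x) = 1"
begin

definition P :: "('n \<Rightarrow> real) measure" where
  "P = PiM UNIV (\<lambda>k. density lborel (\<lambda>x. ennreal (p k x)))"

definition Dom :: "(real ^ 'n) set" where "Dom = {x. \<forall>k. x $ k \<in> I k}"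

abbreviation Gk :: "'n \<Rightarrow> real \<Rightarrow> real" where "Gk k \<equiv> coordinate.G (p k) (g k)"

definition flow_deriv :: "(real ^ 'n \<Rightarrow> real) \<Rightarrow> real ^ 'n \<Rightarrow> real" where
  "flow_deriv u x = (\<Sum>k\<in>UNIV. partial_deriv k u x * Lop (p k) (g k) (x $ k))"

text \<open>Functions on the range of the random vector are extended by \<open>0\<close>: their values elsewhere are
  arbitrary and need not be measurable.\<close>

definition on_Dom :: "(real ^ 'n \<Rightarrow> real) \<Rightarrow> ('n \<Rightarrow> real) \<Rightarrow> real" where
  "on_Dom h x = (if (\<chi> k. x k) \<in> Dom then h (\<chi> k. x k) else 0)"

lemmas p_meas[measurable] = coordinate.p_meas[OF coord]
lemmas p_nonneg = coordinate.p_nonneg[OF coord]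
lemmas p_int = coordinate.p_int[OF coord]
lemmas I_meas[measurable] = coordinate.I_meas[OF coord]
lemmas G_meas[measurable] = coordinate.G_meas[OF coord]

lemma prob_coordinate: "prob_space (density lborel (\<lambda>x. ennreal (p k x)))"
proof
  have "(\<integral>\<^sup>+x. ennreal (p k x) \<partial>lborel) = ennreal (LBINT x. p k x)"
    by (rule nn_integral_eq_integral) (use p_int p_nonneg in auto)
  then show "emeasure (density lborel (\<lambda>x. ennreal (p k x))) (space (density lborel (\<lambda>x. ennreal (p k x)))) = 1"
    by (simp add: emeasure_density p_one)
qed

lemma prob_P: "prob_space P"
  unfolding P_def by (rule prob_space_PiM) (rule prob_coordinate)

lemma sets_P[measurable_cong]: "sets P = sets lborel_fun"
  unfolding P_def by (intro sets_PiM_cong) auto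

lemma sets_P': "sets P = sets (PiM UNIV (\<lambda>_. borel))"
  unfolding P_def by (intro sets_PiM_cong) auto

lemma space_P[simp]: "space P = UNIV"
  by (simp add: P_def space_PiM)

lemma component_meas[measurable]: "(\<lambda>x. x k) \<in> borel_measurable P"
  unfolding measurable_cong_sets[OF sets_P' refl] by (rule measurable_component_singleton) simp

lemma AE_coordinate: assumes "AE x in lborel. p k x > 0 \<longrightarrow> Q x" shows "AE x in P. Q (x k)"
proof -
  have "AE x in density lborel (\<lambda>x. ennreal (p k x)). Q x"
    using assms by (subst AE_density) auto
  then show ?thesis unfolding P_def by (intro AE_PiM_component prob_coordinate) auto
qed

lemma open_Dom: "open Dom"
proof -
  have "Dom = (\<Inter>k\<in>UNIV. (\<lambda>x. x $ k) -` I k)" by (auto simp: Dom_def)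
  moreover have "open ((\<lambda>x :: real ^ 'n. x $ k) -` I k)" for k
    by (intro open_vimage_vec_nth coordinate.open_I[OF coord])
  ultimately show ?thesis by (simp add: open_INT)
qed

lemma AE_I: "AE x in P. \<forall>k. x k \<in> I k"
proof -
  have "AE x in P. x k \<in> I k" for k
  proof (rule AE_coordinate, intro AE_I2 impI)
    fix x assume "p k x > 0"
    then show "x \<in> I k" using coordinate.p_zero[OF coord, of x k] by (cases "x \<in> I k") auto
  qed
  then show ?thesis by (simp add: AE_all_countable)
qed

lemma vec_meas[measurable]: "(\<lambda>x. \<chi> k. x k) \<in> P \<rightarrow>\<^sub>M borel"
  by (rule measurable_vec_lambda_PiM) measurable

lemma on_Dom_meas:
  assumes "(\<lambda>x. if x \<in> Dom then h x else 0) \<in> borel_measurable borel"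
  shows "on_Dom h \<in> borel_measurable P"
  using measurable_compose[OF vec_meas assms] by (simp add: on_Dom_def[abs_def])

lemma integrable_coordinate_iff:
  assumes [measurable]: "h \<in> borel_measurable borel"
  shows "integrable P (\<lambda>x. h (x k)) \<longleftrightarrow> integrable lborel (\<lambda>x. p k x * h x)"
proof -
  have d: "distr P (density lborel (\<lambda>x. ennreal (p k x))) (\<lambda>x. x k) = density lborel (\<lambda>x. ennreal (p k x))"
    unfolding P_def by (rule distr_PiM_component) (auto intro: prob_coordinate)
  have "integrable P (\<lambda>x. h (x k)) \<longleftrightarrow> integrable (density lborel (\<lambda>x. ennreal (p k x))) h"
  proof -
    have "integrable (distr P (density lborel (\<lambda>x. ennreal (p k x))) (\<lambda>x. x k)) h \<longleftrightarrow> integrable P (\<lambda>x. h (x k))"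
      by (rule integrable_distr_eq) auto
    then show ?thesis unfolding d by simp
  qed
  also have "\<dots> \<longleftrightarrow> integrable lborel (\<lambda>x. p k x * h x)"
    by (subst integrable_real_density) (auto simp: p_nonneg)
  finally show ?thesis .
qed

lemma gI_meas[measurable]: "(\<lambda>x. if x \<in> I k then g k x else 0) \<in> borel_measurable borel"
proof -
  have "(\<lambda>x. indicator (I k) x *\<^sub>R g k x) \<in> borel_measurable borel"
    by (rule borel_measurable_continuous_on_indicator[OF _ coordinate.g_cont[OF coord]]) simp
  then show ?thesis by (rule measurable_cong[THEN iffD1, rotated]) (auto simp: indicator_def)
qed

lemma gI_integrable: "integrable P (\<lambda>x. if x k \<in> I k then g k (x k) else 0)"
proof -
  have "(\<lambda>x. p k x * (if x \<in> I k then g k x else 0)) = (\<lambda>x. g k x * p k x)"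
  proof
    fix x show "p k x * (if x \<in> I k then g k x else 0) = g k x * p k x"
      using coordinate.p_zero[OF coord, of x k] by (cases "x \<in> I k") auto
  qed
  then have "integrable lborel (\<lambda>x. p k x * (if x \<in> I k then g k x else 0))"
    using coordinate.gp_int[OF coord, of k] by simp
  then show ?thesis using integrable_coordinate_iff[OF gI_meas] by simp
qed

definition cut :: "real \<Rightarrow> 'n set \<Rightarrow> ('n \<Rightarrow> real) \<Rightarrow> real" where
  "cut \<delta> K x = (\<Prod>k\<in>K. cutoff \<delta> (Gk k (x k)))"

text \<open>The divergence with respect to \<open>P\<close> of the field \<open>\<L>g\<close> multiplied by \<open>u\<close> and the product of the
  cutoffs.\<close>

definition cut_div :: "real \<Rightarrow> (real ^ 'n \<Rightarrow> real) \<Rightarrow> ('n \<Rightarrow> real) \<Rightarrow> real" where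
  "cut_div \<delta> u x = on_Dom (flow_deriv u) x * cut \<delta> UNIV x -
     on_Dom u x * (\<Sum>k\<in>UNIV. soft_step \<delta> \<bar>Gk k (x k)\<bar> * (if x k \<in> I k then g k (x k) else 0) * cut \<delta> (UNIV - {k}) x)"

lemma cut_meas[measurable]: "cut \<delta> K \<in> borel_measurable P"
  unfolding cut_def[abs_def] by measurable

lemma cut_bounds: "\<delta> > 0 \<Longrightarrow> 0 \<le> cut \<delta> K x" "\<delta> > 0 \<Longrightarrow> cut \<delta> K x \<le> 1"
  unfolding cut_def by (auto intro!: prod_nonneg prod_le_1 simp: cutoff_bounds)

lemma flow_deriv_meas:
  assumes u: "\<And>x. x \<in> Dom \<Longrightarrow> u differentiable (at x)"
  shows "on_Dom u \<in> borel_measurable P" "on_Dom (flow_deriv u) \<in> borel_measurable P"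
proof -
  show "on_Dom u \<in> borel_measurable P"
    by (rule on_Dom_meas borel_measurable_partial_deriv(1) open_Dom u)+
  have [measurable]: "on_Dom (partial_deriv k u) \<in> borel_measurable P" for k
    by (rule on_Dom_meas borel_measurable_partial_deriv(2) open_Dom u)+
  have [measurable]: "Lop (p k) (g k) \<in> borel_measurable borel" for k
    unfolding coordinate.Lop_eq[OF coord, abs_def] by measurable
  have "(\<lambda>x. \<Sum>k\<in>UNIV. on_Dom (partial_deriv k u) x * Lop (p k) (g k) (x k)) \<in> borel_measurable P"
    by measurable
  moreover have "(\<lambda>x. \<Sum>k\<in>UNIV. on_Dom (partial_deriv k u) x * Lop (p k) (g k) (x k)) = on_Dom (flow_deriv u)"
    by (auto simp: on_Dom_def flow_deriv_def)
  ultimately show "on_Dom (flow_deriv u) \<in> borel_measurable P" by simp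
qed

lemma cut_div_integrable:
  assumes u: "\<And>x. x \<in> Dom \<Longrightarrow> u differentiable (at x)" and C: "\<And>x. x \<in> Dom \<Longrightarrow> \<bar>u x\<bar> \<le> C"
    and int: "integrable P (on_Dom (flow_deriv u))" and \<delta>: "\<delta> > 0"
  shows "integrable P (cut_div \<delta> u)"
    and "\<bar>cut_div \<delta> u x\<bar> \<le> \<bar>on_Dom (flow_deriv u) x\<bar> + \<bar>C\<bar> * (\<Sum>k\<in>UNIV. \<bar>if x k \<in> I k then g k (x k) else 0\<bar>)"
proof -
  note [measurable] = flow_deriv_meas[OF u]
  show bd: "\<bar>cut_div \<delta> u x\<bar> \<le> \<bar>on_Dom (flow_deriv u) x\<bar> + \<bar>C\<bar> * (\<Sum>k\<in>UNIV. \<bar>if x k \<in> I k then g k (x k) else 0\<bar>)" for x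
  proof -
    have 1: "\<bar>on_Dom (flow_deriv u) x * cut \<delta> UNIV x\<bar> \<le> \<bar>on_Dom (flow_deriv u) x\<bar>"
      using cut_bounds[OF \<delta>, of UNIV x] by (simp add: abs_mult mult_left_le)
    have u1: "\<bar>on_Dom u x\<bar> \<le> \<bar>C\<bar>" using C[of "\<chi> k. x k"] by (auto simp: on_Dom_def)
    have 2: "\<bar>\<Sum>k\<in>UNIV. soft_step \<delta> \<bar>Gk k (x k)\<bar> * (if x k \<in> I k then g k (x k) else 0) * cut \<delta> (UNIV - {k}) x\<bar>
        \<le> (\<Sum>k\<in>UNIV. \<bar>if x k \<in> I k then g k (x k) else 0\<bar>)"
    proof (rule order_trans[OF sum_abs], rule sum_mono)
      fix k
      let ?g = "if x k \<in> I k then g k (x k) else 0" and ?s = "soft_step \<delta> \<bar>Gk k (x k)\<bar>" and ?c = "cut \<delta> (UNIV - {k}) x"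
      have "?s * ?c \<le> 1" "0 \<le> ?s * ?c"
        using soft_step_bounds[OF \<delta>, of "\<bar>Gk k (x k)\<bar>"] cut_bounds[OF \<delta>, of "UNIV - {k}" x] by (auto intro: mult_le_one)
      then have "\<bar>?g\<bar> * (?s * ?c) \<le> \<bar>?g\<bar> * 1" "\<bar>?s * ?c\<bar> = ?s * ?c" by (intro mult_left_mono, auto)
      moreover have "\<bar>?s * ?g * ?c\<bar> = \<bar>?g\<bar> * \<bar>?s * ?c\<bar>" by (simp only: abs_mult mult_ac)
      ultimately show "\<bar>?s * ?g * ?c\<bar> \<le> \<bar>?g\<bar>" by simp
    qed
    have "\<bar>on_Dom u x * (\<Sum>k\<in>UNIV. soft_step \<delta> \<bar>Gk k (x k)\<bar> * (if x k \<in> I k then g k (x k) else 0) * cut \<delta> (UNIV - {k}) x)\<bar>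
       \<le> \<bar>C\<bar> * (\<Sum>k\<in>UNIV. \<bar>if x k \<in> I k then g k (x k) else 0\<bar>)"
      unfolding abs_mult using u1 2 by (intro mult_mono) auto
    with 1 show ?thesis unfolding cut_div_def by linarith
  qed
  show "integrable P (cut_div \<delta> u)"
  proof (rule Bochner_Integration.integrable_bound)
    show "integrable P (\<lambda>x. \<bar>on_Dom (flow_deriv u) x\<bar> + \<bar>C\<bar> * (\<Sum>k\<in>UNIV. \<bar>if x k \<in> I k then g k (x k) else 0\<bar>))"
      using int gI_integrable by auto
    show "cut_div \<delta> u \<in> borel_measurable P"
      unfolding cut_div_def[abs_def] by measurable
    show "AE x in P. norm (cut_div \<delta> u x) \<le> norm (\<bar>on_Dom (flow_deriv u) x\<bar> + \<bar>C\<bar> * (\<Sum>k\<in>UNIV. \<bar>if x k \<in> I k then g k (x k) else 0\<bar>))"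
      using bd by (auto intro!: AE_I2 order_trans[OF bd])
  qed
qed

text \<open>In a product of charts the divergence times the density of the chart is the derivative, in the
  constant direction \<open>e\<close>, of \<open>u\<close> times the cut-off densities. This function is differentiable at every point of the
  space: inside the charts by the chain rule, elsewhere because it vanishes along the line nearby.\<close>

lemma integral_cut_div_region:
  assumes u: "\<And>x. x \<in> Dom \<Longrightarrow> u differentiable (at x)" and C: "\<And>x. x \<in> Dom \<Longrightarrow> \<bar>u x\<bar> \<le> C"
    and int: "integrable P (on_Dom (flow_deriv u))" and \<delta>: "\<delta> > 0"
    and chart: "\<And>k. coordinate.flow_chart (p k) (g k) (A k) (e k) (\<tau> k) (q k)"
    and A: "\<And>k. A k \<in> sets borel" "\<And>k. A k \<subseteq> I k"
  shows "(\<integral>x. indicator (Pi\<^sub>E UNIV A) x * cut_div \<delta> u x \<partial>P) = 0"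
proof -
  note ch = chart[unfolded coordinate.flow_chart_def[OF coord]]
  have chart_meas[measurable]: "\<And>k. \<tau> k \<in> borel_measurable borel" "\<And>k. q k \<in> borel_measurable borel" "\<And>k. A k \<in> sets borel"
    using ch A by blast+
  have q0: "\<And>k s. 0 \<le> q k s" using ch by blast
  have transport: "\<And>k B. B \<in> sets borel \<Longrightarrow> (\<integral>\<^sup>+s. ennreal (q k s * indicator B (\<tau> k s)) \<partial>lborel) = (\<integral>\<^sup>+x. ennreal (p k x * indicator (A k \<inter> B) x) \<partial>lborel)"
    using ch by blast
  have move: "\<tau> k s \<in> A k" "((\<lambda>t. \<tau> k (s + t * e k)) has_real_derivative Lop (p k) (g k) (\<tau> k s)) (at 0)" if "q k s \<noteq> 0" for k s
    using ch[of k] that by blast+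
  have dcut: "((\<lambda>t. cutoff \<delta> (Gk k (\<tau> k (s + t * e k))) * q k (s + t * e k)) has_real_derivative
         - (soft_step \<delta> \<bar>Gk k (\<tau> k s)\<bar> * g k (\<tau> k s) * q k s)) (at 0)" for k s
    using ch[of k] \<delta> by blast
  have vanish: "eventually (\<lambda>t. cutoff \<delta> (Gk k (\<tau> k (s + t * e k))) * q k (s + t * e k) = 0) (nhds 0)" if "q k s = 0" for k s
    using ch[of k] \<delta> that by blast
  define Q where "Q s = (\<Prod>k\<in>UNIV. q k (s k))" for s
  define T where "T s = (\<lambda>k. \<tau> k (s k))" for s
  note [measurable] = flow_deriv_meas[OF u]
  have [measurable]: "Pi\<^sub>E UNIV A \<in> sets P" unfolding sets_P by (rule sets_PiM_I_finite) auto
  have [measurable]: "T \<in> lborel_fun \<rightarrow>\<^sub>M P"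
    unfolding measurable_cong_sets[OF refl sets_P] T_def[abs_def] by (rule measurable_PiM_single') (auto simp: space_PiM)
  have [measurable]: "Q \<in> borel_measurable lborel_fun" unfolding Q_def[abs_def] by measurable
  have Q0: "0 \<le> Q s" for s unfolding Q_def by (intro prod_nonneg) (auto simp: q0)
  have law: "distr (density lborel_fun (\<lambda>s. ennreal (Q s))) P T = density P (indicator (Pi\<^sub>E UNIV A))"
    unfolding Q_def[abs_def] T_def[abs_def] P_def
    by (rule chart_product_distr[OF p_meas p_nonneg p_int chart_meas(2) q0 chart_meas(1) chart_meas(3) transport])
  have transfer_int: "integrable lborel_fun (\<lambda>s. Q s * h (T s))" and
    transfer: "(\<integral>s. Q s * h (T s) \<partial>lborel_fun) = (\<integral>x. indicator (Pi\<^sub>E UNIV A) x * h x \<partial>P)"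
    if h: "integrable P h" for h :: "('n \<Rightarrow> real) \<Rightarrow> real"
  proof -
    have [measurable]: "h \<in> borel_measurable P" using h by auto
    have ind: "density P (indicator (Pi\<^sub>E UNIV A)) = density P (\<lambda>x. ennreal (indicator (Pi\<^sub>E UNIV A) x))"
      by (simp add: ennreal_indicator)
    have "integrable P (\<lambda>x. indicator (Pi\<^sub>E UNIV A) x * h x)"
      using integrable_mult_indicator[OF _ h, of "Pi\<^sub>E UNIV A"] by simp
    then have "integrable (density P (indicator (Pi\<^sub>E UNIV A))) h"
      unfolding ind by (subst integrable_real_density) auto
    then have "integrable (density lborel_fun (\<lambda>s. ennreal (Q s))) (\<lambda>s. h (T s))"
      unfolding law[symmetric] by (subst (asm) integrable_distr_eq) auto
    then show "integrable lborel_fun (\<lambda>s. Q s * h (T s))"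
      by (subst (asm) integrable_real_density) (auto simp: Q0)
    have "(\<integral>s. Q s * h (T s) \<partial>lborel_fun) = (\<integral>s. h (T s) \<partial>density lborel_fun (\<lambda>s. ennreal (Q s)))"
      by (subst integral_real_density) (auto simp: Q0)
    also have "\<dots> = (\<integral>x. h x \<partial>density P (indicator (Pi\<^sub>E UNIV A)))"
      unfolding law[symmetric] by (subst integral_distr) auto
    also have "\<dots> = (\<integral>x. indicator (Pi\<^sub>E UNIV A) x * h x \<partial>P)"
      unfolding ind by (subst integral_real_density) auto
    finally show "(\<integral>s. Q s * h (T s) \<partial>lborel_fun) = (\<integral>x. indicator (Pi\<^sub>E UNIV A) x * h x \<partial>P)" .
  qed
  interpret P: prob_space P by (rule prob_P)
  have "integrable P (\<lambda>x. on_Dom u x * cut \<delta> UNIV x)"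
  proof (rule P.integrable_const_bound[where B="\<bar>C\<bar>"])
    show "AE x in P. norm (on_Dom u x * cut \<delta> UNIV x) \<le> \<bar>C\<bar>"
    proof (rule AE_I2)
      fix x
      have "\<bar>on_Dom u x\<bar> \<le> \<bar>C\<bar>" using C[of "\<chi> k. x k"] by (auto simp: on_Dom_def)
      then have "\<bar>on_Dom u x\<bar> * \<bar>cut \<delta> UNIV x\<bar> \<le> \<bar>C\<bar> * 1"
        using cut_bounds[OF \<delta>, of UNIV x] by (intro mult_mono) auto
      then show "norm (on_Dom u x * cut \<delta> UNIV x) \<le> \<bar>C\<bar>" by (simp add: abs_mult)
    qed
  qed measurable
  from transfer_int[OF this] have fint: "integrable lborel_fun (\<lambda>s. Q s * (on_Dom u (T s) * cut \<delta> UNIV (T s)))" .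
  have deriv: "((\<lambda>t. Q (\<lambda>k. s k + t * e k) * (on_Dom u (T (\<lambda>k. s k + t * e k)) * cut \<delta> UNIV (T (\<lambda>k. s k + t * e k))))
      has_real_derivative Q s * cut_div \<delta> u (T s)) (at 0)" for s
  proof -
    define \<beta> where "\<beta> k t = cutoff \<delta> (Gk k (\<tau> k (s k + t * e k))) * q k (s k + t * e k)" for k t
    have f: "Q (\<lambda>k. s k + t * e k) * (on_Dom u (T (\<lambda>k. s k + t * e k)) * cut \<delta> UNIV (T (\<lambda>k. s k + t * e k)))
        = on_Dom u (T (\<lambda>k. s k + t * e k)) * (\<Prod>k\<in>UNIV. \<beta> k t)" for t
      by (simp add: Q_def cut_def T_def \<beta>_def prod.distrib)
    show ?thesis
    proof (cases "\<exists>k. q k (s k) = 0")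
      case True
      then obtain k where k: "q k (s k) = 0" by blast
      have ev: "eventually (\<lambda>t. on_Dom u (T (\<lambda>k. s k + t * e k)) * (\<Prod>k\<in>UNIV. \<beta> k t) = 0) (nhds 0)"
        using vanish[OF k] by eventually_elim (auto simp: \<beta>_def)
      have "Q s = 0" using k by (auto simp: Q_def)
      then show ?thesis unfolding f by (subst DERIV_cong_ev[OF refl ev refl]) simp
    next
      case False
      then have nz: "q k (s k) \<noteq> 0" for k by blast
      have TI: "T s k \<in> I k" for k using move(1)[OF nz, of k] A(2)[of k] by (auto simp: T_def)
      then have TD: "(\<chi> k. T s k) \<in> Dom" by (simp add: Dom_def)
      define c where "c t = (\<lambda>k. \<tau> k (s k + t * e k))" for t
      have c0: "c 0 = T s" by (simp add: c_def T_def)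
      have dc: "((\<lambda>t. c t k) has_real_derivative Lop (p k) (g k) (T s k)) (at 0)" for k
        using move(2)[OF nz, of k] by (simp add: c_def T_def)
      have "((\<lambda>t. u (\<chi> k. c t k)) has_real_derivative (\<Sum>k\<in>UNIV. partial_deriv k u (\<chi> k. c 0 k) * Lop (p k) (g k) (T s k))) (at 0)"
        by (rule chain_rule_along_curve[OF _ dc]) (simp add: c0 u TD)
      then have du: "((\<lambda>t. u (\<chi> k. c t k)) has_real_derivative flow_deriv u (\<chi> k. T s k)) (at 0)"
        by (simp add: flow_deriv_def c0)
      have "((\<lambda>t. (\<chi> k. c t k) :: real ^ 'n) \<longlongrightarrow> (\<chi> k. c 0 k)) (at 0)"
        using DERIV_isCont[OF dc] by (intro tendsto_vec_lambda) (simp add: isCont_def)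
      then have "((\<lambda>t. (\<chi> k. c t k) :: real ^ 'n) \<longlongrightarrow> (\<chi> k. c 0 k)) (nhds 0)"
        using tendsto_at_iff_tendsto_nhds[of "\<lambda>t. (\<chi> k. c t k) :: real ^ 'n" 0] by blast
      then have "eventually (\<lambda>t. (\<chi> k. c t k) \<in> Dom) (nhds 0)"
        using open_Dom TD c0 by (intro topological_tendstoD) auto
      then have "eventually (\<lambda>t. on_Dom u (T (\<lambda>k. s k + t * e k)) = u (\<chi> k. c t k)) (nhds 0)"
        by eventually_elim (simp add: on_Dom_def T_def c_def)
      with du have d1: "((\<lambda>t. on_Dom u (T (\<lambda>k. s k + t * e k))) has_real_derivative flow_deriv u (\<chi> k. T s k)) (at 0)"
        by (subst DERIV_cong_ev[OF refl _ refl])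
      define b where "b k = - (soft_step \<delta> \<bar>Gk k (T s k)\<bar> * g k (T s k) * q k (s k))" for k
      have d2: "((\<lambda>t. \<Prod>k\<in>UNIV. \<beta> k t) has_real_derivative (\<Sum>k\<in>UNIV. b k * (\<Prod>j\<in>UNIV-{k}. \<beta> j 0))) (at 0)"
        unfolding \<beta>_def b_def T_def by (rule has_field_derivative_prod) (rule dcut)
      have prods: "(\<Prod>j\<in>K. \<beta> j 0) = cut \<delta> K (T s) * (\<Prod>k\<in>K. q k (s k))" for K
        by (simp add: \<beta>_def cut_def T_def prod.distrib)
      have rem: "q k (s k) * (\<Prod>j\<in>UNIV-{k}. q j (s j)) = Q s" for k
        unfolding Q_def by (rule prod.remove[symmetric]) auto
      have "(\<Sum>k\<in>UNIV. b k * (\<Prod>j\<in>UNIV-{k}. \<beta> j 0)) =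
          - (Q s * (\<Sum>k\<in>UNIV. soft_step \<delta> \<bar>Gk k (T s k)\<bar> * g k (T s k) * cut \<delta> (UNIV-{k}) (T s)))"
        unfolding sum_distrib_left sum_negf[symmetric] prods b_def
        by (intro sum.cong refl) (simp add: rem mult_ac)
      moreover have "on_Dom u (T s) = u (\<chi> k. T s k)" "on_Dom (flow_deriv u) (T s) = flow_deriv u (\<chi> k. T s k)"
        using TD by (simp_all add: on_Dom_def)
      ultimately have "flow_deriv u (\<chi> k. T s k) * (\<Prod>k\<in>UNIV. \<beta> k 0) + (\<Sum>k\<in>UNIV. b k * (\<Prod>j\<in>UNIV-{k}. \<beta> j 0)) * on_Dom u (T (\<lambda>k. s k + 0 * e k))
          = Q s * cut_div \<delta> u (T s)"
        unfolding cut_div_def prods[of UNIV] Q_def[symmetric] using TI by (simp add: algebra_simps)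
      with DERIV_mult[OF d1 d2] show ?thesis unfolding f by simp
    qed
  qed
  have "(\<integral>s. Q s * cut_div \<delta> u (T s) \<partial>lborel_fun) = 0"
    by (rule integral_directional_derivative_zero[OF fint transfer_int[OF cut_div_integrable(1)[OF u C int \<delta>]] deriv])
  then show ?thesis using transfer[OF cut_div_integrable(1)[OF u C int \<delta>]] by simp
qed

text \<open>Choosing one chart domain for each coordinate gives countably many disjoint boxes, which cover
  the range of the random vector.\<close>

lemma integral_cut_div:
  assumes u: "\<And>x. x \<in> Dom \<Longrightarrow> u differentiable (at x)" and C: "\<And>x. x \<in> Dom \<Longrightarrow> \<bar>u x\<bar> \<le> C"
    and int: "integrable P (on_Dom (flow_deriv u))" and \<delta>: "\<delta> > 0"
  shows "(\<integral>x. cut_div \<delta> u x \<partial>P) = 0"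
proof -
  have "\<forall>k. \<exists>\<A>. countable \<A> \<and> (\<forall>A\<in>\<A>. A \<in> sets borel) \<and> disjoint \<A> \<and> \<Union>\<A> = I k \<and>
      (\<forall>A\<in>\<A>. \<exists>e \<tau> q. coordinate.flow_chart (p k) (g k) A e \<tau> q)"
  proof
    fix k
    show "\<exists>\<A>. countable \<A> \<and> (\<forall>A\<in>\<A>. A \<in> sets borel) \<and> disjoint \<A> \<and> \<Union>\<A> = I k \<and>
      (\<forall>A\<in>\<A>. \<exists>e \<tau> q. coordinate.flow_chart (p k) (g k) A e \<tau> q)"
    proof (rule coordinate.flow_chart_cover[OF coord[of k]])
      fix \<A> assume "countable \<A>" "\<And>A. A \<in> \<A> \<Longrightarrow> A \<in> sets borel" "disjoint \<A>" "\<Union>\<A> = I k"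
        "\<And>A. A \<in> \<A> \<Longrightarrow> \<exists>e \<tau> q. coordinate.flow_chart (p k) (g k) A e \<tau> q"
      then show ?thesis by (intro exI[of _ \<A>] conjI ballI) assumption+
    qed
  qed
  from choice[OF this] obtain \<A> where all: "\<forall>k. countable (\<A> k) \<and> (\<forall>A\<in>\<A> k. A \<in> sets borel) \<and> disjoint (\<A> k) \<and> \<Union>(\<A> k) = I k \<and>
      (\<forall>A\<in>\<A> k. \<exists>e \<tau> q. coordinate.flow_chart (p k) (g k) A e \<tau> q)" by (rule exE)
  have \<A>: "countable (\<A> k)" "disjoint (\<A> k)" "\<Union>(\<A> k) = I k" for k
    using all[THEN spec[of _ k]] by simp_all
  have Asets: "A \<in> sets borel" and Achart: "\<exists>e \<tau> q. coordinate.flow_chart (p k) (g k) A e \<tau> q"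
    if "A \<in> \<A> k" for k A
    using all[THEN spec[of _ k]] that by simp_all
  \<comment> \<open>the boxes are numbered by the codes of the countable set \<open>\<C>\<close>; unused numbers get the empty set\<close>
  define \<C> where "\<C> = Pi\<^sub>E (UNIV :: 'n set) \<A>"
  have c\<C>: "countable \<C>" unfolding \<C>_def using \<A>(1) by (intro countable_PiE) auto
  define R where "R n = (if n \<in> to_nat_on \<C> ` \<C> then Pi\<^sub>E UNIV (from_nat_into \<C> n) else {})" for n
  have idx: "from_nat_into \<C> n \<in> \<C>" "to_nat_on \<C> (from_nat_into \<C> n) = n" if n: "n \<in> to_nat_on \<C> ` \<C>" for n
  proof -
    obtain a where "a \<in> \<C>" "n = to_nat_on \<C> a" using n by (rule imageE)
    then show "from_nat_into \<C> n \<in> \<C>" "to_nat_on \<C> (from_nat_into \<C> n) = n" using c\<C> by simp_all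
  qed
  have R_sets: "R n \<in> sets P" for n
  proof (cases "n \<in> to_nat_on \<C> ` \<C>")
    case True
    then have "from_nat_into \<C> n \<in> \<C>" by (rule idx(1))
    then have "from_nat_into \<C> n k \<in> sets borel" for k using Asets by (auto simp: \<C>_def PiE_iff)
    then show ?thesis using True unfolding R_def sets_P by (simp add: sets_PiM_I_finite)
  qed (simp add: R_def)
  have R_zero: "(\<integral>x. indicator (R n) x * cut_div \<delta> u x \<partial>P) = 0" for n
  proof (cases "n \<in> to_nat_on \<C> ` \<C>")
    case True
    define A where "A = from_nat_into \<C> n"
    have A: "A k \<in> \<A> k" for k using idx(1)[OF True] by (auto simp: \<C>_def A_def PiE_iff)
    have "\<forall>k. \<exists>c. coordinate.flow_chart (p k) (g k) (A k) (fst c) (fst (snd c)) (snd (snd c))"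
    proof
      fix k
      from Achart[OF A[of k]] obtain e \<tau> q where "coordinate.flow_chart (p k) (g k) (A k) e \<tau> q" by blast
      then show "\<exists>c. coordinate.flow_chart (p k) (g k) (A k) (fst c) (fst (snd c)) (snd (snd c))"
        by (intro exI[of _ "(e, \<tau>, q)"]) simp
    qed
    from choice[OF this] obtain c where
      ch: "\<forall>k. coordinate.flow_chart (p k) (g k) (A k) (fst (c k)) (fst (snd (c k))) (snd (snd (c k)))" by (rule exE)
    have "(\<integral>x. indicator (Pi\<^sub>E UNIV A) x * cut_div \<delta> u x \<partial>P) = 0"
    proof (rule integral_cut_div_region[OF u C int \<delta> ch[THEN spec]])
      show "A k \<in> sets borel" for k by (rule Asets[OF A])
      show "A k \<subseteq> I k" for k using A[of k] \<A>(3)[of k] by auto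
    qed
    then show ?thesis using True by (simp add: R_def A_def)
  qed (simp add: R_def)
  have R_disj: "R m \<inter> R n = {}" if "m \<noteq> n" for m n
  proof (rule ccontr)
    assume "R m \<inter> R n \<noteq> {}"
    then obtain x where x: "x \<in> R m" "x \<in> R n" by blast
    have ne: "k \<in> to_nat_on \<C> ` \<C>" if "x \<in> R k" for k
    proof (rule ccontr)
      assume "k \<notin> to_nat_on \<C> ` \<C>"
      then have "R k = {}" unfolding R_def by (rule if_not_P)
      with that show False by simp
    qed
    have mn: "m \<in> to_nat_on \<C> ` \<C>" "n \<in> to_nat_on \<C> ` \<C>" by (rule ne[OF x(1)], rule ne[OF x(2)])
    define a b where "a = from_nat_into \<C> m" and "b = from_nat_into \<C> n"
    have ab: "a k \<in> \<A> k" "b k \<in> \<A> k" for k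
      using idx(1)[OF mn(1)] idx(1)[OF mn(2)] unfolding \<C>_def a_def b_def PiE_iff by blast+
    have "x \<in> Pi\<^sub>E UNIV a" "x \<in> Pi\<^sub>E UNIV b"
      using x unfolding R_def if_P[OF mn(1)] if_P[OF mn(2)] a_def b_def by simp_all
    then have xab: "x k \<in> a k" "x k \<in> b k" for k by (simp_all add: PiE_iff)
    have "a k = b k" for k
    proof (rule ccontr)
      assume "a k \<noteq> b k"
      then have "a k \<inter> b k = {}" using disjointD[OF \<A>(2) ab] by simp
      then show False using xab[of k] by blast
    qed
    then have "a = b" by (rule ext)
    have "m = to_nat_on \<C> a" unfolding a_def by (rule idx(2)[OF mn(1), symmetric])
    also have "\<dots> = to_nat_on \<C> b" unfolding \<open>a = b\<close> by (rule refl)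
    also have "\<dots> = n" unfolding b_def by (rule idx(2)[OF mn(2)])
    finally show False using \<open>m \<noteq> n\<close> by simp
  qed
  have R_Un: "x \<in> (\<Union>n. R n)" if x: "(\<chi> k. x k) \<in> Dom" for x
  proof -
    have "\<forall>k. \<exists>A. A \<in> \<A> k \<and> x k \<in> A"
    proof
      fix k
      have "x k \<in> \<Union>(\<A> k)" using x unfolding \<A>(3) by (simp add: Dom_def)
      then show "\<exists>A. A \<in> \<A> k \<and> x k \<in> A" by blast
    qed
    from choice[OF this] obtain a where a: "\<forall>k. a k \<in> \<A> k \<and> x k \<in> a k" by (rule exE)
    then have a\<C>: "a \<in> \<C>" unfolding \<C>_def by (intro PiE_I) auto
    have "R (to_nat_on \<C> a) = Pi\<^sub>E UNIV a" unfolding R_def using a\<C> c\<C> by simp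
    then have "x \<in> R (to_nat_on \<C> a)" using a by (simp add: PiE_iff)
    then show ?thesis by blast
  qed
  have ind: "indicator (\<Union>n. R n) x * cut_div \<delta> u x = cut_div \<delta> u x" for x
  proof (cases "(\<chi> k. x k) \<in> Dom")
    case False
    then show ?thesis by (simp add: cut_div_def on_Dom_def)
  next
    case True
    then show ?thesis using R_Un[OF True] by (simp only: indicator_simps mult_1)
  qed
  have "set_integrable P (\<Union>n. R n) (cut_div \<delta> u)"
    unfolding set_integrable_def using R_sets by (intro integrable_mult_indicator cut_div_integrable(1)[OF u C int \<delta>]) auto
  from lebesgue_integral_countable_add[OF R_sets R_disj this]
  have "(\<integral>x. indicator (\<Union>n. R n) x * cut_div \<delta> u x \<partial>P) = (\<Sum>n. \<integral>x. indicator (R n) x * cut_div \<delta> u x \<partial>P)"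
    by (simp add: set_lebesgue_integral_def)
  then show ?thesis by (simp only: ind R_zero suminf_zero)
qed

text \<open>As the cutoffs are removed, the divergence converges to \<open>D u - u \<Sum> g\<^sub>k\<close>, where \<open>k\<close> runs over the
  coordinates with nonzero flux; in the others \<open>g\<^sub>k\<close> is zero almost surely. The errors made by the cutoffs are
  dominated by multiples of \<open>|g\<^sub>k(X\<^sub>k)|\<close>.\<close>

theorem integration_by_parts:
  assumes u: "\<And>x. x \<in> Dom \<Longrightarrow> u differentiable (at x)" and C: "\<And>x. x \<in> Dom \<Longrightarrow> \<bar>u x\<bar> \<le> C"
    and int: "integrable P (on_Dom (flow_deriv u))"
  shows "(\<integral>x. on_Dom (flow_deriv u) x \<partial>P) = (\<integral>x. on_Dom (\<lambda>x. u x * (\<Sum>k\<in>UNIV. g k (x $ k))) x \<partial>P)"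
proof -
  note [measurable] = flow_deriv_meas[OF u]
  define \<delta> where "\<delta> n = 1 / real (Suc n)" for n
  have \<delta>: "\<delta> n > 0" for n by (simp add: \<delta>_def)
  define w where "w x = on_Dom u x * (\<Sum>k\<in>UNIV. (if x k \<in> I k then g k (x k) else 0))" for x
  have wm[measurable]: "w \<in> borel_measurable P" unfolding w_def[abs_def] by measurable
  have w_eq: "w x = on_Dom (\<lambda>x. u x * (\<Sum>k\<in>UNIV. g k (x $ k))) x" for x
    by (auto simp: w_def on_Dom_def Dom_def)
  have wint: "integrable P w"
  proof (rule Bochner_Integration.integrable_bound)
    show "integrable P (\<lambda>x. \<bar>C\<bar> * (\<Sum>k\<in>UNIV. \<bar>if x k \<in> I k then g k (x k) else 0\<bar>))" using gI_integrable by auto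
    show "AE x in P. norm (w x) \<le> norm (\<bar>C\<bar> * (\<Sum>k\<in>UNIV. \<bar>if x k \<in> I k then g k (x k) else 0\<bar>))"
    proof (rule AE_I2)
      fix x
      have "\<bar>on_Dom u x\<bar> \<le> \<bar>C\<bar>" using C[of "\<chi> k. x k"] by (auto simp: on_Dom_def)
      then have "\<bar>w x\<bar> \<le> \<bar>C\<bar> * (\<Sum>k\<in>UNIV. \<bar>if x k \<in> I k then g k (x k) else 0\<bar>)"
        unfolding w_def abs_mult by (intro mult_mono sum_abs) auto
      then show "norm (w x) \<le> norm (\<bar>C\<bar> * (\<Sum>k\<in>UNIV. \<bar>if x k \<in> I k then g k (x k) else 0\<bar>))" by (simp add: sum_nonneg)
    qed
  qed measurable
  have AEg: "AE x in P. \<forall>k. Gk k (x k) = 0 \<longrightarrow> x k \<in> I k \<longrightarrow> g k (x k) = 0"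
  proof -
    have "AE x in P. Gk k (x k) = 0 \<longrightarrow> x k \<in> I k \<longrightarrow> g k (x k) = 0" for k
      by (rule AE_coordinate) (use coordinate.g_zero_ae[OF coord, of k] in \<open>auto elim: eventually_mono\<close>)
    then show ?thesis by (simp add: AE_all_countable)
  qed
  have lim: "(\<lambda>n. \<integral>x. cut_div (\<delta> n) u x \<partial>P) \<longlonglongrightarrow> (\<integral>x. on_Dom (flow_deriv u) x - w x \<partial>P)"
  proof (rule integral_dominated_convergence)
    show "integrable P (\<lambda>x. \<bar>on_Dom (flow_deriv u) x\<bar> + \<bar>C\<bar> * (\<Sum>k\<in>UNIV. \<bar>if x k \<in> I k then g k (x k) else 0\<bar>))"
      using int gI_integrable by auto
    show "cut_div (\<delta> n) u \<in> borel_measurable P" for n using cut_div_integrable(1)[OF u C int \<delta>] by auto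
    show "AE x in P. norm (cut_div (\<delta> n) u x) \<le> \<bar>on_Dom (flow_deriv u) x\<bar> + \<bar>C\<bar> * (\<Sum>k\<in>UNIV. \<bar>if x k \<in> I k then g k (x k) else 0\<bar>)" for n
      using cut_div_integrable(2)[OF u C int \<delta>] by auto
    show "AE x in P. (\<lambda>n. cut_div (\<delta> n) u x) \<longlonglongrightarrow> on_Dom (flow_deriv u) x - w x"
      using AEg
    proof eventually_elim
      case (elim x)
      have cut: "(\<lambda>n. cut (\<delta> n) K x) \<longlonglongrightarrow> 1" for K
      proof -
        have "(\<lambda>n. cut (\<delta> n) K x) \<longlonglongrightarrow> (\<Prod>k\<in>K. 1)"
          unfolding cut_def \<delta>_def by (intro tendsto_prod cutoff_tendsto)
        then show ?thesis by simp
      qed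
      have step: "(\<lambda>n. soft_step (\<delta> n) \<bar>Gk k (x k)\<bar>) \<longlonglongrightarrow> (if \<bar>Gk k (x k)\<bar> > 0 then 1 else 0)" for k
        unfolding \<delta>_def by (rule soft_step_tendsto)
      have "(\<lambda>n. cut_div (\<delta> n) u x) \<longlonglongrightarrow> on_Dom (flow_deriv u) x * 1 - on_Dom u x *
          (\<Sum>k\<in>UNIV. (if \<bar>Gk k (x k)\<bar> > 0 then 1 else 0) * (if x k \<in> I k then g k (x k) else 0) * 1)"
        unfolding cut_div_def by (intro tendsto_intros cut step)
      also have "(\<Sum>k\<in>UNIV. (if \<bar>Gk k (x k)\<bar> > 0 then 1 else 0) * (if x k \<in> I k then g k (x k) else 0) * 1)
          = (\<Sum>k\<in>UNIV. (if x k \<in> I k then g k (x k) else 0))"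
        using elim by (intro sum.cong) auto
      finally show ?case by (simp add: w_def)
    qed
  qed measurable
  have "(\<integral>x. cut_div (\<delta> n) u x \<partial>P) = 0" for n by (rule integral_cut_div[OF u C int \<delta>])
  with lim have "(\<lambda>n. 0) \<longlonglongrightarrow> (\<integral>x. on_Dom (flow_deriv u) x - w x \<partial>P)" by simp
  from LIMSEQ_unique[OF tendsto_const this] have "(\<integral>x. on_Dom (flow_deriv u) x - w x \<partial>P) = 0" by simp
  then have "(\<integral>x. on_Dom (flow_deriv u) x \<partial>P) = (\<integral>x. w x \<partial>P)" using int wint by simp
  then show ?thesis by (simp only: w_eq)
qed

end

section \<open>Division by the derivative along the field\<close>

text \<open>A smooth bounded approximation of \<open>1 / z\<close>. Both it and its derivative are dominated by those of
  \<open>1 / z\<close>, which makes the two weights integrable majorants.\<close>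

definition reg_inv :: "real \<Rightarrow> real \<Rightarrow> real" where "reg_inv \<epsilon> z = z / (z\<^sup>2 + \<epsilon>)"

lemma reg_inv_has_derivative:
  assumes "\<epsilon> > 0"
  shows "(reg_inv \<epsilon> has_real_derivative (\<epsilon> - z\<^sup>2) / (z\<^sup>2 + \<epsilon>)\<^sup>2) (at z)"
proof -
  have "z\<^sup>2 + \<epsilon> \<noteq> 0" using assms zero_le_power2[of z] by linarith
  then show ?thesis unfolding reg_inv_def[abs_def]
    by (auto intro!: derivative_eq_intros simp: power2_eq_square algebra_simps)
qed

lemma reg_inv_bound:
  assumes "\<epsilon> > 0" shows "\<bar>reg_inv \<epsilon> z\<bar> \<le> 1 / sqrt \<epsilon>"
proof -
  have "0 \<le> (\<bar>z\<bar> - sqrt \<epsilon>)\<^sup>2 + \<bar>z\<bar> * sqrt \<epsilon>" using assms by simp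
  also have "\<dots> = z\<^sup>2 + \<epsilon> - \<bar>z\<bar> * sqrt \<epsilon>" using assms by (simp add: power2_diff)
  finally have "\<bar>z\<bar> * sqrt \<epsilon> \<le> z\<^sup>2 + \<epsilon>" by simp
  moreover have "z\<^sup>2 + \<epsilon> > 0" using assms zero_le_power2[of z] by linarith
  ultimately show ?thesis using assms by (simp add: reg_inv_def field_simps)
qed

lemma reg_inv_le_inverse:
  assumes "\<epsilon> > 0" "z \<noteq> 0" shows "\<bar>reg_inv \<epsilon> z\<bar> \<le> 1 / \<bar>z\<bar>"
proof -
  have p: "z\<^sup>2 + \<epsilon> > 0" using assms zero_le_power2[of z] by linarith
  have "\<bar>z\<bar> * \<bar>z\<bar> \<le> z\<^sup>2 + \<epsilon>" using assms by (simp add: power2_eq_square)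
  then show ?thesis using p assms by (simp add: reg_inv_def divide_le_eq field_simps)
qed

lemma reg_inv_deriv_le_inverse:
  fixes z \<epsilon> :: real
  assumes "\<epsilon> > 0" "z \<noteq> 0" shows "\<bar>(\<epsilon> - z\<^sup>2) / (z\<^sup>2 + \<epsilon>)\<^sup>2\<bar> \<le> 1 / z\<^sup>2"
proof -
  have z: "0 < z\<^sup>2" using assms(2) by (rule zero_less_power2[THEN iffD2])
  then have p: "z\<^sup>2 + \<epsilon> > 0" using assms by linarith
  have "\<bar>\<epsilon> - z\<^sup>2\<bar> \<le> z\<^sup>2 + \<epsilon>" using z assms(1) by linarith
  then have "\<bar>\<epsilon> - z\<^sup>2\<bar> * z\<^sup>2 \<le> (z\<^sup>2 + \<epsilon>) * (z\<^sup>2 + \<epsilon>)" using z assms(1) by (intro mult_mono) auto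
  then have le: "\<bar>\<epsilon> - z\<^sup>2\<bar> * z\<^sup>2 \<le> (z\<^sup>2 + \<epsilon>)\<^sup>2" by (simp only: power2_eq_square[of "z\<^sup>2 + \<epsilon>"])
  have div: "a / b \<le> 1 / c" if "a * c \<le> b" "b > 0" "c > 0" for a b c :: real
    using that by (simp add: field_simps)
  have "\<bar>\<epsilon> - z\<^sup>2\<bar> / (z\<^sup>2 + \<epsilon>)\<^sup>2 \<le> 1 / z\<^sup>2" by (rule div[OF le]) (use p z in simp_all)
  then show ?thesis by (simp add: abs_divide)
qed

lemma reg_inv_mult_bounds: assumes "\<epsilon> > 0" shows "0 \<le> z * reg_inv \<epsilon> z" "z * reg_inv \<epsilon> z \<le> 1"
proof -
  have "z\<^sup>2 + \<epsilon> > 0" using assms zero_le_power2[of z] by linarith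
  then show "0 \<le> z * reg_inv \<epsilon> z" "z * reg_inv \<epsilon> z \<le> 1"
    using assms by (simp_all add: reg_inv_def power2_eq_square[symmetric])
qed

lemma reg_inv_tendsto:
  assumes "z \<noteq> 0"
  shows "(\<lambda>n. reg_inv (inverse (real (Suc n))) z) \<longlonglongrightarrow> 1 / z"
    and "(\<lambda>n. (inverse (real (Suc n)) - z\<^sup>2) / (z\<^sup>2 + inverse (real (Suc n)))\<^sup>2) \<longlonglongrightarrow> - 1 / z\<^sup>2"
proof -
  have "(\<lambda>n. z / (z\<^sup>2 + inverse (real (Suc n)))) \<longlonglongrightarrow> z / (z\<^sup>2 + 0)"
    using assms by (intro tendsto_intros LIMSEQ_inverse_real_of_nat) auto
  then show "(\<lambda>n. reg_inv (inverse (real (Suc n))) z) \<longlonglongrightarrow> 1 / z"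
    using assms by (simp add: reg_inv_def power2_eq_square)
  have "(\<lambda>n. (inverse (real (Suc n)) - z\<^sup>2) / (z\<^sup>2 + inverse (real (Suc n)))\<^sup>2) \<longlonglongrightarrow> (0 - z\<^sup>2) / (z\<^sup>2 + 0)\<^sup>2"
    using assms by (intro tendsto_intros LIMSEQ_inverse_real_of_nat) auto
  then show "(\<lambda>n. (inverse (real (Suc n)) - z\<^sup>2) / (z\<^sup>2 + inverse (real (Suc n)))\<^sup>2) \<longlonglongrightarrow> - 1 / z\<^sup>2"
    using assms by (simp add: power2_eq_square)
qed

context product_law
begin

lemma nabla_eq_flow_deriv: "nabla p g u = flow_deriv u"
  by (auto simp: nabla_def flow_deriv_def)

lemma flow_deriv_compose:
  assumes x: "x \<in> Dom" and a: "a differentiable (at x)" and b: "b differentiable (at x)"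
    and \<phi>: "\<And>y. (\<phi> has_real_derivative \<phi>' y) (at y)" and \<psi>: "\<And>y. (\<psi> has_real_derivative \<psi>' y) (at y)"
  shows "(\<lambda>x. \<phi> (a x) * \<psi> (b x)) differentiable (at x)"
    and "flow_deriv (\<lambda>x. \<phi> (a x) * \<psi> (b x)) x = \<phi>' (a x) * flow_deriv a x * \<psi> (b x) + \<phi> (a x) * \<psi>' (b x) * flow_deriv b x"
proof -
  obtain a' b' where a': "(a has_derivative a') (at x)" and b': "(b has_derivative b') (at x)"
    using a b by (auto simp: differentiable_def)
  have A: "((\<lambda>x. \<phi> (a x)) has_derivative (\<lambda>h. \<phi>' (a x) * a' h)) (at x)"
    using has_derivative_compose[OF a' \<phi>[unfolded has_field_derivative_def]] .
  have B: "((\<lambda>x. \<psi> (b x)) has_derivative (\<lambda>h. \<psi>' (b x) * b' h)) (at x)"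
    using has_derivative_compose[OF b' \<psi>[unfolded has_field_derivative_def]] .
  note AB = has_derivative_mult[OF A B]
  show "(\<lambda>x. \<phi> (a x) * \<psi> (b x)) differentiable (at x)" using AB by (auto simp: differentiable_def)
  define d where "d = (\<chi> k. Lop (p k) (g k) (x $ k))"
  have fd: "flow_deriv u x = u' d" if "(u has_derivative u') (at x)" for u u'
    using has_derivative_partial_deriv(1)[OF that, of d] by (simp add: flow_deriv_def d_def)
  show "flow_deriv (\<lambda>x. \<phi> (a x) * \<psi> (b x)) x = \<phi>' (a x) * flow_deriv a x * \<psi> (b x) + \<phi> (a x) * \<psi>' (b x) * flow_deriv b x"
    unfolding fd[OF AB] fd[OF a'] fd[OF b'] by (simp add: algebra_simps)
qed

lemma measurable_Dom[measurable]: "Measurable.pred P (\<lambda>x. (\<chi> k. x k) \<in> Dom)"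
proof -
  have "(\<lambda>x. \<chi> k. x k) -` Dom \<inter> space P \<in> sets P"
    by (rule measurable_sets[OF vec_meas]) (use open_Dom in simp)
  then show ?thesis by (simp add: vimage_def pred_def)
qed

lemma on_Dom_compose_meas:
  assumes [measurable]: "on_Dom F \<in> borel_measurable P" "f \<in> borel_measurable borel"
  shows "on_Dom (\<lambda>x. f (F x)) \<in> borel_measurable P"
proof -
  have "(\<lambda>x. if (\<chi> k. x k) \<in> Dom then f (on_Dom F x) else 0) \<in> borel_measurable P" by measurable
  then show ?thesis by (rule measurable_cong[THEN iffD1, rotated]) (auto simp: on_Dom_def)
qed

lemma nabla_meas:
  assumes F: "\<And>x. x \<in> Dom \<Longrightarrow> F differentiable (at x)"
    and N: "\<And>x. x \<in> Dom \<Longrightarrow> nabla p g F differentiable (at x)"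
  shows "on_Dom F \<in> borel_measurable P" "on_Dom (nabla p g F) \<in> borel_measurable P"
    "on_Dom (nabla p g (nabla p g F)) \<in> borel_measurable P"
  using flow_deriv_meas[OF F] flow_deriv_meas[OF N] by (auto simp: nabla_eq_flow_deriv)

lemma on_Dom_weights:
  assumes x: "(\<chi> k. x k) \<in> Dom"
  shows "on_Dom (weight1 p g F) x = (\<Sum>k\<in>UNIV. if x k \<in> I k then g k (x k) else 0) / on_Dom (nabla p g F) x"
    and "on_Dom (weight2 p g F) x = on_Dom (nabla p g (nabla p g F)) x / (on_Dom (nabla p g F) x)\<^sup>2"
proof -
  have "(\<Sum>k\<in>UNIV. g k (x k)) = (\<Sum>k\<in>UNIV. if x k \<in> I k then g k (x k) else 0)"
    using x by (intro sum.cong) (auto simp: Dom_def)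
  then show "on_Dom (weight1 p g F) x = (\<Sum>k\<in>UNIV. if x k \<in> I k then g k (x k) else 0) / on_Dom (nabla p g F) x"
    using x by (simp add: on_Dom_def weight1_def)
  show "on_Dom (weight2 p g F) x = on_Dom (nabla p g (nabla p g F)) x / (on_Dom (nabla p g F) x)\<^sup>2"
    using x by (simp add: on_Dom_def weight2_def nabla_def[of p g "nabla p g F"])
qed

lemma weight_meas:
  assumes F: "\<And>x. x \<in> Dom \<Longrightarrow> F differentiable (at x)"
    and N: "\<And>x. x \<in> Dom \<Longrightarrow> nabla p g F differentiable (at x)"
  shows "on_Dom (weight1 p g F) \<in> borel_measurable P" "on_Dom (weight2 p g F) \<in> borel_measurable P"
proof -
  note [measurable] = nabla_meas[OF F N]
  let ?D = "\<lambda>x. (\<chi> k. x k) \<in> Dom"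
  have "(\<lambda>x. if ?D x then (\<Sum>k\<in>UNIV. if x k \<in> I k then g k (x k) else 0) / on_Dom (nabla p g F) x else 0) \<in> borel_measurable P"
    by measurable
  moreover have "(\<lambda>x. if ?D x then (\<Sum>k\<in>UNIV. if x k \<in> I k then g k (x k) else 0) / on_Dom (nabla p g F) x else 0) = on_Dom (weight1 p g F)"
    using on_Dom_weights(1) by (intro ext) (simp, simp add: on_Dom_def)
  ultimately show "on_Dom (weight1 p g F) \<in> borel_measurable P" by simp
  have "(\<lambda>x. if ?D x then on_Dom (nabla p g (nabla p g F)) x / (on_Dom (nabla p g F) x)\<^sup>2 else 0) \<in> borel_measurable P"
    by measurable
  moreover have "(\<lambda>x. if ?D x then on_Dom (nabla p g (nabla p g F)) x / (on_Dom (nabla p g F) x)\<^sup>2 else 0) = on_Dom (weight2 p g F)"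
    using on_Dom_weights(2) by (intro ext) (simp, simp add: on_Dom_def)
  ultimately show "on_Dom (weight2 p g F) \<in> borel_measurable P" by simp
qed

text \<open>Integration by parts for \<open>u = \<phi>(F) reg_inv \<epsilon> (\<nabla>\<^sub>F)\<close>: the derivative of \<open>u\<close> along the field consists of
  \<open>\<phi>'(F) \<nabla>\<^sub>F reg_inv \<epsilon> (\<nabla>\<^sub>F)\<close>, which tends to \<open>\<phi>'(F)\<close>, and a term that tends to \<open>- \<phi>(F)\<close> times the
  second weight, while \<open>u \<Sum> g\<^sub>k\<close> tends to \<open>\<phi>(F)\<close> times the first.\<close>

lemma weighted_integration_by_parts:
  fixes F :: "real ^ 'n \<Rightarrow> real"
  assumes F: "\<And>x. x \<in> Dom \<Longrightarrow> F differentiable (at x)"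
    and N: "\<And>x. x \<in> Dom \<Longrightarrow> nabla p g F differentiable (at x)"
    and nz: "AE x in P. nabla p g F (\<chi> k. x k) \<noteq> 0"
    and w1: "integrable P (on_Dom (weight1 p g F))" and w2: "integrable P (on_Dom (weight2 p g F))"
    and \<phi>: "\<And>y. (\<phi> has_real_derivative \<phi>' y) (at y)" and \<phi>'c: "continuous_on UNIV \<phi>'"
    and \<phi>b: "\<And>y. \<bar>\<phi> y\<bar> \<le> C" and \<phi>'b: "\<And>y. \<bar>\<phi>' y\<bar> \<le> C"
  shows "(\<integral>x. on_Dom (\<lambda>x. \<phi>' (F x)) x \<partial>P) =
         (\<integral>x. on_Dom (\<lambda>x. \<phi> (F x) * (weight1 p g F x + weight2 p g F x)) x \<partial>P)"
proof -
  interpret P: prob_space P by (rule prob_P)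
  let ?N = "nabla p g F"
  have C0: "C \<ge> 0" using \<phi>b[of 0] by linarith
  define \<epsilon> where "\<epsilon> n = inverse (real (Suc n))" for n
  have \<epsilon>: "\<epsilon> n > 0" for n by (simp add: \<epsilon>_def)
  define \<psi>' where "\<psi>' n z = (\<epsilon> n - z\<^sup>2) / (z\<^sup>2 + \<epsilon> n)\<^sup>2" for n z
  define u where "u n x = \<phi> (F x) * reg_inv (\<epsilon> n) (?N x)" for n x
  have [measurable]: "\<phi> \<in> borel_measurable borel" "\<phi>' \<in> borel_measurable borel"
    using \<phi>'c DERIV_continuous_on[of UNIV \<phi>, OF has_field_derivative_at_within[OF \<phi>]]
    by (auto intro: borel_measurable_continuous_onI)
  have [measurable]: "reg_inv e \<in> borel_measurable borel" "\<psi>' n \<in> borel_measurable borel" for e n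
    unfolding reg_inv_def[abs_def] \<psi>'_def[abs_def] by measurable
  note [measurable] = nabla_meas[OF F N]
  define S where "S x = (\<Sum>k\<in>UNIV. if x k \<in> I k then g k (x k) else 0)" for x :: "'n \<Rightarrow> real"
  have S_meas[measurable]: "S \<in> borel_measurable P" unfolding S_def[abs_def] by measurable
  have S: "(\<Sum>k\<in>UNIV. g k (x k)) = S x" if "(\<chi> k. x k) \<in> Dom" for x using that by (auto simp: S_def Dom_def)
  define D where "D x \<longleftrightarrow> (\<chi> k. x k) \<in> Dom" for x :: "'n \<Rightarrow> real"
  have D_meas[measurable]: "Measurable.pred P D" unfolding D_def[abs_def] by measurable
  define f1 where "f1 n x = (if D x then \<phi>' (on_Dom F x) * (on_Dom ?N x * reg_inv (\<epsilon> n) (on_Dom ?N x)) else 0)" for n x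
  define f2 where "f2 n x = (if D x then \<phi> (on_Dom F x) * (\<psi>' n (on_Dom ?N x) * on_Dom (nabla p g ?N) x) else 0)" for n x
  define f3 where "f3 n x = (if D x then \<phi> (on_Dom F x) * (reg_inv (\<epsilon> n) (on_Dom ?N x) * S x) else 0)" for n x
  have meas[measurable]: "f1 n \<in> borel_measurable P" "f2 n \<in> borel_measurable P" "f3 n \<in> borel_measurable P" for n
    unfolding f1_def[abs_def] f2_def[abs_def] f3_def[abs_def] by measurable
  have AE: "AE x in P. D x \<and> on_Dom ?N x \<noteq> 0"
    using nz AE_I by eventually_elim (auto simp: D_def on_Dom_def Dom_def)
  have W1: "on_Dom (weight1 p g F) x = S x / on_Dom ?N x" if "D x" for x
    using that on_Dom_weights(1)[of x F] by (simp add: D_def S_def)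
  have W2: "on_Dom (weight2 p g F) x = on_Dom (nabla p g ?N) x / (on_Dom ?N x)\<^sup>2" if "D x" for x
    using that on_Dom_weights(2)[of x F] by (simp add: D_def)
  have b1: "\<bar>f1 n x\<bar> \<le> C" for n x
  proof -
    have "\<bar>\<phi>' (on_Dom F x)\<bar> * \<bar>on_Dom ?N x * reg_inv (\<epsilon> n) (on_Dom ?N x)\<bar> \<le> C * 1"
      using reg_inv_mult_bounds[OF \<epsilon>, of "on_Dom ?N x" n] C0 by (intro mult_mono \<phi>'b) auto
    then show ?thesis using C0 by (auto simp: f1_def abs_mult)
  qed
  have b2: "\<bar>f2 n x\<bar> \<le> C * \<bar>on_Dom (weight2 p g F) x\<bar>" if "D x \<and> on_Dom ?N x \<noteq> 0" for n x
  proof -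
    have "\<bar>\<psi>' n (on_Dom ?N x)\<bar> * \<bar>on_Dom (nabla p g ?N) x\<bar> \<le> 1 / (on_Dom ?N x)\<^sup>2 * \<bar>on_Dom (nabla p g ?N) x\<bar>"
      using that unfolding \<psi>'_def by (intro mult_right_mono reg_inv_deriv_le_inverse \<epsilon>) auto
    also have "\<dots> = \<bar>on_Dom (weight2 p g F) x\<bar>" using that by (simp add: W2 abs_divide)
    finally have "\<bar>\<phi> (on_Dom F x)\<bar> * (\<bar>\<psi>' n (on_Dom ?N x)\<bar> * \<bar>on_Dom (nabla p g ?N) x\<bar>) \<le> C * \<bar>on_Dom (weight2 p g F) x\<bar>"
      using C0 by (intro mult_mono \<phi>b) auto
    then show ?thesis using that by (simp add: f2_def abs_mult)
  qed
  have b3: "\<bar>f3 n x\<bar> \<le> C * \<bar>on_Dom (weight1 p g F) x\<bar>" if "D x \<and> on_Dom ?N x \<noteq> 0" for n x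
  proof -
    have "\<bar>reg_inv (\<epsilon> n) (on_Dom ?N x)\<bar> * \<bar>S x\<bar> \<le> 1 / \<bar>on_Dom ?N x\<bar> * \<bar>S x\<bar>"
      using that by (intro mult_right_mono reg_inv_le_inverse \<epsilon>) auto
    also have "\<dots> = \<bar>on_Dom (weight1 p g F) x\<bar>" using that by (simp add: W1 abs_divide)
    finally have "\<bar>\<phi> (on_Dom F x)\<bar> * (\<bar>reg_inv (\<epsilon> n) (on_Dom ?N x)\<bar> * \<bar>S x\<bar>) \<le> C * \<bar>on_Dom (weight1 p g F) x\<bar>"
      using C0 by (intro mult_mono \<phi>b) auto
    then show ?thesis using that by (simp add: f3_def abs_mult)
  qed
  have i1: "integrable P (f1 n)" for n by (rule P.integrable_const_bound[where B=C]) (auto simp: b1)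
  have d2: "integrable P (\<lambda>x. C * \<bar>on_Dom (weight2 p g F) x\<bar>)" and d3: "integrable P (\<lambda>x. C * \<bar>on_Dom (weight1 p g F) x\<bar>)"
    using w1 w2 by auto
  have n2: "AE x in P. norm (f2 n x) \<le> C * \<bar>on_Dom (weight2 p g F) x\<bar>" and n3: "AE x in P. norm (f3 n x) \<le> C * \<bar>on_Dom (weight1 p g F) x\<bar>" for n
    using AE by (eventually_elim, simp add: b2, eventually_elim, simp add: b3)
  have i2: "integrable P (f2 n)" for n
    by (rule Bochner_Integration.integrable_bound[OF d2]) (use n2[of n] in \<open>auto elim!: eventually_mono\<close>)
  have uflow: "u n differentiable (at x)"
    "flow_deriv (u n) x = \<phi>' (F x) * ?N x * reg_inv (\<epsilon> n) (?N x) + \<phi> (F x) * \<psi>' n (?N x) * nabla p g ?N x" if x: "x \<in> Dom" for n x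
    using flow_deriv_compose[OF x F[OF x] N[OF x] \<phi> reg_inv_has_derivative[OF \<epsilon>[of n]]]
    unfolding u_def[abs_def] \<psi>'_def nabla_eq_flow_deriv[symmetric] by auto
  have ub: "\<bar>u n x\<bar> \<le> C * (1 / sqrt (\<epsilon> n))" for n x
    unfolding u_def abs_mult using C0 \<epsilon>[of n] by (intro mult_mono \<phi>b reg_inv_bound) auto
  have fl: "on_Dom (flow_deriv (u n)) = (\<lambda>x. f1 n x + f2 n x)" for n
    by (auto simp: on_Dom_def f1_def f2_def D_def uflow mult.assoc)
  have "(\<integral>x. on_Dom (flow_deriv (u n)) x \<partial>P) = (\<integral>x. on_Dom (\<lambda>x. u n x * (\<Sum>k\<in>UNIV. g k (x $ k))) x \<partial>P)" for n
  proof (rule integration_by_parts[OF uflow(1) ub])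
    show "integrable P (on_Dom (flow_deriv (u n)))" unfolding fl using i1 i2 by simp
  qed
  moreover have "on_Dom (\<lambda>x. u n x * (\<Sum>k\<in>UNIV. g k (x $ k))) = f3 n" for n
    using S by (auto simp: on_Dom_def f3_def D_def u_def)
  ultimately have eq: "(\<integral>x. f1 n x \<partial>P) + (\<integral>x. f2 n x \<partial>P) = (\<integral>x. f3 n x \<partial>P)" for n
    using i1 i2 unfolding fl by simp
  have [measurable]: "on_Dom (\<lambda>x. \<phi>' (F x)) \<in> borel_measurable P" by (rule on_Dom_compose_meas) measurable
  have [measurable]: "on_Dom (weight1 p g F) \<in> borel_measurable P" "on_Dom (weight2 p g F) \<in> borel_measurable P" using w1 w2 by auto
  have l1: "(\<lambda>n. \<integral>x. f1 n x \<partial>P) \<longlonglongrightarrow> (\<integral>x. on_Dom (\<lambda>x. \<phi>' (F x)) x \<partial>P)"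
  proof (rule integral_dominated_convergence[where w="\<lambda>_. C"])
    show "AE x in P. (\<lambda>n. f1 n x) \<longlonglongrightarrow> on_Dom (\<lambda>x. \<phi>' (F x)) x"
      using AE
    proof eventually_elim
      case (elim x)
      then have "(\<lambda>n. \<phi>' (on_Dom F x) * (on_Dom ?N x * reg_inv (\<epsilon> n) (on_Dom ?N x))) \<longlonglongrightarrow> \<phi>' (on_Dom F x) * (on_Dom ?N x * (1 / on_Dom ?N x))"
        unfolding \<epsilon>_def by (intro tendsto_intros reg_inv_tendsto) auto
      with elim show ?case by (simp add: f1_def) (simp add: D_def on_Dom_def)
    qed
  qed (auto simp: b1)
  have l2: "(\<lambda>n. \<integral>x. f2 n x \<partial>P) \<longlonglongrightarrow> (\<integral>x. - (\<phi> (on_Dom F x) * on_Dom (weight2 p g F) x) \<partial>P)"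
  proof (rule integral_dominated_convergence[OF _ _ d2 _ n2])
    show "AE x in P. (\<lambda>n. f2 n x) \<longlonglongrightarrow> - (\<phi> (on_Dom F x) * on_Dom (weight2 p g F) x)"
      using AE
    proof eventually_elim
      case (elim x)
      then have "(\<lambda>n. \<phi> (on_Dom F x) * (\<psi>' n (on_Dom ?N x) * on_Dom (nabla p g ?N) x)) \<longlonglongrightarrow> \<phi> (on_Dom F x) * ((- 1 / (on_Dom ?N x)\<^sup>2) * on_Dom (nabla p g ?N) x)"
        unfolding \<epsilon>_def \<psi>'_def by (intro tendsto_intros reg_inv_tendsto) auto
      with elim show ?case by (simp add: f2_def W2)
    qed
  qed measurable
  have l3: "(\<lambda>n. \<integral>x. f3 n x \<partial>P) \<longlonglongrightarrow> (\<integral>x. \<phi> (on_Dom F x) * on_Dom (weight1 p g F) x \<partial>P)"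
  proof (rule integral_dominated_convergence[OF _ _ d3 _ n3])
    show "AE x in P. (\<lambda>n. f3 n x) \<longlonglongrightarrow> \<phi> (on_Dom F x) * on_Dom (weight1 p g F) x"
      using AE
    proof eventually_elim
      case (elim x)
      then have "(\<lambda>n. \<phi> (on_Dom F x) * (reg_inv (\<epsilon> n) (on_Dom ?N x) * S x)) \<longlonglongrightarrow> \<phi> (on_Dom F x) * ((1 / on_Dom ?N x) * S x)"
        unfolding \<epsilon>_def by (intro tendsto_intros reg_inv_tendsto) auto
      with elim show ?case by (simp add: f3_def W1)
    qed
  qed measurable
  have I: "integrable P (\<lambda>x. \<phi> (on_Dom F x) * h x)" if h: "integrable P h" for h
  proof -
    have [measurable]: "h \<in> borel_measurable P" using h by auto
    have "integrable P (\<lambda>x. C * \<bar>h x\<bar>)" using h by auto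
    then show ?thesis
    proof (rule Bochner_Integration.integrable_bound)
      show "AE x in P. norm (\<phi> (on_Dom F x) * h x) \<le> norm (C * \<bar>h x\<bar>)"
        using \<phi>b C0 by (auto simp: abs_mult intro!: mult_right_mono)
    qed measurable
  qed
  have "(\<integral>x. on_Dom (\<lambda>x. \<phi>' (F x)) x \<partial>P) + (\<integral>x. - (\<phi> (on_Dom F x) * on_Dom (weight2 p g F) x) \<partial>P)
      = (\<integral>x. \<phi> (on_Dom F x) * on_Dom (weight1 p g F) x \<partial>P)"
    using tendsto_add[OF l1 l2] l3 unfolding eq by (rule LIMSEQ_unique)
  then have "(\<integral>x. on_Dom (\<lambda>x. \<phi>' (F x)) x \<partial>P)
      = (\<integral>x. \<phi> (on_Dom F x) * on_Dom (weight1 p g F) x + \<phi> (on_Dom F x) * on_Dom (weight2 p g F) x \<partial>P)"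
    using I[OF w1] I[OF w2] by simp
  also have "\<dots> = (\<integral>x. on_Dom (\<lambda>x. \<phi> (F x) * (weight1 p g F x + weight2 p g F x)) x \<partial>P)"
    by (intro Bochner_Integration.integral_cong refl) (auto simp: on_Dom_def distrib_left)
  finally show ?thesis .
qed

lemma nabla_differentiable:
  fixes F :: "real ^ 'n \<Rightarrow> real"
  assumes F: "Ck_on 2 Dom F" and x: "x \<in> Dom"
  shows "F differentiable (at x)" "nabla p g F differentiable (at x)"
proof -
  have F2: "F differentiable_on Dom" "\<And>k. partial_deriv k F differentiable_on Dom"
    using F by (auto simp: numeral_2_eq_2)
  then show "F differentiable (at x)" using x open_Dom by (simp add: differentiable_on_eq_differentiable_at)
  have pd: "partial_deriv k F differentiable (at x)" for k
    using F2(2)[of k] x open_Dom by (simp add: differentiable_on_eq_differentiable_at)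
  have L: "(\<lambda>x. Lop (p k) (g k) (x $ k)) differentiable (at x)" for k
  proof -
    have "Lop (p k) (g k) differentiable (at (x $ k))"
      using x by (intro coordinate.Lop_differentiable[OF coord]) (auto simp: Dom_def)
    moreover have "(\<lambda>x :: real ^ 'n. x $ k) differentiable (at x)"
      by (rule bounded_linear_imp_differentiable) (rule bounded_linear_vec_nth)
    ultimately show ?thesis
      using differentiable_chain_at[of "\<lambda>x :: real ^ 'n. x $ k" x "Lop (p k) (g k)"] by (simp add: o_def)
  qed
  show "nabla p g F differentiable (at x)"
    unfolding nabla_def[abs_def] by (intro differentiable_sum ballI differentiable_mult pd L) simp
qed

end

section \<open>Density and score of a smooth functional\<close>

theorem proposition3p2:
  fixes M :: "'a measure"
    and X :: "'n::finite \<Rightarrow> 'a \<Rightarrow> real"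
    and I :: "'n \<Rightarrow> real set"
    and p g :: "'n \<Rightarrow> real \<Rightarrow> real"
    and F :: "real ^ 'n \<Rightarrow> real"
  assumes "prob_space M"
    and "prob_space.indep_vars M (\<lambda>_. borel) X UNIV"
    and "\<And>k. integrable M (X k)"
    and "\<And>k. integrable M (\<lambda>\<omega>. (X k \<omega>)\<^sup>2)"
    and "\<And>k. prob_space.expectation M (X k) = 0"
    and "\<And>k. prob_space.variance M (X k) = 1"
    and "\<And>k. open (I k)"
    and "\<And>k. connected (I k)"
    and "\<And>k. distributed M lborel (X k) (\<lambda>x. ennreal (p k x))"
    and "\<And>k x. x \<in> I k \<Longrightarrow> p k x > 0"
    and "\<And>k x. x \<notin> I k \<Longrightarrow> p k x = 0"
    and "\<And>k. p k differentiable_on I k"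
    and "Ck_on 2 {x. \<forall>k. x $ k \<in> I k} F"
    and "(\<lambda>\<omega>. F (random_vec X \<omega>)) \<in> borel_measurable M"
    and "integrable M (\<lambda>\<omega>. (F (random_vec X \<omega>))\<^sup>2)"
    and "\<And>k. continuous_on (I k) (g k)"
    and "\<And>k. integrable M (\<lambda>\<omega>. g k (X k \<omega>))"
    and "\<And>k. prob_space.expectation M (\<lambda>\<omega>. g k (X k \<omega>)) = 0"
    and "AE \<omega> in M. nabla p g F (random_vec X \<omega>) \<noteq> 0"
    and "integrable M (\<lambda>\<omega>. weight1 p g F (random_vec X \<omega>))"
    and "integrable M (\<lambda>\<omega>. weight2 p g F (random_vec X \<omega>))"
  shows "let Y = (\<lambda>\<omega>. F (random_vec X \<omega>));
             H = (\<lambda>\<omega>. weight1 p g F (random_vec X \<omega>) + weight2 p g F (random_vec X \<omega>));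
             pF = weighted_tail M Y H
         in distributed M lborel Y (\<lambda>x. ennreal (pF x)) \<and>
            (\<forall>x. pF x \<ge> 0) \<and>
            abs_continuous_fun pF \<and>
            (AE x in distr M borel Y. pF x > 0 \<and> pF differentiable (at x)) \<and>
            (\<exists>h. cond_exp_version M Y H h) \<and>
            (\<forall>h. cond_exp_version M Y H h \<longrightarrow>
               (AE x in distr M borel Y. score pF x = - h x))"
proof -
  interpret prob_space M by fact
  note openI = assms(7) and distX = assms(9) and p_pos = assms(10) and p_zero = assms(11)
    and g_cont = assms(16) and Y_meas = assms(14) and W1 = assms(20) and W2 = assms(21)
  have X_meas[measurable]: "X k \<in> borel_measurable M" for k
    using distX[of k] by (auto simp: distributed_def)
  have p_nonneg: "0 \<le> p k x" for k x using p_pos[of x k] p_zero[of x k] by (cases "x \<in> I k") auto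
  have [measurable]: "p k \<in> borel_measurable borel" for k
  proof -
    have "(\<lambda>x. enn2real (ennreal (p k x))) \<in> borel_measurable lborel"
      using distX[of k] by (intro measurable_compose[OF _ borel_measurable_enn2real]) (auto simp: distributed_def)
    then show ?thesis by (simp add: p_nonneg)
  qed
  have lawX: "distr M borel (X k) = density lborel (\<lambda>x. ennreal (p k x))" for k
  proof -
    have "distr M borel (X k) = distr M lborel (X k)" by (rule distr_cong) auto
    then show ?thesis using distX[of k] by (simp add: distributed_def)
  qed
  have AE_X: "AE \<omega> in M. \<forall>k. X k \<omega> \<in> I k"
  proof -
    have "AE \<omega> in M. X k \<omega> \<in> I k" for k
    proof -
      have [measurable]: "I k \<in> sets borel" using openI by simp
      have "AE x in density lborel (\<lambda>x. ennreal (p k x)). x \<in> I k"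
      proof (subst AE_density)
        have "x \<in> I k" if "0 < ennreal (p k x)" for x using that p_zero[of x k] by (cases "x \<in> I k") auto
        then show "AE x in lborel. 0 < ennreal (p k x) \<longrightarrow> x \<in> I k" by (intro AE_I2 impI)
      qed simp
      then have "AE x in distr M borel (X k). x \<in> I k" unfolding lawX .
      then show ?thesis by (subst (asm) AE_distr_iff) auto
    qed
    then show ?thesis by (simp add: AE_all_countable)
  qed
  define gI where "gI k x = (if x \<in> I k then g k x else 0)" for k x
  have [measurable]: "gI k \<in> borel_measurable borel" for k
  proof -
    have "(\<lambda>x. indicator (I k) x *\<^sub>R g k x) \<in> borel_measurable borel"
      using openI by (intro borel_measurable_continuous_on_indicator g_cont) auto
    then show ?thesis by (rule measurable_cong[THEN iffD1, rotated]) (auto simp: indicator_def gI_def)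
  qed
  have gp: "p k x * gI k x = g k x * p k x" for k x
    using p_zero[of x k] by (cases "x \<in> I k") (auto simp: gI_def)
  have gX: "AE \<omega> in M. gI k (X k \<omega>) = g k (X k \<omega>)" for k
    using AE_X by eventually_elim (simp add: gI_def)
  have [measurable]: "(\<lambda>\<omega>. g k (X k \<omega>)) \<in> borel_measurable M" for k using assms(17)[of k] by auto
  have "integrable M (\<lambda>\<omega>. gI k (X k \<omega>))" for k
    using assms(17)[of k] gX[of k] by (subst integrable_cong_AE[where g="\<lambda>\<omega>. g k (X k \<omega>)"]) auto
  then have "integrable (distr M borel (X k)) (gI k)" for k by (subst integrable_distr_eq) auto
  then have gp_int: "integrable lborel (\<lambda>x. g k x * p k x)" for k
    unfolding lawX by (subst (asm) integrable_real_density) (auto simp: p_nonneg gp)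
  have "0 = (\<integral>\<omega>. gI k (X k \<omega>) \<partial>M)" for k
    using assms(18)[of k] gX[of k] by (subst integral_cong_AE[where g="\<lambda>\<omega>. g k (X k \<omega>)"]) auto
  also have "(\<integral>\<omega>. gI k (X k \<omega>) \<partial>M) = (\<integral>x. gI k x \<partial>distr M borel (X k))" for k
    by (subst integral_distr) auto
  also have "(\<integral>x. gI k x \<partial>distr M borel (X k)) = (LBINT x. g k x * p k x)" for k
    unfolding lawX by (subst integral_real_density) (auto simp: p_nonneg gp)
  finally have gp_zero: "(LBINT x. g k x * p k x) = 0" for k by simp
  have p_nn: "(\<integral>\<^sup>+x. ennreal (p k x) \<partial>lborel) = 1" for k
  proof -
    interpret Xk: prob_space "distr M borel (X k)" by (rule prob_space_distr) simp
    show ?thesis using Xk.emeasure_space_1 unfolding lawX by (simp add: emeasure_density)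
  qed
  have p_int: "integrable lborel (p k)" for k
    using p_nn[of k] by (intro integrableI_nonneg) (auto simp: p_nonneg)
  have p_one: "(LBINT x. p k x) = 1" for k
    using p_nn[of k] by (simp add: integral_eq_nn_integral p_nonneg)
  interpret L: product_law p g I
  proof (intro product_law.intro coordinate.intro)
  qed (fact assms(8) assms(12) openI p_pos p_zero g_cont p_int gp_int gp_zero p_one)+
  have Dom: "{x. \<forall>k. x $ k \<in> I k} = L.Dom" by (simp add: L.Dom_def)
  define T where "T \<omega> = (\<lambda>k. X k \<omega>)" for \<omega>
  have T_meas[measurable]: "T \<in> M \<rightarrow>\<^sub>M L.P"
    unfolding measurable_cong_sets[OF refl L.sets_P'] T_def[abs_def] by (rule measurable_PiM_single') (auto simp: space_PiM)
  have lawT: "distr M L.P T = L.P"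
  proof -
    have "distr M (PiM UNIV (\<lambda>_. borel)) (\<lambda>x. \<lambda>i\<in>UNIV. X i x) = PiM UNIV (\<lambda>i. distr M borel (X i))"
      using assms(2) by (subst indep_vars_iff_distr_eq_PiM[symmetric]) auto
    moreover have "PiM UNIV (\<lambda>i. distr M borel (X i)) = L.P" by (simp add: lawX L.P_def)
    moreover have "distr M L.P T = distr M (PiM UNIV (\<lambda>_. borel)) (\<lambda>x. \<lambda>i\<in>UNIV. X i x)"
      by (rule distr_cong) (auto simp: L.sets_P' T_def)
    ultimately show ?thesis by simp
  qed
  have rv: "random_vec X \<omega> = (\<chi> k. T \<omega> k)" for \<omega> by (simp add: random_vec_def T_def)
  have on_Dom_rv: "AE \<omega> in M. L.on_Dom h (T \<omega>) = h (random_vec X \<omega>)" for h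
    using AE_X by eventually_elim (simp add: L.on_Dom_def rv L.Dom_def T_def)
  have transfer: "integrable L.P (L.on_Dom h)"
    if h: "integrable M (\<lambda>\<omega>. h (random_vec X \<omega>))" and m[measurable]: "L.on_Dom h \<in> borel_measurable L.P" for h
  proof -
    have [measurable]: "(\<lambda>\<omega>. h (random_vec X \<omega>)) \<in> borel_measurable M" using h by auto
    have "integrable M (\<lambda>\<omega>. L.on_Dom h (T \<omega>))"
      using h on_Dom_rv[of h] by (subst integrable_cong_AE[where g="\<lambda>\<omega>. h (random_vec X \<omega>)"]) auto
    then have "integrable (distr M L.P T) (L.on_Dom h)" by (subst integrable_distr_eq) auto
    then show ?thesis by (simp add: lawT)
  qed
  have transfer_integral: "(\<integral>\<omega>. h (random_vec X \<omega>) \<partial>M) = (\<integral>x. L.on_Dom h x \<partial>L.P)"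
    if [measurable]: "(\<lambda>\<omega>. h (random_vec X \<omega>)) \<in> borel_measurable M" and [measurable]: "L.on_Dom h \<in> borel_measurable L.P" for h
  proof -
    have "(\<integral>\<omega>. h (random_vec X \<omega>) \<partial>M) = (\<integral>\<omega>. L.on_Dom h (T \<omega>) \<partial>M)"
      using on_Dom_rv[of h] by (intro integral_cong_AE) auto
    also have "\<dots> = (\<integral>x. L.on_Dom h x \<partial>distr M L.P T)" by (subst integral_distr) auto
    finally show ?thesis by (simp add: lawT)
  qed
  have F_diff: "F differentiable (at x)" "nabla p g F differentiable (at x)" if "x \<in> L.Dom" for x
    using L.nabla_differentiable[of F x] assms(13) that unfolding Dom by auto
  note [measurable] = L.nabla_meas[OF F_diff] L.weight_meas[OF F_diff]
  have nz: "AE x in L.P. nabla p g F (\<chi> k. x k) \<noteq> 0"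
  proof -
    have "AE \<omega> in M. L.on_Dom (nabla p g F) (T \<omega>) \<noteq> 0"
      using assms(19) on_Dom_rv[of "nabla p g F"] by eventually_elim simp
    then have "AE x in distr M L.P T. L.on_Dom (nabla p g F) x \<noteq> 0"
    proof (subst AE_distr_iff[OF T_meas])
      show "{x \<in> space L.P. L.on_Dom (nabla p g F) x \<noteq> 0} \<in> sets L.P" by measurable
    qed
    then have "AE x in L.P. L.on_Dom (nabla p g F) x \<noteq> 0" unfolding lawT .
    then show ?thesis by eventually_elim (auto simp: L.on_Dom_def split: if_splits)
  qed
  have w1: "integrable L.P (L.on_Dom (weight1 p g F))" by (rule transfer[OF W1]) measurable
  have w2: "integrable L.P (L.on_Dom (weight2 p g F))" by (rule transfer[OF W2]) measurable
  let ?Y = "\<lambda>\<omega>. F (random_vec X \<omega>)"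
  let ?H = "\<lambda>\<omega>. weight1 p g F (random_vec X \<omega>) + weight2 p g F (random_vec X \<omega>)"
  interpret B: density_by_parts M ?Y ?H
  proof (unfold_locales)
    show "?Y \<in> borel_measurable M" by (rule Y_meas)
    show "integrable M ?H" using W1 W2 by simp
    fix \<phi> \<phi>' :: "real \<Rightarrow> real" and C
    assume \<phi>: "\<And>x. (\<phi> has_real_derivative \<phi>' x) (at x)" and \<phi>'c: "continuous_on UNIV \<phi>'"
      and b: "\<And>x. \<bar>\<phi> x\<bar> \<le> C" "\<And>x. \<bar>\<phi>' x\<bar> \<le> C"
    have [measurable]: "\<phi> \<in> borel_measurable borel" "\<phi>' \<in> borel_measurable borel"
      using \<phi>'c DERIV_continuous_on[of UNIV \<phi>, OF has_field_derivative_at_within[OF \<phi>]]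
      by (auto intro: borel_measurable_continuous_onI)
    note [measurable] = Y_meas
    have [measurable]: "(\<lambda>\<omega>. weight1 p g F (random_vec X \<omega>)) \<in> borel_measurable M"
      "(\<lambda>\<omega>. weight2 p g F (random_vec X \<omega>)) \<in> borel_measurable M" using W1 W2 by auto
    have [measurable]: "L.on_Dom (\<lambda>x. \<phi> (F x)) \<in> borel_measurable L.P" "L.on_Dom (\<lambda>x. \<phi>' (F x)) \<in> borel_measurable L.P"
      by (rule L.on_Dom_compose_meas; measurable)+
    have "(\<lambda>x. L.on_Dom (\<lambda>x. \<phi> (F x)) x * (L.on_Dom (weight1 p g F) x + L.on_Dom (weight2 p g F) x)) \<in> borel_measurable L.P"
      by measurable
    moreover have "(\<lambda>x. L.on_Dom (\<lambda>x. \<phi> (F x)) x * (L.on_Dom (weight1 p g F) x + L.on_Dom (weight2 p g F) x)) =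
        L.on_Dom (\<lambda>x. \<phi> (F x) * (weight1 p g F x + weight2 p g F x))"
      by (auto simp: L.on_Dom_def)
    ultimately have [measurable]: "L.on_Dom (\<lambda>x. \<phi> (F x) * (weight1 p g F x + weight2 p g F x)) \<in> borel_measurable L.P" by simp
    have "(\<integral>\<omega>. \<phi>' (?Y \<omega>) \<partial>M) = (\<integral>x. L.on_Dom (\<lambda>x. \<phi>' (F x)) x \<partial>L.P)"
      by (rule transfer_integral) measurable
    also have "\<dots> = (\<integral>x. L.on_Dom (\<lambda>x. \<phi> (F x) * (weight1 p g F x + weight2 p g F x)) x \<partial>L.P)"
      by (rule L.weighted_integration_by_parts[OF F_diff nz w1 w2 \<phi> \<phi>'c b])
    also have "\<dots> = (\<integral>\<omega>. \<phi> (?Y \<omega>) * ?H \<omega> \<partial>M)"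
      by (rule transfer_integral[symmetric]) measurable
    finally show "(\<integral>\<omega>. \<phi>' (?Y \<omega>) \<partial>M) = (\<integral>\<omega>. \<phi> (?Y \<omega>) * ?H \<omega> \<partial>M)" .
  qed
  show ?thesis
    unfolding Let_def B.dens_def[symmetric] using B.density_and_score by (intro conjI)
qed

end
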